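(* Let $T$, $(\Omega,\mathcal F,\mathbb P)$, $(\mathcal F_t)_{t\in[0,T]}$, $V$, $H$, $A$, $(\lambda_n)_{n\in\mathbb N}$, $(e_n)_{n\in\mathbb N}$, $F$, $O$, $\xi$, $\gamma\in[\frac12,1)$ and $\theta\in(0,\frac12]$ satisfy all the standing assumptions listed in the context. Let $X\colon[0,T]\times\Omega\to D((-A)^\gamma)$ be the unique adapted stochastic process with continuous sample paths satisfying $$X_t(\omega)=e^{At}\xi(\omega)+\int_0^t e^{A(t-s)}F(X_s(\omega))\,ds+O_t(\omega)\qquad\text{for all }t\in[0,T],\ \omega\in\Omega.$$ For $N,M\in\mathbb N$ and $m\in\{0,1,\ldots,M\}$ let $Y^{N,M}_m\colon\Omega\to H_N$ be defined by $Y^{N,M}_0(\omega):=P_N(\xi(\omega))+P_N(O_0(\omega))$ and, for $m\in\{0,1,\ldots,M-1\}$, $$Y^{N,M}_{m+1}(\omega):=e^{A\frac TM}\Big(Y^{N,M}_m(\omega)+\tfrac TM\, P_N\big(F(Y^{N,M}_m(\omega))\big)\Big)+P_N\Big(O_{\frac{(m+1)T}{M}}(\omega)-e^{A\frac TM}O_{\frac{mT}{M}}(\omega)\Big),\qquad\omega\in\Omega.$$ Then there is a real number $C>0$ such that $$\Big(\mathbb E\Big[\big\|X_{\frac{mT}{M}}-Y^{N,M}_m\big\|_H^2\Big]\Big)^{1/2}\le C\left(\frac{1}{(\lambda_N)^\gamma}+\frac{1+\log(M)}{M^{2\theta}}\right)$$ holds for every $m\in\{0,1,\ldots,M\}$ and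 every $N,M\in\mathbb N$.
   Context: Standing setting. $\mathbb N=\{1,2,\ldots\}$; $T\in(0,\infty)$; $(\Omega,\mathcal F,\mathbb P)$ is a probability space with a normal filtration $(\mathcal F_t)_{t\in[0,T]}$, i.e. $\bigcap_{s>t}\mathcal F_s=\mathcal F_t$ for all $t\in[0,T)$ and $\{B\in\mathcal F:\mathbb P[B]=0\}\subset\mathcal F_0$. $(V,\|\cdot\|_V)$ is a separable $\mathbb R$-Banach space and $(H,\langle\cdot,\cdot\rangle_H,\|\cdot\|_H)$ is a separable $\mathbb R$-Hilbert space with $V\subset H$ continuously. For a Banach space $W$, $L(W)$ denotes the bounded linear operators $W\to W$ and $L^{(2)}(W)$ the bounded bilinear maps $W\times W\to W$, with their usual norms. $\log$ is the natural logarithm. Linear operator: $(\lambda_n)_{n\in\mathbb N}\subset(0,\infty)$ is an increasing sequence of real numbers, $(e_n)_{n\in\mathbb N}\subset H$ is an orthonormal basis of $H$, and $A\colon D(A)\subset H\to H$ is given by $Av=\sum_{n=1}^\infty-\lambda_n\langle e_n,v\rangle_He_n$ for $v\in D(A)=\{w\in H:\sum_{n=1}^\infty|\lambda_n|^2|\langle e_n,w\rangle_H|^2<\infty\}$. Thus $e^{At}v=\sum_{n=1}^\infty e^{-\lambda_nt}\langle e_n,v\rangle_He_n$ for $t\ge0$, $v\in H$. For $r\ge 0$, $D((-A)^r)=\{v\in H:\sum_{n=1}^\infty\lambda_n^{2r}|\langle e_n,v\rangle_H|^2<\infty\}$, $(-A)^rv=\sum_{n=1}^\infty\lambda_n^r\langle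 e_n,v\rangle_He_n$, with norm $\|v\|_{D((-A)^r)}=\|(-A)^rv\|_H$. Nonlinearity: $D((-A)^{1/2})\subset V$ continuously, and $F\colon V\to V$ is twice continuously Fréchet differentiable such that, for some real number $c\in[0,\infty)$, for all $v,w\in V$ and all $u\in D((-A)^{1/2})$, $$\|F'(v)w\|_H\le c\|w\|_H,\quad\|F'(v)\|_{L(V)}\le c,\quad\|F''(v)\|_{L^{(2)}(V)}\le c,$$ $$\|(F'(u))^*\|_{L(D((-A)^{1/2}))}\le c\big(1+\|u\|_{D((-A)^{1/2})}\big).$$ Here, by the first inequality, $F'(v)$ extends to a bounded linear operator on $H$ for each $v\in V$; $(F'(v))^*\in L(H)$ is the adjoint of this operator with respect to $\langle\cdot,\cdot\rangle_H$, and the last condition means that for $u\in D((-A)^{1/2})$ this adjoint maps $D((-A)^{1/2})$ into itself with the stated norm bound. Stochastic process: $\gamma\in[\frac12,1)$ and $\theta\in(0,\frac12]$ are given real numbers and $O\colon[0,T]\times\Omega\to D((-A)^\gamma)$ is a centered (mean zero) stochastic process, adapted to $(\mathcal F_t)_{t\in[0,T]}$, with continuous sample paths, such that $O_{t_2}-e^{A(t_2-t_1)}O_{t_1}$ is independent of $\mathcal F_{t_1}$ for all $0\le t_1<t_2\le T$ and $$\mathbb E\Big[\sup_{0\le t\le T}\|(-A)^\gamma O_t\|_H^4\Big]+\sup_{0\le t_1<t_2\le T}\Big((t_2-t_1)^{-4\theta}\,\mathbb E\big[\|O_{t_2}-O_{t_1}\|_V^4\big]\Big)<\infty.$$ Initial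 value: $\xi\colon\Omega\to D(A)$ is $\mathcal F_0/\mathcal B(D(A))$-measurable with $\mathbb E[\|A\xi\|_H^4]<\infty$. Under these assumptions the process $X$ in the claim exists and is unique. Projections: for $N\in\mathbb N$, $P_N\colon H\to H$ is $P_N(v)=\sum_{n=1}^N\langle e_n,v\rangle_He_n$ and $H_N:=P_N(H)$ (a finite-dimensional subspace contained in $D(A)\subset V$). *)

theory Defs
  imports "HOL-Probability.Probability"
begin

text \<open>
  Sequences over the positive integers are functions on \<^typ>\<open>nat\<close> whose value at \<open>0\<close> is
  irrelevant; hence a series from \<open>n = 1\<close> to infinity is written with index \<open>Suc n\<close>.
  The space \<open>H\<close> is a type of sort \<open>{real_inner, banach, second_countable_topology}\<close>
  (for a metric space, separable and second countable agree). \<open>A\<close> is the diagonal operator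
  \<open>gen lam e\<close> with eigenvalues \<open>- lam n\<close> and domain \<open>gen_dom lam e\<close>. All functions on
  \<open>D(A)\<close> or \<open>D((-A)\<^sup>r)\<close> are total on \<open>H\<close>, with no meaning outside the domain.
\<close>

definition orthonormal_basis :: "(nat \<Rightarrow> 'h::real_inner) \<Rightarrow> bool" where
  "orthonormal_basis e \<longleftrightarrow>
     (\<forall>m\<ge>1. \<forall>n\<ge>1. e m \<bullet> e n = (if m = n then 1 else 0)) \<and>
     closure (span (e ` {1..})) = UNIV"

definition gen_dom :: "(nat \<Rightarrow> real) \<Rightarrow> (nat \<Rightarrow> 'h::real_inner) \<Rightarrow> 'h set" where
  "gen_dom lam e = {w. summable (\<lambda>n. \<bar>lam (Suc n)\<bar>\<^sup>2 * \<bar>e (Suc n) \<bullet> w\<bar>\<^sup>2)}"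

definition gen :: "(nat \<Rightarrow> real) \<Rightarrow> (nat \<Rightarrow> 'h::real_inner) \<Rightarrow> 'h \<Rightarrow> 'h" where
  "gen lam e v = (\<Sum>n. (- lam (Suc n) * (e (Suc n) \<bullet> v)) *\<^sub>R e (Suc n))"

definition semigrp :: "(nat \<Rightarrow> real) \<Rightarrow> (nat \<Rightarrow> 'h::real_inner) \<Rightarrow> real \<Rightarrow> 'h \<Rightarrow> 'h" where
  "semigrp lam e t v = (\<Sum>n. (exp (- lam (Suc n) * t) * (e (Suc n) \<bullet> v)) *\<^sub>R e (Suc n))"

text \<open>\<open>D((-A)\<^sup>r)\<close> carries the topology and Borel sigma-algebra of its own norm, not the
  ones inherited from \<open>H\<close>.\<close>

definition frac_dom :: "(nat \<Rightarrow> real) \<Rightarrow> (nat \<Rightarrow> 'h::real_inner) \<Rightarrow> real \<Rightarrow> 'h set" where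
  "frac_dom lam e r = {v. summable (\<lambda>n. lam (Suc n) powr (2 * r) * \<bar>e (Suc n) \<bullet> v\<bar>\<^sup>2)}"

definition frac_pow :: "(nat \<Rightarrow> real) \<Rightarrow> (nat \<Rightarrow> 'h::real_inner) \<Rightarrow> real \<Rightarrow> 'h \<Rightarrow> 'h" where
  "frac_pow lam e r v = (\<Sum>n. (lam (Suc n) powr r * (e (Suc n) \<bullet> v)) *\<^sub>R e (Suc n))"

definition frac_norm :: "(nat \<Rightarrow> real) \<Rightarrow> (nat \<Rightarrow> 'h::real_inner) \<Rightarrow> real \<Rightarrow> 'h \<Rightarrow> real" where
  "frac_norm lam e r v = norm (frac_pow lam e r v)"

definition frac_topology ::
    "(nat \<Rightarrow> real) \<Rightarrow> (nat \<Rightarrow> 'h::real_inner) \<Rightarrow> real \<Rightarrow> 'h topology" where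
  "frac_topology lam e r =
     Metric_space.mtopology (frac_dom lam e r) (\<lambda>v w. frac_norm lam e r (v - w))"

definition frac_borel ::
    "(nat \<Rightarrow> real) \<Rightarrow> (nat \<Rightarrow> 'h::real_inner) \<Rightarrow> real \<Rightarrow> 'h measure" where
  "frac_borel lam e r = sigma (frac_dom lam e r) {U. openin (frac_topology lam e r) U}"

lemma space_frac_borel: "space (frac_borel lam e r) = frac_dom lam e r"
  by (simp add: frac_borel_def space_measure_of_conv)

lemma frac_dom_1:
  assumes "\<And>n. n \<ge> 1 \<Longrightarrow> lam n > 0"
  shows "frac_dom lam e 1 = gen_dom lam e"
proof -
  have "lam (Suc n) powr (2 * 1) = \<bar>lam (Suc n)\<bar>\<^sup>2" for n
    using assms[of "Suc n"] by (simp flip: powr_numeral)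
  then show ?thesis by (simp add: frac_dom_def gen_dom_def)
qed

definition proj :: "(nat \<Rightarrow> 'h::real_inner) \<Rightarrow> nat \<Rightarrow> 'h \<Rightarrow> 'h" where
  "proj e N v = (\<Sum>n=1..N. (e n \<bullet> v) *\<^sub>R e n)"

text \<open>
  The inclusion of \<open>V\<close> in \<open>H\<close> is an injective bounded linear map \<open>j\<close>; an element \<open>u\<close> of \<open>H\<close>
  that lies in \<open>V\<close> is, as an element of \<open>V\<close>, \<open>inv j u\<close>.
  \<open>H_extension j L\<close> is the continuous extension to \<open>H\<close> of an operator \<open>L\<close> on \<open>V\<close>. It exists
  and is unique when \<open>V\<close> is dense in \<open>H\<close> and \<open>L\<close> is bounded for the norm of \<open>H\<close>.
\<close>

definition H_extension ::
    "('v::real_normed_vector \<Rightarrow> 'h::real_normed_vector) \<Rightarrow> ('v \<Rightarrow>\<^sub>L 'v) \<Rightarrow> 'h \<Rightarrow> 'h" where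
  "H_extension j L = (THE G. bounded_linear G \<and> (\<forall>w. G (j w) = j (blinfun_apply L w)))"

definition normal_filtration :: "'w measure \<Rightarrow> real \<Rightarrow> (real \<Rightarrow> 'w measure) \<Rightarrow> bool" where
  "normal_filtration P T Filt \<longleftrightarrow>
     (\<forall>t\<in>{0..T}. subalgebra P (Filt t)) \<and>
     (\<forall>s t. 0 \<le> s \<and> s \<le> t \<and> t \<le> T \<longrightarrow> sets (Filt s) \<subseteq> sets (Filt t)) \<and>
     (\<forall>t\<in>{0..<T}. (\<Inter>s\<in>{t<..T}. sets (Filt s)) = sets (Filt t)) \<and>
     {B \<in> sets P. emeasure P B = 0} \<subseteq> sets (Filt 0)"

text \<open>That the values lie in \<open>D((-A)\<^sup>r)\<close> is part of measurability, see
  \<open>space_frac_borel\<close>.\<close>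

definition adapted_continuous ::
    "(nat \<Rightarrow> real) \<Rightarrow> (nat \<Rightarrow> 'h::real_inner) \<Rightarrow> real \<Rightarrow> 'w measure \<Rightarrow> real \<Rightarrow>
     (real \<Rightarrow> 'w measure) \<Rightarrow> (real \<Rightarrow> 'w \<Rightarrow> 'h) \<Rightarrow> bool" where
  "adapted_continuous lam e r P T Filt Z \<longleftrightarrow>
     (\<forall>t\<in>{0..T}. Z t \<in> Filt t \<rightarrow>\<^sub>M frac_borel lam e r) \<and>
     (\<forall>\<omega>\<in>space P. continuous_map (top_of_set {0..T}) (frac_topology lam e r) (\<lambda>t. Z t \<omega>))"

end

theory Submission
  imports Defs
begin

text \<open>
  With \<open>h = T / M\<close> and \<open>f\<close> the nonlinearity on \<open>H\<close>, the error splits into the projection error of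
  \<open>X\<close>, of order \<open>(lam N) powr (- \<gamma>)\<close> by the smoothness of \<open>X\<close>, and the projection of
  \<open>\<integral> S (t - s) f (X s) ds - \<Sum> h S (t - t\<^sub>k) f (Y\<^sub>k)\<close>. Freezing the semigroup at the grid points costs
  \<open>h (1 + ln M)\<close>, because \<open>S (t - s) - S (t - t\<^sub>k)\<close> has norm at most \<open>h / (t - s)\<close>. Replacing
  \<open>f (X t\<^sub>k)\<close> by \<open>f (Y\<^sub>k)\<close> is absorbed by a discrete Gronwall inequality. What remains is
  \<open>f (X s) - f (X t\<^sub>k)\<close>, where a Lipschitz bound would only give order \<open>\<theta>\<close>. The order \<open>2 \<theta>\<close> comes
  from a Taylor expansion: the remainder is quadratic in the \<open>\<theta>\<close>-Hoelder increment of \<open>X\<close>; the part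
  of the linear term due to \<open>(S (s - t\<^sub>k) - 1) X\<close> is of order \<open>h\<close> after moving the derivative to the
  other side by its adjoint; and the noise parts \<open>Z s - S (s - t\<^sub>k) Z t\<^sub>k\<close> yield
  martingale differences, which are orthogonal over \<open>k\<close> and gain a factor \<open>sqrt h\<close>.

  Pathwise constants are multiples of powers of one random variable \<open>R\<close> with finite fourth moment that
  bounds the data.
\<close>

section \<open>Spectral calculus of the diagonal operator\<close>

text \<open>Both the equation and the scheme carry the noise exactly, so once the recursion is
  unrolled it cancels up to the projection and only drift terms are compared. The Taylor expansion
  is made at \<open>X\<close>, never at \<open>Y\<close>; the scheme enters through the Lipschitz
  bound in \<open>H\<close> alone. The obstacle is the linear noise term: along one path it is only
  of order \<theta>, and only its variance is good. It therefore passes unbounded through the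
  pathwise estimates. Orthogonality is available at fixed times, not under the time integral, so
  every cell is sampled at the same relative position \<open>r\<close>. For fixed \<open>r\<close>
  the sampled noise terms are martingale differences; averages over \<open>r\<close> converge
  pathwise to the integral, and Fatou's lemma carries the moment bound over. Half powers occur
  because \<open>X\<close> lies in \<open>D(1/2)\<close> but need not lie in \<open>D(1)\<close>:
  the one power of the operator that order \<open>h\<close> costs is shared between \<open>X\<close>
  and the semigroup on the left, at the price of a factor \<open>\<tau> powr (-1/2)\<close> summable
  over the grid. The logarithm comes from freezing the semigroup alone. Local errors are bounded by
  squares of the data, hence the fourth moments.\<close>

lemma set_lebesgue_integral_eq_integral_continuous:
  fixes f :: "real \<Rightarrow> 'a::{real_inner, banach, second_countable_topology}"
  assumes "continuous_on {a..b} f"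
  shows "(LINT s:{a..b}|lborel. f s) = integral {a..b} f"
proof -
  have si: "set_integrable lborel {a..b} f"
    by (rule borel_integrable_atLeastAtMost'[OF assms])
  \<comment> \<open>Pairing with an arbitrary vector reduces the claim to real integrands. It links
    the Lebesgue integral of the mild equation with the gauge integral of the estimates.\<close>
  have "x \<bullet> (LINT s:{a..b}|lborel. f s) = x \<bullet> integral {a..b} f" for x
  proof -
    have c: "continuous_on {a..b} (\<lambda>s. x \<bullet> f s)"
      by (intro continuous_intros assms)
    have "x \<bullet> (LINT s:{a..b}|lborel. f s) = (LINT s:{a..b}|lborel. x \<bullet> f s)"
      using si unfolding set_lebesgue_integral_def set_integrable_def
      by (subst integral_inner_right[symmetric]) auto
    also have "\<dots> = integral {a..b} (\<lambda>s. x \<bullet> f s)"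
      by (rule set_borel_integral_eq_integral(2)[OF borel_integrable_atLeastAtMost'[OF c]])
    also have "\<dots> = x \<bullet> integral {a..b} f"
      using integral_linear[OF integrable_continuous_interval[OF assms]
          bounded_linear_inner_right[of x]]
      by (simp add: o_def)
    finally show ?thesis .
  qed
  then show ?thesis
    by (metis vector_eq_ldot)
qed

text \<open>The pointwise bound is asked for in the open interval only, so \<open>G'\<close> may be
  singular at an end, like \<open>(t - s) powr (-\<gamma>)\<close>, as long as \<open>G\<close> is
  continuous there.\<close>

lemma norm_integral_le_antiderivative:
  fixes g :: "real \<Rightarrow> 'a::banach"
  assumes ab: "a \<le> b" and g: "continuous_on {a..b} g" and G: "continuous_on {a..b} G"
    and G': "\<And>s. a < s \<Longrightarrow> s < b \<Longrightarrow> (G has_real_derivative G' s) (at s)"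
    and le: "\<And>s. a < s \<Longrightarrow> s < b \<Longrightarrow> norm (g s) \<le> G' s"
  shows "norm (integral {a..b} g) \<le> G b - G a"
proof (cases "a = b")
  case False
  then have ab: "a < b" using ab by simp
  define I where "I s = integral {a..s} g" for s
  have "norm (I b - I a) \<le> G b - G a"
  proof (rule differentiable_bound_general[OF ab _ G _ _ le])
    show "continuous_on {a..b} I"
      unfolding I_def by (intro indefinite_integral_continuous_1 integrable_continuous_interval g)
    fix s assume s: "a < s" "s < b"
    have "(I has_vector_derivative g s) (at s within {a..b})"
      unfolding I_def by (rule integral_has_vector_derivative[OF g]) (use s in auto)
    then show "(I has_vector_derivative g s) (at s)"
      using s by (simp add: at_within_Icc_at)
    show "(G has_vector_derivative G' s) (at s)"
      using G'[OF s] by (simp add: has_real_derivative_iff_has_vector_derivative)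
  qed auto
  then show ?thesis by (simp add: I_def)
qed auto

lemma tendsto_norm_bound:
  fixes f :: "nat \<Rightarrow> 'a::real_normed_vector" and g :: "nat \<Rightarrow> 'b::real_normed_vector"
  assumes "g \<longlonglongrightarrow> 0" "\<And>n. norm (f n - l) \<le> C * norm (g n)"
  shows "f \<longlonglongrightarrow> l"
  by (rule LIM_zero_cancel, rule tendsto_0_le[OF assms(1), where K = C])
     (use assms(2) in \<open>auto simp: mult.commute\<close>)

section \<open>Scalar inequalities behind the semigroup estimates\<close>

lemma powr_sq: "(x powr r)\<^sup>2 = x powr (2 * r)" for x r :: real
  by (simp add: power2_eq_square flip: powr_add)

lemma one_minus_exp_le_sqrt: "0 \<le> y \<Longrightarrow> 1 - exp (- y) \<le> sqrt y" for y :: real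
proof -
  assume y: "0 \<le> y"
  have 1: "1 - exp (- y) \<le> y" using exp_ge_add_one_self[of "-y"] by simp
  show ?thesis
  proof (cases "y \<le> 1")
    case True
    then have "y\<^sup>2 \<le> y" using y by (simp add: power2_eq_square mult_left_le)
    then have "y \<le> sqrt y" by (rule real_le_rsqrt)
    then show ?thesis using 1 by simp
  next
    case False
    then have "1 \<le> sqrt y" by simp
    then show ?thesis using exp_gt_zero[of "-y"] by linarith
  qed
qed

text \<open>Smoothing for a single eigenvalue \<open>x\<close>. With \<open>y = x * t\<close> it
  says \<open>y powr r \<le> exp y\<close>: for \<open>y \<le> 1\<close> the left side is at most 1,
  otherwise at most \<open>y\<close>.\<close>

lemma powr_mult_exp_minus_le:
  fixes x t r :: real
  assumes x: "0 < x" and t: "0 < t" and r: "0 \<le> r" "r \<le> 1"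
  shows "x powr r * exp (- x * t) \<le> t powr (- r)"
proof -
  have "(x * t) powr r \<le> exp (x * t)"
  proof (cases "x * t \<le> 1")
    case True
    have "(x * t) powr r \<le> 1" using powr_le1[of r "x*t"] True x t r by simp
    also have "1 \<le> exp (x * t)" using x t by simp
    finally show ?thesis .
  next
    case False
    then have "(x * t) powr r \<le> (x * t) powr 1" using r by (intro powr_mono) auto
    also have "\<dots> = x * t" using x t by simp
    also have "\<dots> \<le> exp (x * t)" using exp_ge_add_one_self[of "x*t"] by linarith
    finally show ?thesis .
  qed
  then have "x powr r * t powr r \<le> exp (x * t)" using x t by (simp add: powr_mult)
  then show ?thesis using x t by (simp add: powr_minus exp_minus field_simps)
qed

lemma powr_three_halves: "0 < x \<Longrightarrow> x powr (3/2) = x * sqrt x" for x :: real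
  using powr_add[of x 1 "1/2"] by (simp add: powr_half_sqrt)

text \<open>Smoothing combined with the half-order modulus of continuity would give
  \<open>\<delta> powr (1/2) / \<tau>\<close>, which is not integrable at 0. A difference of powers
  has an explicit antiderivative and integrates to order \<open>\<delta> powr (1/2)\<close>.\<close>

lemma sqrt_mult_exp_diff_le:
  fixes x \<tau> \<delta> :: real
  assumes x: "0 < x" and \<tau>: "0 < \<tau>" and \<delta>: "0 \<le> \<delta>"
  shows "x powr (1/2) * (exp (- x * \<tau>) - exp (- x * (\<tau> + \<delta>)))
    \<le> 2 * (\<tau> powr (-1/2) - (\<tau> + \<delta>) powr (-1/2))"
proof -
  \<comment> \<open>The claim is that \<open>g\<close> increases; its derivative is nonnegative
    because \<open>y powr (3/2) \<le> exp y\<close> for \<open>y = x * u\<close>.\<close>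
  define g where "g u = x powr (1/2) * exp (- x * u) - 2 * u powr (-1/2)" for u
  have "g \<tau> \<le> g (\<tau> + \<delta>)"
  proof (rule DERIV_nonneg_imp_nondecreasing[where f = g])
    fix u assume u: "\<tau> \<le> u" "u \<le> \<tau> + \<delta>"
    have u0: "u > 0" using u \<tau> by simp
    have d: "(g has_real_derivative (u powr (-(3/2)) - x powr (3/2) * exp (- x * u))) (at u)"
      unfolding g_def using u0 x
      apply (auto intro!: derivative_eq_intros)
      by (simp add: powr_diff powr_minus field_simps powr_half_sqrt powr_three_halves)
    define y where "y = x * u"
    have y: "y > 0" using x u0 by (simp add: y_def)
    have "y powr (3/2) = y * sqrt y"
      using y by (simp add: powr_three_halves)
    also have "\<dots> \<le> y * ((1 + y) / 2)"
      using y arith_geo_mean_sqrt[of 1 y] by (intro mult_left_mono) auto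
    also have "\<dots> \<le> 1 + y + y\<^sup>2 / 2" using y by (simp add: power2_eq_square field_simps)
    also have "\<dots> \<le> exp y" using exp_lower_Taylor_quadratic[of y] y by simp
    finally have "x powr (3/2) * u powr (3/2) \<le> exp (x * u)"
      using x u0 by (simp add: y_def powr_mult)
    then have "x powr (3/2) * exp (- x * u) \<le> u powr (-(3/2))"
      using u0 by (simp add: powr_minus exp_minus field_simps)
    then show "\<exists>y. (g has_real_derivative y) (at u) \<and> 0 \<le> y"
      using d by (intro exI[of _ "u powr (-(3/2)) - x powr (3/2) * exp (- x * u)"]) simp
  qed (use \<delta> in simp)
  then show ?thesis by (simp add: g_def algebra_simps)
qed

section \<open>Expansions in the eigenbasis\<close>

locale spectral_basis =
  fixes lam :: "nat \<Rightarrow> real"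
    and e :: "nat \<Rightarrow> 'h::{real_inner, banach, second_countable_topology}"
  assumes lam_pos: "n \<ge> 1 \<Longrightarrow> lam n > 0"
    and lam_mono: "mono_on {1..} lam"
    and basis: "orthonormal_basis e"
begin

abbreviation "lm n \<equiv> lam (Suc n)"
abbreviation "bv n \<equiv> e (Suc n)"
abbreviation "S \<equiv> semigrp lam e"
abbreviation "D \<equiv> frac_dom lam e"
abbreviation "fnorm \<equiv> frac_norm lam e"
abbreviation "fpow \<equiv> frac_pow lam e"

lemma lm_pos [simp]: "0 < lm n" by (simp add: lam_pos)
lemma lm_nonneg [simp]: "0 \<le> lm n" using lm_pos[of n] by linarith
lemma lm_neq_0 [simp]: "lm n \<noteq> 0" using lm_pos[of n] by linarith

lemma lam_le: "1 \<le> m \<Longrightarrow> m \<le> n \<Longrightarrow> lam m \<le> lam n"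
  using lam_mono by (auto simp: mono_on_def)

lemma inner_bv [simp]: "bv m \<bullet> bv n = (if m = n then 1 else 0)"
  using basis by (simp add: orthonormal_basis_def)

lemma norm_bv [simp]: "norm (bv n) = 1"
  by (simp add: norm_eq_sqrt_inner)

lemma proj_eq: "proj e N v = (\<Sum>n<N. (bv n \<bullet> v) *\<^sub>R bv n)"
  by (simp add: proj_def sum.atLeast1_atMost_eq)

lemma inner_sum_bv: "finite A \<Longrightarrow> bv k \<bullet> (\<Sum>n\<in>A. a n *\<^sub>R bv n) = (if k \<in> A then a k else 0)"
  by (simp add: inner_sum_right if_distrib[of "(*) _"] cong: if_cong)

lemma norm_sum_bv: "finite A \<Longrightarrow> (norm (\<Sum>n\<in>A. a n *\<^sub>R bv n))\<^sup>2 = (\<Sum>n\<in>A. (a n)\<^sup>2)"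
  by (subst power2_norm_eq_inner)
     (simp add: inner_sum_left inner_sum_bv power2_eq_square)

lemma coord_proj: "bv k \<bullet> proj e N v = (if k < N then bv k \<bullet> v else 0)"
  by (simp add: proj_eq inner_sum_bv)

lemma norm_proj_sq: "(norm (proj e N v))\<^sup>2 = (\<Sum>n<N. (bv n \<bullet> v)\<^sup>2)"
  by (simp add: proj_eq norm_sum_bv)

lemma norm_proj_le: "norm (proj e N v) \<le> norm v"
proof -
  have "(norm (proj e N v))\<^sup>2 = proj e N v \<bullet> v"
    unfolding norm_proj_sq by (simp add: proj_eq inner_sum_left power2_eq_square)
  also have "\<dots> \<le> norm (proj e N v) * norm v" by (rule norm_cauchy_schwarz)
  finally show ?thesis
    by (cases "norm (proj e N v) = 0") (auto simp: power2_eq_square)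
qed

lemma bounded_linear_proj: "bounded_linear (proj e N)"
  by (rule bounded_linear_intro[where K = 1])
     (auto simp: proj_eq inner_add_right scaleR_add_left sum.distrib scaleR_sum_right
        norm_proj_le[unfolded proj_eq])

lemma proj_diff: "proj e N (v - w) = proj e N v - proj e N w"
  by (rule linear_diff[OF bounded_linear.linear[OF bounded_linear_proj]])

lemma proj_add: "proj e N (v + w) = proj e N v + proj e N w"
  by (rule linear_add[OF bounded_linear.linear[OF bounded_linear_proj]])

text \<open>Density and contractivity: some \<open>w\<close> in the span is close to
  \<open>v\<close> and is reproduced by all large projections, while projecting \<open>v - w\<close>
  does not enlarge it. Parseval's identities follow by passing to the limit.\<close>

lemma proj_tendsto: "(\<lambda>N. proj e N v) \<longlonglongrightarrow> v"
proof (rule LIMSEQ_I)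
  fix r :: real assume r: "0 < r"
  have "v \<in> closure (span (e ` {1..}))" using basis by (simp add: orthonormal_basis_def)
  then obtain w where w: "w \<in> span (e ` {1..})" "dist w v < r / 2"
    using r by (metis closure_approachable half_gt_zero)
  from w(1) have "\<exists>N0. \<forall>N\<ge>N0. proj e N w = w"
  proof (induction rule: span_induct_alt)
    case base then show ?case by (simp add: proj_eq)
  next
    case (step a x y)
    then obtain N0 where N0: "\<forall>N\<ge>N0. proj e N y = y" by auto
    obtain k where k: "x = bv k" using step(1) by (metis Suc_le_D atLeast_iff image_iff One_nat_def)
    have px: "proj e N x = x" if "N \<ge> Suc k" for N
      using that by (simp add: k proj_eq if_distrib[of "\<lambda>c. c *\<^sub>R _"] cong: if_cong)
    show ?case
    proof (intro exI allI impI)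
      fix N assume "N \<ge> max N0 (Suc k)"
      then show "proj e N (a *\<^sub>R x + y) = a *\<^sub>R x + y"
        using N0 px by (simp add: proj_add
           linear_scale[OF bounded_linear.linear[OF bounded_linear_proj]])
    qed
  qed
  then obtain N0 where N0: "\<forall>N\<ge>N0. proj e N w = w" by auto
  show "\<exists>N0. \<forall>N\<ge>N0. norm (proj e N v - v) < r"
  proof (intro exI allI impI)
    fix N assume "N \<ge> N0"
    then have "proj e N v - v = proj e N (v - w) + (w - v)" using N0 by (simp add: proj_diff)
    also have "norm \<dots> \<le> norm (v - w) + norm (w - v)"
      using norm_proj_le[of N "v - w"] norm_triangle_ineq by (smt (verit))
    also have "\<dots> < r" using w(2) by (simp add: dist_norm norm_minus_commute)
    finally show "norm (proj e N v - v) < r" .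
  qed
qed

lemma inner_sums: "(\<lambda>n. (bv n \<bullet> v) * (bv n \<bullet> w)) sums (v \<bullet> w)"
proof -
  have "(\<lambda>N. proj e N v \<bullet> w) \<longlonglongrightarrow> v \<bullet> w"
    by (intro tendsto_intros proj_tendsto)
  then show ?thesis by (simp add: sums_def proj_eq inner_sum_left)
qed

lemma norm_sums: "(\<lambda>n. (bv n \<bullet> v)\<^sup>2) sums (norm v)\<^sup>2"
  using inner_sums[of v v] by (simp add: power2_eq_square dot_square_norm)

lemma coord_eqI: "(\<And>n. bv n \<bullet> v = bv n \<bullet> w) \<Longrightarrow> v = w"
proof -
  assume "\<And>n. bv n \<bullet> v = bv n \<bullet> w"
  then have "(norm (v - w))\<^sup>2 = 0"
    using norm_sums[of "v - w"] by (simp add: inner_diff_right sums_iff)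
  then show ?thesis by simp
qed

text \<open>Riesz-Fischer: by Pythagoras the Cauchy criterion for the squares is the Cauchy
  criterion for the vectors.\<close>

lemma summable_bv:
  assumes "summable (\<lambda>n. (a n)\<^sup>2)"
  shows "summable (\<lambda>n. a n *\<^sub>R bv n)"
  unfolding summable_Cauchy
proof (intro allI impI)
  fix r :: real assume r: "0 < r"
  then obtain N where N: "\<And>m n. m \<ge> N \<Longrightarrow> norm (\<Sum>k=m..<n. (a k)\<^sup>2) < r\<^sup>2"
    using assms[unfolded summable_Cauchy] by (meson zero_less_power)
  have "norm (\<Sum>k=m..<n. a k *\<^sub>R bv k) < r" if "m \<ge> N" for m n
  proof (rule power2_less_imp_less)
    show "(norm (\<Sum>k=m..<n. a k *\<^sub>R bv k))\<^sup>2 < r\<^sup>2"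
      using N[OF that, of n] by (simp add: norm_sum_bv)
  qed (use r in simp)
  then show "\<exists>N. \<forall>m\<ge>N. \<forall>n. norm (\<Sum>k=m..<n. a k *\<^sub>R bv k) < r" by blast
qed

lemma coord_suminf:
  assumes "summable (\<lambda>n. (a n)\<^sup>2)"
  shows "bv k \<bullet> (\<Sum>n. a n *\<^sub>R bv n) = a k"
proof -
  have "(\<lambda>n. bv k \<bullet> (a n *\<^sub>R bv n)) sums (bv k \<bullet> (\<Sum>n. a n *\<^sub>R bv n))"
    by (rule bounded_linear.sums[OF bounded_linear_inner_right summable_sums[OF summable_bv[OF assms]]])
  moreover have "(\<lambda>n. bv k \<bullet> (a n *\<^sub>R bv n)) sums a k"
    using sums_single[of k a] by (simp add: if_distrib[of "(*) _"] eq_commute cong: if_cong)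
  ultimately show ?thesis by (rule sums_unique2)
qed

lemma summable_coord_sq: "summable (\<lambda>n. (bv n \<bullet> v)\<^sup>2)"
  using norm_sums sums_summable by blast

lemma norm_le_coord:
  assumes "\<And>n. \<bar>bv n \<bullet> w\<bar> \<le> C * \<bar>bv n \<bullet> u\<bar>" "0 \<le> C"
  shows "norm w \<le> C * norm u"
proof -
  have "(norm w)\<^sup>2 \<le> C\<^sup>2 * (norm u)\<^sup>2"
  proof (rule sums_le[OF _ norm_sums sums_mult[OF norm_sums]])
    fix n show "(bv n \<bullet> w)\<^sup>2 \<le> C\<^sup>2 * (bv n \<bullet> u)\<^sup>2"
      using power_mono[OF assms(1)[of n], of 2] by (simp add: power_mult_distrib)
  qed
  then have "(norm w)\<^sup>2 \<le> (C * norm u)\<^sup>2" by (simp add: power_mult_distrib)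
  then show ?thesis by (rule power2_le_imp_le) (simp add: assms(2))
qed

lemma summable_sq_dominated:
  assumes "\<And>n. \<bar>a n\<bar> \<le> C * \<bar>bv n \<bullet> u\<bar>"
  shows "summable (\<lambda>n. (a n)\<^sup>2)"
proof (rule summable_comparison_test'[OF summable_mult[OF summable_coord_sq[of u]]])
  fix n show "norm ((a n)\<^sup>2) \<le> C\<^sup>2 * (bv n \<bullet> u)\<^sup>2"
    using power_mono[OF assms[of n], of 2] by (simp add: power_mult_distrib)
qed

section \<open>Domains and norms of the fractional powers\<close>

lemma frac_dom_iff: "v \<in> D r \<longleftrightarrow> summable (\<lambda>n. (lm n powr r * (bv n \<bullet> v))\<^sup>2)"
  by (simp add: frac_dom_def power_mult_distrib powr_sq)

lemma coord_fpow: "v \<in> D r \<Longrightarrow> bv n \<bullet> fpow r v = lm n powr r * (bv n \<bullet> v)"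
  by (simp add: frac_pow_def frac_dom_iff coord_suminf)

lemma fnorm_nonneg [simp]: "0 \<le> fnorm r v"
  by (simp add: frac_norm_def)

lemma fnorm_sums: "v \<in> D r \<Longrightarrow> (\<lambda>n. (lm n powr r * (bv n \<bullet> v))\<^sup>2) sums (fnorm r v)\<^sup>2"
  using norm_sums[of "fpow r v"] by (simp add: coord_fpow frac_norm_def)

text \<open>The working tool for operators that are diagonal in the basis: one bound on coordinates
  yields membership and norm together. Often \<open>u\<close> is taken to be \<open>fpow q v\<close>
  instead of \<open>v\<close>.\<close>

lemma frac_dominated:
  assumes "\<And>n. lm n powr r * \<bar>bv n \<bullet> w\<bar> \<le> C * \<bar>bv n \<bullet> u\<bar>" "0 \<le> C"
  shows "w \<in> D r" "fnorm r w \<le> C * norm u"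
proof -
  have 1: "\<bar>lm n powr r * (bv n \<bullet> w)\<bar> \<le> C * \<bar>bv n \<bullet> u\<bar>" for n
    using assms(1)[of n] by (simp add: abs_mult)
  show 2: "w \<in> D r"
    unfolding frac_dom_iff by (rule summable_sq_dominated[OF 1])
  show "fnorm r w \<le> C * norm u"
    unfolding frac_norm_def
    by (rule norm_le_coord) (use 1 assms(2) in \<open>auto simp: coord_fpow[OF 2]\<close>)
qed

lemma frac_dom_add:
  assumes "v \<in> D r" "w \<in> D r" shows "v + w \<in> D r" "fpow r (v + w) = fpow r v + fpow r w"
proof -
  have "\<bar>lm n powr r * (bv n \<bullet> (v + w))\<bar> \<le> 1 * \<bar>bv n \<bullet> (fpow r v + fpow r w)\<bar>" for n
    using assms by (simp add: coord_fpow inner_add_right algebra_simps)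
  from summable_sq_dominated[OF this] show 1: "v + w \<in> D r" by (simp add: frac_dom_iff)
  show "fpow r (v + w) = fpow r v + fpow r w"
    by (rule coord_eqI) (simp add: coord_fpow 1 assms inner_add_right algebra_simps)
qed

lemma frac_dom_scaleR:
  assumes "v \<in> D r" shows "a *\<^sub>R v \<in> D r" "fpow r (a *\<^sub>R v) = a *\<^sub>R fpow r v"
proof -
  have "\<bar>lm n powr r * (bv n \<bullet> (a *\<^sub>R v))\<bar> \<le> 1 * \<bar>bv n \<bullet> (a *\<^sub>R fpow r v)\<bar>" for n
    using assms by (simp add: coord_fpow algebra_simps)
  from summable_sq_dominated[OF this] show 1: "a *\<^sub>R v \<in> D r" by (simp add: frac_dom_iff)
  show "fpow r (a *\<^sub>R v) = a *\<^sub>R fpow r v"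
    by (rule coord_eqI) (simp add: coord_fpow 1 assms algebra_simps)
qed

lemma frac_dom_diff:
  assumes "v \<in> D r" "w \<in> D r" shows "v - w \<in> D r" "fpow r (v - w) = fpow r v - fpow r w"
  using frac_dom_add[OF assms(1) frac_dom_scaleR(1)[OF assms(2), of "-1"]]
    frac_dom_scaleR(2)[OF assms(2), of "-1"] by auto

lemma fnorm_triangle: "v \<in> D r \<Longrightarrow> w \<in> D r \<Longrightarrow> fnorm r (v + w) \<le> fnorm r v + fnorm r w"
  unfolding frac_norm_def by (simp add: frac_dom_add norm_triangle_ineq)

lemma zero_in_frac_dom [simp]: "0 \<in> D r" by (simp add: frac_dom_iff)

lemma fnorm_zero [simp]: "fnorm r 0 = 0" by (simp add: frac_norm_def frac_pow_def)

lemma proj_in_frac_dom: "proj e N v \<in> D r"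
  unfolding frac_dom_iff
  by (rule summable_finite[of "{..<N}"]) (auto simp: coord_proj)

lemma bv_in_frac_dom: "bv n \<in> D r"
proof -
  have "bv n = proj e (Suc n) (bv n)" by (rule coord_eqI) (simp add: coord_proj)
  then show ?thesis using proj_in_frac_dom by metis
qed

text \<open>The exponent \<open>r - q\<close> is at most 0 and \<open>lam 1\<close> is the smallest
  eigenvalue, so the multiplier is largest there.\<close>

lemma frac_mono:
  assumes "r \<le> q" "v \<in> D q"
  shows "v \<in> D r" "fnorm r v \<le> lam 1 powr (r - q) * fnorm q v"
proof -
  have "lm n powr r * \<bar>bv n \<bullet> v\<bar> \<le> lam 1 powr (r - q) * \<bar>bv n \<bullet> fpow q v\<bar>" for n
  proof -
    have "lm n powr (r - q) \<le> lam 1 powr (r - q)"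
      using assms lam_le[of 1 "Suc n"] lam_pos[of 1] by (intro powr_mono2') auto
    then have "lm n powr (r - q) * (lm n powr q * \<bar>bv n \<bullet> v\<bar>)
        \<le> lam 1 powr (r - q) * (lm n powr q * \<bar>bv n \<bullet> v\<bar>)"
      by (intro mult_right_mono) auto
    then show ?thesis using assms by (simp add: coord_fpow abs_mult powr_diff)
  qed
  from frac_dominated[OF this] show "v \<in> D r" "fnorm r v \<le> lam 1 powr (r - q) * fnorm q v"
    by (auto simp: frac_norm_def)
qed

lemma fnorm_0: "fnorm 0 v = norm v"
proof -
  have "v \<in> D 0" by (simp add: frac_dom_iff summable_coord_sq)
  then have "fpow 0 v = v" by (intro coord_eqI) (simp add: coord_fpow)
  then show ?thesis by (simp add: frac_norm_def)
qed

lemma norm_le_fnorm: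
  assumes "0 \<le> q" "v \<in> D q" shows "norm v \<le> lam 1 powr (- q) * fnorm q v"
  using frac_mono(2)[of 0 q v] assms by (simp add: fnorm_0)

lemma norm_proj_tail:
  assumes "0 \<le> q" "v \<in> D q" "1 \<le> N" shows "norm (v - proj e N v) \<le> lam N powr (- q) * fnorm q v"
  unfolding frac_norm_def
proof (rule norm_le_coord)
  fix n
  show "\<bar>bv n \<bullet> (v - proj e N v)\<bar> \<le> lam N powr (- q) * \<bar>bv n \<bullet> fpow q v\<bar>"
  proof (cases "n < N")
    case False
    \<comment> \<open>Counted from 0, the projection keeps \<open>n < N\<close>. The first
      eigenvalue left is \<open>lam (Suc N)\<close>, which is at least \<open>lam N\<close>.\<close>
    then have "lm n powr (-q) \<le> lam N powr (- q)"
      using assms lam_le[of N "Suc n"] lam_pos[of N] by (intro powr_mono2') auto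
    then have "lm n powr (-q) * (lm n powr q * \<bar>bv n \<bullet> v\<bar>)
        \<le> lam N powr (- q) * (lm n powr q * \<bar>bv n \<bullet> v\<bar>)"
      by (intro mult_right_mono) auto
    then show ?thesis using False assms
      by (simp add: inner_diff_right coord_proj coord_fpow abs_mult powr_minus field_simps)
  qed (use assms in \<open>simp add: inner_diff_right coord_proj\<close>)
qed simp

lemma fnorm_proj_le:
  assumes "v \<in> D q" shows "fnorm q (proj e N v) \<le> fnorm q v"
  using frac_dominated(2)[of q "proj e N v" 1 "fpow q v"] assms
  by (auto simp: frac_norm_def coord_proj coord_fpow abs_mult)

lemma fnorm_proj_tail_tendsto:
  assumes "v \<in> D q" shows "(\<lambda>N. fnorm q (proj e N v - v)) \<longlonglongrightarrow> 0"
proof -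
  have "fpow q (proj e N v) = proj e N (fpow q v)" for N
    by (rule coord_eqI) (simp add: coord_fpow proj_in_frac_dom assms coord_proj)
  then have "fnorm q (proj e N v - v) = norm (proj e N (fpow q v) - fpow q v)" for N
    by (simp add: frac_norm_def frac_dom_diff proj_in_frac_dom assms)
  moreover have "(\<lambda>N. norm (proj e N (fpow q v) - fpow q v)) \<longlonglongrightarrow> 0"
    using proj_tendsto[of "fpow q v"] by (simp add: LIM_zero tendsto_norm_zero)
  ultimately show ?thesis by simp
qed

lemma norm_gen: "v \<in> D 1 \<Longrightarrow> norm (gen lam e v) = fnorm 1 v"
proof -
  assume v: "v \<in> D 1"
  have *: "(- lm n * (bv n \<bullet> v))\<^sup>2 = (lm n powr 1 * (bv n \<bullet> v))\<^sup>2" for n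
    by (simp add: power_mult_distrib)
  have s: "summable (\<lambda>n. (- lm n * (bv n \<bullet> v))\<^sup>2)"
    using v unfolding * frac_dom_iff .
  have "gen lam e v = - fpow 1 v"
    unfolding gen_def by (rule coord_eqI) (subst coord_suminf[OF s], simp add: coord_fpow v)
  then show ?thesis by (simp add: frac_norm_def)
qed

section \<open>The semigroup: continuity, smoothing and increments\<close>

lemma coord_S: "0 \<le> t \<Longrightarrow> bv n \<bullet> S t v = exp (- lm n * t) * (bv n \<bullet> v)"
  unfolding semigrp_def
  by (rule coord_suminf, rule summable_sq_dominated[where C = 1 and u = v])
     (auto simp: abs_mult mult_left_le_one_le)

lemma norm_S_le: "0 \<le> t \<Longrightarrow> norm (S t v) \<le> norm v"
  using norm_le_coord[of "S t v" 1 v] by (simp add: coord_S abs_mult mult_left_le_one_le)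

lemma bounded_linear_S: "0 \<le> t \<Longrightarrow> bounded_linear (S t)"
  by (rule bounded_linear_intro[where K = 1])
     (auto intro!: coord_eqI simp: coord_S inner_add_right algebra_simps norm_S_le)

lemma S_add: "0 \<le> t \<Longrightarrow> S t (v + w) = S t v + S t w"
  by (rule linear_add[OF bounded_linear.linear[OF bounded_linear_S]])

lemma S_diff: "0 \<le> t \<Longrightarrow> S t (v - w) = S t v - S t w"
  by (rule linear_diff[OF bounded_linear.linear[OF bounded_linear_S]])

lemma S_scaleR: "0 \<le> t \<Longrightarrow> S t (a *\<^sub>R v) = a *\<^sub>R S t v"
  by (rule linear_scale[OF bounded_linear.linear[OF bounded_linear_S]])

lemma S_sum: "0 \<le> t \<Longrightarrow> S t (\<Sum>i\<in>I. f i) = (\<Sum>i\<in>I. S t (f i))"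
  by (rule linear_sum[OF bounded_linear.linear[OF bounded_linear_S]])

lemma S_0 [simp]: "S 0 v = v"
  by (rule coord_eqI) (simp add: coord_S)

lemma S_S: "0 \<le> s \<Longrightarrow> 0 \<le> t \<Longrightarrow> S s (S t v) = S (s + t) v"
  by (rule coord_eqI) (simp add: coord_S algebra_simps flip: exp_add)

lemma S_proj: "0 \<le> t \<Longrightarrow> S t (proj e N v) = proj e N (S t v)"
  by (rule coord_eqI) (simp add: coord_S coord_proj)

text \<open>For projected vectors this is a finite sum of exponentials, and contractivity makes the
  convergence uniform over all times.\<close>

lemma continuous_on_S: "continuous_on {0..} (\<lambda>t. S t v)"
proof (rule uniform_limit_theorem)
  show "\<forall>\<^sub>F N in sequentially. continuous_on {0..} (\<lambda>t. S t (proj e N v))"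
  proof (intro always_eventually allI)
    fix N
    have "S t (proj e N v) = (\<Sum>n<N. (exp (- lm n * t) * (bv n \<bullet> v)) *\<^sub>R bv n)" if "0 \<le> t" for t
      by (rule coord_eqI) (simp add: coord_S that coord_proj inner_sum_bv)
    then show "continuous_on {0..} (\<lambda>t. S t (proj e N v))"
      by (subst continuous_on_cong[OF refl]) (auto intro!: continuous_intros)
  qed
  show "uniform_limit {0..} (\<lambda>N t. S t (proj e N v)) (\<lambda>t. S t v) sequentially"
  proof (rule uniform_limitI)
    fix r :: real assume "0 < r"
    then have "\<forall>\<^sub>F N in sequentially. dist (proj e N v) v < r"
      using proj_tendsto tendstoD by blast
    then show "\<forall>\<^sub>F N in sequentially. \<forall>t\<in>{0..}. dist (S t (proj e N v)) (S t v) < r"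
    proof eventually_elim
      case (elim N)
      then show ?case
        using norm_S_le[of _ "proj e N v - v"]
        by (auto simp: dist_norm S_diff intro: le_less_trans)
    qed
  qed
qed simp

text \<open>The semigroup is strongly continuous but in general not norm continuous at 0.
  Contractivity handles the moving vector, and the time varies on a fixed one.\<close>

lemma continuous_on_S_compose:
  fixes f :: "'a::metric_space \<Rightarrow> 'h"
  assumes a: "continuous_on U a" and f: "continuous_on U f" and "\<And>s. s \<in> U \<Longrightarrow> 0 \<le> a s"
  shows "continuous_on U (\<lambda>s. S (a s) (f s))"
proof (rule continuous_on_sequentiallyI)
  fix u s assume us: "\<forall>n. u n \<in> U" "s \<in> U" "u \<longlonglongrightarrow> s"
  have fl: "(\<lambda>n. f (u n)) \<longlonglongrightarrow> f s"
    using f us unfolding continuous_on_sequentially by (auto simp: o_def)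
  have "continuous_on U (\<lambda>x. S (a x) (f s))"
    by (rule continuous_on_compose2[OF continuous_on_S a]) (use assms in auto)
  then have al: "(\<lambda>n. S (a (u n)) (f s)) \<longlonglongrightarrow> S (a s) (f s)"
    using us unfolding continuous_on_sequentially by (auto simp: o_def)
  have "(\<lambda>n. S (a (u n)) (f (u n) - f s)) \<longlonglongrightarrow> 0"
  proof (rule tendsto_0_le[where K = 1])
    show "(\<lambda>n. f (u n) - f s) \<longlonglongrightarrow> 0" using fl by (simp add: LIM_zero)
  qed (use us assms norm_S_le in auto)
  from tendsto_add[OF this al]
  show "(\<lambda>n. S (a (u n)) (f (u n))) \<longlonglongrightarrow> S (a s) (f s)"
    using us assms by (simp add: S_diff)
qed

lemma frac_dom_S:
  assumes "0 \<le> t" "v \<in> D r" shows "S t v \<in> D r" "fnorm r (S t v) \<le> fnorm r v"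
proof -
  have "lm n powr r * \<bar>bv n \<bullet> S t v\<bar> \<le> 1 * \<bar>bv n \<bullet> fpow r v\<bar>" for n
  proof -
    have "exp (- lm n * t) * (lm n powr r * \<bar>bv n \<bullet> v\<bar>) \<le> lm n powr r * \<bar>bv n \<bullet> v\<bar>"
      using assms by (intro mult_left_le_one_le) auto
    then show ?thesis using assms by (simp add: coord_S coord_fpow abs_mult mult_ac)
  qed
  from frac_dominated[OF this] show "S t v \<in> D r" "fnorm r (S t v) \<le> fnorm r v"
    by (auto simp: frac_norm_def)
qed

lemma S_smoothing:
  assumes "0 < t" "0 \<le> r" "r \<le> 1"
  shows "S t v \<in> D r" "fnorm r (S t v) \<le> t powr (- r) * norm v"
proof -
  have "lm n powr r * \<bar>bv n \<bullet> S t v\<bar> \<le> t powr (- r) * \<bar>bv n \<bullet> v\<bar>" for n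
    using mult_right_mono[OF powr_mult_exp_minus_le[OF lm_pos[of n] assms], of "\<bar>bv n \<bullet> v\<bar>"] assms
    by (simp add: coord_S abs_mult mult_ac)
  from frac_dominated[OF this] show "S t v \<in> D r" "fnorm r (S t v) \<le> t powr (- r) * norm v"
    by auto
qed

lemma S_diff_half:
  assumes "0 < \<tau>" "0 \<le> \<delta>"
  shows "S (\<tau> + \<delta>) v - S \<tau> v \<in> D (1/2)"
    "fnorm (1/2) (S (\<tau> + \<delta>) v - S \<tau> v) \<le> 2 * (\<tau> powr (-1/2) - (\<tau> + \<delta>) powr (-1/2)) * norm v"
proof -
  have nn: "0 \<le> 2 * (\<tau> powr (-1/2) - (\<tau> + \<delta>) powr (-1/2))"
    using assms by (auto intro!: powr_mono2')
  have "lm n powr (1/2) * \<bar>bv n \<bullet> (S (\<tau> + \<delta>) v - S \<tau> v)\<bar>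
    \<le> 2 * (\<tau> powr (-1/2) - (\<tau> + \<delta>) powr (-1/2)) * \<bar>bv n \<bullet> v\<bar>" for n
  proof -
    have "bv n \<bullet> (S (\<tau> + \<delta>) v - S \<tau> v) = (exp (- lm n * (\<tau> + \<delta>)) - exp (- lm n * \<tau>)) * (bv n \<bullet> v)"
      using assms by (simp add: inner_diff_right coord_S algebra_simps)
    moreover have "\<bar>exp (- lm n * (\<tau> + \<delta>)) - exp (- lm n * \<tau>)\<bar> = exp (- lm n * \<tau>) - exp (- lm n * (\<tau> + \<delta>))"
      using assms by (auto simp: abs_if mult_left_mono)
    ultimately show ?thesis
      using mult_right_mono[OF sqrt_mult_exp_diff_le[OF lm_pos[of n] assms], of "\<bar>bv n \<bullet> v\<bar>"]
      by (simp add: abs_mult mult_ac)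
  qed
  from frac_dominated[OF this nn]
  show "S (\<tau> + \<delta>) v - S \<tau> v \<in> D (1/2)"
    "fnorm (1/2) (S (\<tau> + \<delta>) v - S \<tau> v) \<le> 2 * (\<tau> powr (-1/2) - (\<tau> + \<delta>) powr (-1/2)) * norm v" .
qed

lemma norm_S_diff_le:
  assumes t: "0 < t" and d: "0 \<le> \<delta>"
  shows "norm (S (t + \<delta>) v - S t v) \<le> \<delta> / t * norm v"
proof (rule norm_le_coord)
  fix n
  have "exp (- lm n * t) - exp (- lm n * (t + \<delta>)) = exp (- lm n * t) * (1 - exp (- (lm n * \<delta>)))"
    by (simp add: algebra_simps flip: exp_add)
  also have "\<dots> \<le> exp (- lm n * t) * (lm n * \<delta>)"
    using exp_ge_add_one_self[of "- (lm n * \<delta>)"] by (intro mult_left_mono) auto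
  also have "\<dots> \<le> \<delta> / t"
  proof -
    have "lm n * exp (- lm n * t) \<le> 1 / t"
      using powr_mult_exp_minus_le[OF lm_pos[of n] t, of 1] t by (simp add: powr_minus_divide)
    from mult_right_mono[OF this d] show ?thesis by (simp add: mult_ac)
  qed
  finally have "exp (- lm n * t) - exp (- lm n * (t + \<delta>)) \<le> \<delta> / t" .
  moreover have "bv n \<bullet> (S (t + \<delta>) v - S t v) = (exp (- lm n * (t + \<delta>)) - exp (- lm n * t)) * (bv n \<bullet> v)"
    using assms by (simp add: inner_diff_right coord_S algebra_simps)
  moreover have "\<bar>exp (- lm n * (t + \<delta>)) - exp (- lm n * t)\<bar> = exp (- lm n * t) - exp (- lm n * (t + \<delta>))"
    using assms by (auto simp: abs_if mult_left_mono)
  ultimately show "\<bar>bv n \<bullet> (S (t + \<delta>) v - S t v)\<bar> \<le> \<delta> / t * \<bar>bv n \<bullet> v\<bar>"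
    by (simp only: abs_mult) (rule mult_right_mono, simp_all)
qed (use assms in simp)

lemma one_minus_exp_lm_le:
  assumes "0 \<le> \<delta>" shows "1 - exp (- lm n * \<delta>) \<le> \<delta> powr (1/2) * lm n powr (1/2)"
  using one_minus_exp_le_sqrt[of "lm n * \<delta>"] assms
  by (simp add: real_sqrt_mult powr_half_sqrt mult_ac)

lemma coord_S_minus_id: "0 \<le> \<delta> \<Longrightarrow> \<bar>bv n \<bullet> (S \<delta> v - v)\<bar> = (1 - exp (- lm n * \<delta>)) * \<bar>bv n \<bullet> v\<bar>"
proof -
  assume d: "0 \<le> \<delta>"
  have "bv n \<bullet> (S \<delta> v - v) = - ((1 - exp (- lm n * \<delta>)) * (bv n \<bullet> v))"
    using d by (simp add: inner_diff_right coord_S algebra_simps)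
  then show ?thesis using d by (simp add: abs_mult)
qed

text \<open>Half a power of smoothness pays for \<open>\<delta> powr (1/2)\<close>, by
  \<open>1 - exp (- y) \<le> sqrt y\<close> in each coordinate.\<close>

lemma S_minus_id_half:
  assumes d: "0 \<le> \<delta>" and v: "v \<in> D (1/2 + r)"
  shows "S \<delta> v - v \<in> D r" "fnorm r (S \<delta> v - v) \<le> \<delta> powr (1/2) * fnorm (1/2 + r) v"
proof -
  have "lm n powr r * \<bar>bv n \<bullet> (S \<delta> v - v)\<bar> \<le> \<delta> powr (1/2) * \<bar>bv n \<bullet> fpow (1/2 + r) v\<bar>" for n
    using mult_right_mono[OF one_minus_exp_lm_le[OF d], of "lm n powr r * \<bar>bv n \<bullet> v\<bar>" n] v
    by (simp add: coord_S_minus_id d coord_fpow abs_mult powr_add mult_ac)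
  from frac_dominated[OF this] show "S \<delta> v - v \<in> D r"
    "fnorm r (S \<delta> v - v) \<le> \<delta> powr (1/2) * fnorm (1/2 + r) v"
    by (auto simp: frac_norm_def)
qed

lemma norm_S_minus_id_le:
  assumes "0 \<le> \<delta>" "v \<in> D (1/2)" shows "norm (S \<delta> v - v) \<le> \<delta> powr (1/2) * fnorm (1/2) v"
  using S_minus_id_half(2)[of \<delta> v 0] assms by (simp add: fnorm_0)

text \<open>Order \<delta> costs one full power of the operator; in a pairing each side can pay half
  of it.\<close>

lemma S_minus_id_dual:
  assumes d: "0 \<le> \<delta>" and x: "x \<in> D (1/2)" and u: "u \<in> D (1/2)"
  shows "\<bar>(S \<delta> x - x) \<bullet> u\<bar> \<le> \<delta> * fnorm (1/2) x * fnorm (1/2) u"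
proof -
  \<comment> \<open>Eigenvalues of the operator \<open>1 - S \<delta>\<close> followed by the
    inverse of \<open>-A\<close>; they are bounded by \<delta>. Below, \<open>w\<close> is the value
    of this operator at \<open>fpow (1/2) x\<close>.\<close>
  define q where "q n = (if \<delta> = 0 then 0 else (1 - exp (- lm n * \<delta>)) / lm n)" for n
  have q: "0 \<le> q n" "q n \<le> \<delta>" "q n * lm n = 1 - exp (- lm n * \<delta>)" for n
    using exp_ge_add_one_self[of "- (lm n * \<delta>)"] d lm_pos[of n]
    by (auto simp: q_def divide_le_eq mult_ac less_imp_neq[symmetric])
  define w where "w = (\<Sum>n. (q n * (bv n \<bullet> fpow (1/2) x)) *\<^sub>R bv n)"
  have dom: "\<bar>q n * (bv n \<bullet> fpow (1/2) x)\<bar> \<le> \<delta> * \<bar>bv n \<bullet> fpow (1/2) x\<bar>" for n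
    using q[of n] by (simp add: abs_mult mult_right_mono)
  have cw: "bv n \<bullet> w = q n * (bv n \<bullet> fpow (1/2) x)" for n
    unfolding w_def by (rule coord_suminf[OF summable_sq_dominated[OF dom]])
  have nw: "norm w \<le> \<delta> * fnorm (1/2) x"
    unfolding frac_norm_def by (rule norm_le_coord) (use dom d in \<open>auto simp: cw\<close>)
  have "(S \<delta> x - x) \<bullet> u = - (w \<bullet> fpow (1/2) u)"
  proof (rule sums_unique2[OF inner_sums])
    have "- ((bv n \<bullet> w) * (bv n \<bullet> fpow (1/2) u)) = (bv n \<bullet> (S \<delta> x - x)) * (bv n \<bullet> u)" for n
    proof -
      have p: "lm n powr (1/2) * lm n powr (1/2) = lm n"
        by (simp flip: powr_add)
      have "(bv n \<bullet> w) * (bv n \<bullet> fpow (1/2) u)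
          = q n * (lm n powr (1/2) * lm n powr (1/2)) * (bv n \<bullet> x) * (bv n \<bullet> u)"
        using x u by (simp add: cw coord_fpow mult_ac)
      also have "\<dots> = (1 - exp (- lm n * \<delta>)) * (bv n \<bullet> x) * (bv n \<bullet> u)"
        by (simp only: p q)
      finally show ?thesis using d by (simp add: inner_diff_right coord_S algebra_simps)
    qed
    with sums_minus[OF inner_sums[of w "fpow (1/2) u"]]
    show "(\<lambda>n. (bv n \<bullet> (S \<delta> x - x)) * (bv n \<bullet> u)) sums - (w \<bullet> fpow (1/2) u)" by simp
  qed
  then have "\<bar>(S \<delta> x - x) \<bullet> u\<bar> \<le> norm w * norm (fpow (1/2) u)"
    using Cauchy_Schwarz_ineq2[of w "fpow (1/2) u"] by simp
  also have "\<dots> \<le> (\<delta> * fnorm (1/2) x) * norm (fpow (1/2) u)"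
    by (rule mult_right_mono[OF nw]) simp
  finally show ?thesis by (simp add: frac_norm_def)
qed

text \<open>The squared norms of the projections are the partial sums of the series for
  \<open>v\<close>, so a bound uniform in \<open>N\<close> forces convergence.\<close>

lemma frac_bounded_iff_proj:
  assumes "\<And>N. fnorm r (proj e N v) \<le> B"
  shows "v \<in> D r" "fnorm r v \<le> B"
proof -
  have B: "0 \<le> B" using assms[of 0] fnorm_nonneg order_trans by blast
  have s: "(\<Sum>n<N. (lm n powr r * (bv n \<bullet> v))\<^sup>2) \<le> B\<^sup>2" for N
  proof -
    have "(\<Sum>n<N. (lm n powr r * (bv n \<bullet> v))\<^sup>2) = (\<Sum>n<N. (lm n powr r * (bv n \<bullet> proj e N v))\<^sup>2)"
      by (simp add: coord_proj)
    also have "\<dots> \<le> (\<Sum>n. (lm n powr r * (bv n \<bullet> proj e N v))\<^sup>2)"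
      by (rule sum_le_suminf) (use proj_in_frac_dom frac_dom_iff in auto)
    also have "\<dots> = (fnorm r (proj e N v))\<^sup>2"
      by (rule sums_unique[OF fnorm_sums[OF proj_in_frac_dom], symmetric])
    also have "\<dots> \<le> B\<^sup>2" by (intro power_mono assms) simp
    finally show ?thesis .
  qed
  show v: "v \<in> D r"
    unfolding frac_dom_iff
    by (rule summableI_nonneg_bounded[where x = "B\<^sup>2"]) (use s in auto)
  have "(fnorm r v)\<^sup>2 \<le> B\<^sup>2"
    by (rule LIMSEQ_le_const2[OF fnorm_sums[OF v, unfolded sums_def]]) (use s in blast)
  then show "fnorm r v \<le> B" using B power2_le_imp_le by blast
qed

text \<open>\<open>g\<close> is continuous in \<open>H\<close> only, and its stronger norm may blow
  up at the ends. After projection, \<open>fpow r\<close> is a bounded operator and commutes with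
  the integral; the resulting bound does not depend on \<open>N\<close>.\<close>

lemma frac_integral_le:
  assumes ab: "a \<le> b" and g: "continuous_on {a..b} g" and G: "continuous_on {a..b} G"
    and G': "\<And>s. a < s \<Longrightarrow> s < b \<Longrightarrow> (G has_real_derivative G' s) (at s)"
    and le: "\<And>s. a < s \<Longrightarrow> s < b \<Longrightarrow> g s \<in> D r \<and> fnorm r (g s) \<le> G' s"
  shows "integral {a..b} g \<in> D r" "fnorm r (integral {a..b} g) \<le> G b - G a"
proof -
  have "fnorm r (proj e N (integral {a..b} g)) \<le> G b - G a" for N
  proof -
    have lin: "bounded_linear (\<lambda>v. fpow r (proj e N v))"
    proof -
      have eq: "fpow r (proj e N v) = (\<Sum>n<N. (lm n powr r * (bv n \<bullet> v)) *\<^sub>R bv n)" for v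
        by (rule coord_eqI) (simp add: coord_fpow proj_in_frac_dom coord_proj inner_sum_bv)
      show ?thesis
        unfolding eq
        by (intro bounded_linear_sum bounded_linear_scaleR_const bounded_linear_const_mult
              bounded_linear_inner_right)
    qed
    have "fpow r (proj e N (integral {a..b} g)) = integral {a..b} (\<lambda>s. fpow r (proj e N (g s)))"
      using integral_linear[OF integrable_continuous_interval[OF g] lin] by (simp add: o_def)
    moreover have "norm (integral {a..b} (\<lambda>s. fpow r (proj e N (g s)))) \<le> G b - G a"
    proof (rule norm_integral_le_antiderivative[OF ab _ G G'])
      show "continuous_on {a..b} (\<lambda>s. fpow r (proj e N (g s)))"
        by (rule bounded_linear.continuous_on[OF lin g])
      fix s assume "a < s" "s < b"
      then show "norm (fpow r (proj e N (g s))) \<le> G' s"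
        using le fnorm_proj_le[of "g s" r N] unfolding frac_norm_def by fastforce
    qed
    ultimately show ?thesis by (simp add: frac_norm_def)
  qed
  from frac_bounded_iff_proj[OF this]
  show "integral {a..b} g \<in> D r" "fnorm r (integral {a..b} g) \<le> G b - G a" .
qed

lemma Metric_space_frac: "Metric_space (D r) (\<lambda>v w. fnorm r (v - w))"
proof
  fix x y z
  show "0 \<le> fnorm r (x - y)" by simp
  \<comment> \<open>The metric axioms demand symmetry on the whole type. Where the series diverges,
    \<open>suminf\<close> takes the same default value for \<open>v\<close> and
    \<open>- v\<close>.\<close>
  have *: "fpow r (- v) = - fpow r v \<or> fpow r (- v) = fpow r v" for v
  proof (cases "summable (\<lambda>n. (lm n powr r * (bv n \<bullet> v)) *\<^sub>R bv n)")
    case True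
    then show ?thesis using suminf_minus[OF True] by (simp add: frac_pow_def)
  next
    case False
    then have "\<not> summable (\<lambda>n. - ((lm n powr r * (bv n \<bullet> v)) *\<^sub>R bv n))"
      by (simp add: summable_minus_iff)
    with False show ?thesis
      by (simp add: frac_pow_def suminf_def summable_def)
  qed
  then show "fnorm r (x - y) = fnorm r (y - x)"
    unfolding frac_norm_def using *[of "y - x"] by (auto simp: norm_minus_commute)
  {
    assume "x \<in> D r" "y \<in> D r"
    then have "x - y \<in> D r" by (rule frac_dom_diff(1))
    moreover have "v = 0" if "v \<in> D r" "fnorm r v = 0" for v
    proof (rule coord_eqI)
      fix n
      have "lm n powr r * (bv n \<bullet> v) = 0"
        using that coord_fpow[of v r n] by (simp add: frac_norm_def)
      then show "bv n \<bullet> v = bv n \<bullet> 0" using lm_pos[of n] by simp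
    qed
    ultimately show "(fnorm r (x - y) = 0) = (x = y)" by force
  }
  assume "x \<in> D r" "y \<in> D r" "z \<in> D r"
  then show "fnorm r (x - z) \<le> fnorm r (x - y) + fnorm r (y - z)"
    using fnorm_triangle[of "x - y" r "y - z"] by (simp add: frac_dom_diff)
qed

end

section \<open>The nonlinearity\<close>

lemma continuous_on_norm_bound:
  fixes x :: "'a::metric_space \<Rightarrow> 'b::real_normed_vector"
    and y :: "'a \<Rightarrow> 'c::real_normed_vector"
  assumes y: "continuous_on U y"
    and le: "\<And>s t. s \<in> U \<Longrightarrow> t \<in> U \<Longrightarrow> norm (x s - x t) \<le> C * norm (y s - y t)"
  shows "continuous_on U x"
proof (rule continuous_on_sequentiallyI)
  fix u s assume us: "\<forall>n. u n \<in> U" "s \<in> U" "u \<longlonglongrightarrow> s"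
  have "(\<lambda>n. y (u n) - y s) \<longlonglongrightarrow> 0"
    using y us unfolding continuous_on_sequentially by (auto simp: o_def LIM_zero_iff)
  then show "(\<lambda>n. x (u n)) \<longlonglongrightarrow> x s"
    by (rule tendsto_norm_bound) (use us le in blast)
qed

section \<open>Adjoints, topology and Borel sets of the fractional domains\<close>

context spectral_basis
begin

text \<open>\<open>adjoint\<close> is defined by choice, so an adjoint has to be produced. This is
  Riesz representation in coordinates: \<open>z\<close> has the coordinates
  \<open>G (bv n) \<bullet> y\<close>.\<close>

lemma adjoint_works:
  fixes G :: "'h \<Rightarrow> 'h"
  assumes G: "bounded_linear G"
  shows "G x \<bullet> y = x \<bullet> adjoint G y"
proof -
  interpret G: bounded_linear G by (rule G)
  obtain B where B: "\<And>x. norm (G x) \<le> norm x * B" "0 \<le> B" using G.nonneg_bounded by auto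
  have "\<exists>z. \<forall>x. G x \<bullet> y = x \<bullet> z" for y
  proof -
    define a where "a n = G (bv n) \<bullet> y" for n
    have "(\<Sum>n<N. (a n)\<^sup>2) \<le> (B * norm y)\<^sup>2" for N
    proof -
      \<comment> \<open>Testing \<open>G\<close> on this vector gives the sum of squares as
        \<open>G v \<bullet> y\<close>, and one factor \<open>norm v\<close> cancels.\<close>
      define v where "v = (\<Sum>n<N. a n *\<^sub>R bv n)"
      have nv: "(norm v)\<^sup>2 = (\<Sum>n<N. (a n)\<^sup>2)" by (simp add: v_def norm_sum_bv)
      also have "\<dots> = G v \<bullet> y"
        by (simp add: v_def G.sum G.scaleR inner_sum_left a_def power2_eq_square)
      also have "\<dots> \<le> norm (G v) * norm y" by (rule norm_cauchy_schwarz)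
      also have "\<dots> \<le> (norm v * B) * norm y" by (intro mult_right_mono B) simp
      finally have "norm v * norm v \<le> norm v * (B * norm y)"
        by (simp add: power2_eq_square mult_ac)
      then have "norm v \<le> B * norm y"
        using B(2) by (cases "norm v = 0") auto
      then show ?thesis unfolding nv[symmetric] by (intro power_mono) auto
    qed
    then have s: "summable (\<lambda>n. (a n)\<^sup>2)"
      by (intro summableI_nonneg_bounded[where x = "(B * norm y)\<^sup>2"]) auto
    define z where "z = (\<Sum>n. a n *\<^sub>R bv n)"
    have cz: "bv n \<bullet> z = a n" for n unfolding z_def by (rule coord_suminf[OF s])
    have "G x \<bullet> y = x \<bullet> z" for x
    proof (rule LIMSEQ_unique)
      show "(\<lambda>N. proj e N x \<bullet> z) \<longlonglongrightarrow> x \<bullet> z" by (intro tendsto_intros proj_tendsto)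
      have "proj e N x \<bullet> z = G (proj e N x) \<bullet> y" for N
        by (simp add: proj_eq inner_sum_left cz a_def G.sum G.scaleR)
      then show "(\<lambda>N. proj e N x \<bullet> z) \<longlonglongrightarrow> G x \<bullet> y"
        by (simp only:) (intro tendsto_intros G.tendsto proj_tendsto)
    qed
    then show ?thesis by blast
  qed
  then have "\<forall>y. \<exists>z. \<forall>x. G x \<bullet> y = x \<bullet> z" by blast
  from choice[OF this] obtain g where "\<forall>y x. G x \<bullet> y = x \<bullet> g y" ..
  then have "\<forall>x y. G x \<bullet> y = x \<bullet> g y" by blast
  from someI[of "\<lambda>f'. \<forall>x y. G x \<bullet> y = x \<bullet> f' y", OF this]
  show ?thesis unfolding adjoint_def by blast
qed

lemma S_self_adjoint: "0 \<le> t \<Longrightarrow> S t v \<bullet> w = v \<bullet> S t w"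
  using inner_sums[of "S t v" w] inner_sums[of v "S t w"]
  by (simp add: coord_S mult_ac sums_iff)

lemma topspace_frac: "topspace (frac_topology lam e r) = D r"
  unfolding frac_topology_def by (rule Metric_space.topspace_mtopology[OF Metric_space_frac])

text \<open>The norm of \<open>D r\<close> dominates that of \<open>H\<close>, so traces of
  \<open>H\<close>-open sets are open in \<open>D r\<close>. From here on measurability can mean
  Borel measurability in \<open>H\<close>.\<close>

lemma measurable_frac_borel_id:
  assumes r: "0 \<le> r"
  shows "(\<lambda>x. x) \<in> frac_borel lam e r \<rightarrow>\<^sub>M borel"
proof (rule borel_measurableI)
  interpret M: Metric_space "D r" "\<lambda>v w. fnorm r (v - w)" by (rule Metric_space_frac)
  fix U :: "'h set" assume U: "open U"
  have "openin (frac_topology lam e r) (U \<inter> D r)"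
    unfolding frac_topology_def M.openin_mtopology
  proof (intro conjI allI impI)
    fix x assume x: "x \<in> U \<inter> D r"
    then obtain \<epsilon> where \<epsilon>: "0 < \<epsilon>" "ball x \<epsilon> \<subseteq> U" using U openE by blast
    have "M.mball x (\<epsilon> / lam 1 powr (- r)) \<subseteq> U \<inter> D r"
    proof
      fix y assume "y \<in> M.mball x (\<epsilon> / lam 1 powr (- r))"
      then have y: "y \<in> D r" "fnorm r (x - y) < \<epsilon> / lam 1 powr (- r)" by auto
      have "norm (x - y) \<le> lam 1 powr (- r) * fnorm r (x - y)"
        using norm_le_fnorm[OF r frac_dom_diff(1)] x y by auto
      also have "\<dots> < \<epsilon>" using y lam_pos[of 1] by (simp add: field_simps)
      finally show "y \<in> U \<inter> D r" using \<epsilon> y by (auto simp: dist_norm)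
    qed
    moreover have "0 < \<epsilon> / lam 1 powr (- r)" using \<epsilon> lam_pos[of 1] by simp
    ultimately show "\<exists>\<rho>>0. M.mball x \<rho> \<subseteq> U \<inter> D r" by blast
  qed auto
  then have "U \<inter> D r \<in> sets (frac_borel lam e r)"
    unfolding frac_borel_def
    by (subst sets_measure_of) (auto dest: openin_subset simp flip: topspace_frac)
  then show "(\<lambda>x. x) -` U \<inter> space (frac_borel lam e r) \<in> sets (frac_borel lam e r)"
    by (simp add: space_frac_borel)
qed

lemma measurable_frac_borelD:
  assumes "W \<in> M \<rightarrow>\<^sub>M frac_borel lam e r" "0 \<le> r"
  shows "W \<in> borel_measurable M" "\<And>\<omega>. \<omega> \<in> space M \<Longrightarrow> W \<omega> \<in> D r"
  using measurable_compose[OF assms(1) measurable_frac_borel_id[OF assms(2)]]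
    measurable_space[OF assms(1)] by (auto simp: space_frac_borel)

lemma continuous_map_fracD:
  assumes "continuous_map (top_of_set U) (frac_topology lam e r) x"
  shows "\<And>t. t \<in> U \<Longrightarrow> x t \<in> D r" "continuous_on U (\<lambda>t. fpow r (x t))"
proof -
  interpret M: Metric_space "D r" "\<lambda>v w. fnorm r (v - w)" by (rule Metric_space_frac)
  show d: "x t \<in> D r" if "t \<in> U" for t
    using continuous_map_image_subset_topspace[OF assms] that by (auto simp: topspace_frac)
  show "continuous_on U (\<lambda>t. fpow r (x t))"
    unfolding continuous_on_topological
  proof (intro ballI allI impI)
    fix t B assume t: "t \<in> U" and B: "open B" "fpow r (x t) \<in> B"
    obtain \<epsilon> where \<epsilon>: "0 < \<epsilon>" "ball (fpow r (x t)) \<epsilon> \<subseteq> B" using B openE by blast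
    from assms[unfolded frac_topology_def M.continuous_map_to_metric] t \<epsilon>
    obtain O' where O': "openin (top_of_set U) O'" "t \<in> O'" "\<forall>y\<in>O'. x y \<in> M.mball (x t) \<epsilon>"
      by (metis topspace_euclidean_subtopology)
    then obtain A where A: "open A" "O' = U \<inter> A" by (auto simp: openin_open)
    show "\<exists>A. open A \<and> t \<in> A \<and> (\<forall>y\<in>U. y \<in> A \<longrightarrow> fpow r (x y) \<in> B)"
    proof (intro exI[of _ A] conjI ballI impI)
      fix y assume y: "y \<in> U" "y \<in> A"
      then have "fnorm r (x t - x y) < \<epsilon>" using O' A by auto
      then have "fpow r (x y) \<in> ball (fpow r (x t)) \<epsilon>"
        using d t y by (simp add: frac_norm_def frac_dom_diff dist_norm)
      then show "fpow r (x y) \<in> B" using \<epsilon> by blast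
    qed (use A O' in auto)
  qed
qed

lemma continuous_on_fpow_imp:
  fixes x :: "real \<Rightarrow> 'h"
  assumes "continuous_on U (\<lambda>t. fpow r (x t))" "\<And>t. t \<in> U \<Longrightarrow> x t \<in> D r" "0 \<le> r"
  shows "continuous_on U x"
  using assms(1)
proof (rule continuous_on_norm_bound)
  fix s t assume "s \<in> U" "t \<in> U"
  then show "norm (x s - x t) \<le> lam 1 powr (- r) * norm (fpow r (x s) - fpow r (x t))"
    using norm_le_fnorm[of r "x s - x t"] assms by (simp add: frac_norm_def frac_dom_diff)
qed

end

locale nemytskii = spectral_basis lam e
  for lam :: "nat \<Rightarrow> real" and e :: "nat \<Rightarrow> 'h::{real_inner, banach, second_countable_topology}" +
  fixes j :: "'v::{banach, second_countable_topology} \<Rightarrow> 'h"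
    and F :: "'v \<Rightarrow> 'v" and F' :: "'v \<Rightarrow> 'v \<Rightarrow>\<^sub>L 'v" and F'' :: "'v \<Rightarrow> 'v \<Rightarrow>\<^sub>L 'v \<Rightarrow>\<^sub>L 'v"
    and c K :: real
  assumes bounded_linear_j: "bounded_linear j" and inj_j: "inj j"
    and K: "0 \<le> K"
    and half_embed: "\<And>u. u \<in> frac_dom lam e (1/2) \<Longrightarrow>
          u \<in> range j \<and> norm (inv j u) \<le> K * frac_norm lam e (1/2) u"
    and F': "\<And>v. (F has_derivative blinfun_apply (F' v)) (at v)"
    and F'': "\<And>v. (F' has_derivative blinfun_apply (F'' v)) (at v)"
    and c: "c \<ge> 0"
    and F'_H: "\<And>v w. norm (j (F' v w)) \<le> c * norm (j w)"
    and F''_V: "\<And>v. norm (F'' v) \<le> c"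
    and F'_adjoint: "\<And>u v. u \<in> frac_dom lam e (1/2) \<Longrightarrow> v \<in> frac_dom lam e (1/2) \<Longrightarrow>
          adjoint (H_extension j (F' (inv j u))) v \<in> frac_dom lam e (1/2) \<and>
          frac_norm lam e (1/2) (adjoint (H_extension j (F' (inv j u))) v)
            \<le> c * (1 + frac_norm lam e (1/2) u) * frac_norm lam e (1/2) v"
begin

sublocale j: bounded_linear j by (rule bounded_linear_j)

abbreviation "iv \<equiv> inv j"

text \<open>Together with \<open>ddrift\<close>, its derivative at \<open>u\<close> in direction
  \<open>w\<close>, this moves the nonlinearity from \<open>V\<close> to \<open>H\<close>. Both are
  total but meaningful only on the range of \<open>j\<close>, in particular on
  \<open>D(1/2)\<close>, where \<open>iv\<close> inverts the inclusion.\<close>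

definition drift :: "'h \<Rightarrow> 'h" where "drift u = j (F (iv u))"

definition ddrift :: "'h \<Rightarrow> 'h \<Rightarrow> 'h" where "ddrift u w = j (F' (iv u) (iv w))"

lemma iv_j [simp]: "iv (j v) = v" using inj_j by simp

lemma j_iv: "u \<in> D r \<Longrightarrow> 1/2 \<le> r \<Longrightarrow> j (iv u) = u"
  using half_embed[of u] frac_mono(1)[of "1/2" r u] by (simp add: f_inv_into_f)

lemma norm_iv_le: "u \<in> D (1/2) \<Longrightarrow> norm (iv u) \<le> K * fnorm (1/2) u"
  using half_embed by blast

lemma iv_add: "u \<in> D (1/2) \<Longrightarrow> w \<in> D (1/2) \<Longrightarrow> iv (u + w) = iv u + iv w"
  by (metis iv_j j.add j_iv order_refl)

lemma iv_diff: "u \<in> D (1/2) \<Longrightarrow> w \<in> D (1/2) \<Longrightarrow> iv (u - w) = iv u - iv w"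
  by (metis iv_j j.diff j_iv order_refl)

lemma iv_proj: "iv (proj e N u) = (\<Sum>n<N. (bv n \<bullet> u) *\<^sub>R iv (bv n))"
proof -
  have "proj e N u = j (\<Sum>n<N. (bv n \<bullet> u) *\<^sub>R iv (bv n))"
    by (simp add: proj_eq j.sum j.scaleR j_iv[OF bv_in_frac_dom order_refl])
  then show ?thesis by simp
qed

lemma continuous_on_iv:
  fixes x :: "real \<Rightarrow> 'h"
  assumes "continuous_on U (\<lambda>t. fpow r (x t))" "\<And>t. t \<in> U \<Longrightarrow> x t \<in> D r" "1/2 \<le> r"
  shows "continuous_on U (\<lambda>t. iv (x t))"
  using assms(1)
proof (rule continuous_on_norm_bound)
  fix s t assume st: "s \<in> U" "t \<in> U"
  then have d: "x s - x t \<in> D r" using assms frac_dom_diff by blast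
  have "norm (iv (x s) - iv (x t)) = norm (iv (x s - x t))"
    using st assms frac_mono(1)[OF assms(3)] by (simp add: iv_diff)
  also have "\<dots> \<le> K * fnorm (1/2) (x s - x t)"
    using d frac_mono(1)[OF assms(3)] by (intro norm_iv_le) blast
  also have "\<dots> \<le> K * (lam 1 powr (1/2 - r) * fnorm r (x s - x t))"
    by (rule mult_left_mono[OF frac_mono(2)[OF assms(3) d] K])
  finally show "norm (iv (x s) - iv (x t)) \<le> K * lam 1 powr (1/2 - r) * norm (fpow r (x s) - fpow r (x t))"
    using st assms by (simp add: frac_norm_def frac_dom_diff mult.assoc)
qed

section \<open>Lipschitz and Taylor bounds for the nonlinearity\<close>

lemma continuous_F: "continuous_on U F"
  by (intro continuous_at_imp_continuous_on ballI has_derivative_continuous[OF F'])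

lemma continuous_on_drift:
  fixes x :: "real \<Rightarrow> 'h"
  assumes "continuous_on U (\<lambda>t. fpow r (x t))" "\<And>t. t \<in> U \<Longrightarrow> x t \<in> D r" "1/2 \<le> r"
  shows "continuous_on U (\<lambda>t. drift (x t))"
  unfolding drift_def
  by (intro j.continuous_on continuous_on_compose2[OF continuous_F continuous_on_iv[OF assms] subset_UNIV])

text \<open>Mean value estimate along the segment from \<open>w\<close> to \<open>v\<close>:
  differentiability is used in \<open>V\<close>, but the speed of \<open>j (F (p t))\<close> is
  measured in \<open>H\<close>.\<close>

lemma F_lipschitz_H: "norm (j (F v) - j (F w)) \<le> c * norm (j v - j w)"
proof -
  define p where "p t = w + t *\<^sub>R (v - w)" for t :: real
  have d: "((\<lambda>t. j (F (p t))) has_vector_derivative j (F' (p t) (v - w))) (at t)" for t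
  proof -
    have "(p has_derivative (\<lambda>h. h *\<^sub>R (v - w))) (at t)"
      unfolding p_def by (auto intro!: derivative_eq_intros)
    from j.has_derivative[OF has_derivative_compose[OF this F']]
    show ?thesis by (simp add: has_vector_derivative_def blinfun.scaleR_right j.scaleR)
  qed
  have "norm (j (F (p 1)) - j (F (p 0))) \<le> c * norm (j v - j w) * 1 - c * norm (j v - j w) * 0"
  proof (rule differentiable_bound_general[OF zero_less_one])
    show "continuous_on {0..1} (\<lambda>t. j (F (p t)))"
      using d by (intro continuous_at_imp_continuous_on) (auto intro: has_vector_derivative_continuous)
    show "((\<lambda>t. c * norm (j v - j w) * t) has_vector_derivative c * norm (j v - j w)) (at t)" for t
      unfolding has_real_derivative_iff_has_vector_derivative[symmetric]
      by (auto intro!: derivative_eq_intros)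
    show "norm (j (F' (p t) (v - w))) \<le> c * norm (j v - j w)" for t
      using F'_H[of "p t" "v - w"] by (simp add: j.diff)
  qed (use d in \<open>auto intro!: continuous_intros\<close>)
  then show ?thesis by (simp add: p_def)
qed

lemma drift_lipschitz:
  assumes "x \<in> D (1/2)" "y \<in> D (1/2)"
  shows "norm (drift x - drift y) \<le> c * norm (x - y)"
  using F_lipschitz_H[of "iv x" "iv y"] assms by (simp add: drift_def j_iv)

text \<open>The bound on \<open>F''\<close> makes \<open>F'\<close> Lipschitz with constant
  \<open>c\<close>; linearization along the segment then gives \<open>c\<close> instead of the
  optimal \<open>c / 2\<close>.\<close>

lemma F_taylor: "norm (F w - F v - F' v (w - v)) \<le> c * (norm (w - v))\<^sup>2"
proof -
  have lip: "norm (F' x - F' v) \<le> c * norm (x - v)" for x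
    by (rule differentiable_bound[of UNIV F' "\<lambda>x. blinfun_apply (F'' x)"])
       (use F'' F''_V in \<open>auto simp: norm_blinfun.rep_eq[symmetric]\<close>)
  have "norm (F w - F v - F' v (w - v)) \<le> norm (w - v) * (c * norm (w - v))"
  proof (rule differentiable_bound_linearization[where S = "(\<lambda>t. v + t *\<^sub>R (w - v)) ` {0..1}"
      and f' = "\<lambda>x. blinfun_apply (F' x)"])
    show "v \<in> (\<lambda>t. v + t *\<^sub>R (w - v)) ` {0..1}" by (auto intro!: image_eqI[of _ _ 0])
    fix x assume "x \<in> (\<lambda>t. v + t *\<^sub>R (w - v)) ` {0..1}"
    then obtain t where "x = v + t *\<^sub>R (w - v)" "t \<in> {0..1}" by (rule imageE)
    then have t: "x = v + t *\<^sub>R (w - v)" "0 \<le> t" "t \<le> 1" by simp_all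
    show "(F has_derivative blinfun_apply (F' x)) (at x within (\<lambda>t. v + t *\<^sub>R (w - v)) ` {0..1})"
      using F' has_derivative_at_withinI by blast
    have "onorm (\<lambda>y. blinfun_apply (F' x) y - blinfun_apply (F' v) y) = norm (F' x - F' v)"
      by (simp add: norm_blinfun.rep_eq minus_blinfun.rep_eq)
    also have "\<dots> \<le> c * norm (x - v)" by (rule lip)
    also have "\<dots> \<le> c * norm (w - v)" using t c by (intro mult_left_mono) (auto simp: mult_left_le_one_le)
    finally show "onorm (blinfun_apply (F' x) - blinfun_apply (F' v)) \<le> c * norm (w - v)"
      by (simp add: fun_diff_def)
  qed auto
  then show ?thesis by (simp add: power2_eq_square mult_ac)
qed

lemma norm_ddrift_le: "w \<in> D (1/2) \<Longrightarrow> norm (ddrift x w) \<le> c * norm w"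
  using F'_H[of "iv x" "iv w"] by (simp add: ddrift_def j_iv)

lemma ddrift_add: "u \<in> D (1/2) \<Longrightarrow> w \<in> D (1/2) \<Longrightarrow> ddrift x (u + w) = ddrift x u + ddrift x w"
  by (simp add: ddrift_def iv_add blinfun.add_right j.add)

lemma ddrift_diff: "u \<in> D (1/2) \<Longrightarrow> w \<in> D (1/2) \<Longrightarrow> ddrift x (u - w) = ddrift x u - ddrift x w"
  by (simp add: ddrift_def iv_diff blinfun.diff_right j.diff)

lemma ddrift_proj: "ddrift x (proj e N w) = (\<Sum>n<N. (bv n \<bullet> w) *\<^sub>R ddrift x (bv n))"
  by (simp add: ddrift_def iv_proj blinfun.sum_right blinfun.scaleR_right j.sum j.scaleR)

text \<open>The definite description needs existence and uniqueness. Eigenvectors lie in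
  \<open>D(1/2)\<close>, hence in the range of \<open>j\<close>, so the operator can be evaluated on
  projections; the bound in \<open>H\<close> makes these values Cauchy, and any bounded extension
  agrees with them.\<close>

lemma H_extension_works:
  assumes w: "w \<in> D (1/2)"
  shows "bounded_linear (H_extension j (F' v))" "H_extension j (F' v) w = j (F' v (iv w))"
proof -
  define G where "G N y = j (F' v (iv (proj e N y)))" for N y
  have Gd: "norm (G N y - G M z) \<le> c * norm (proj e N y - proj e M z)" for N M y z
    using F'_H[of v "iv (proj e N y) - iv (proj e M z)"]
    by (simp add: G_def j.diff blinfun.diff_right j_iv[OF proj_in_frac_dom order_refl])
  have "convergent (\<lambda>N. G N y)" for y
  proof (rule Cauchy_convergent, rule metric_CauchyI)
    fix \<epsilon> :: real assume \<epsilon>: "0 < \<epsilon>"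
    have "Cauchy (\<lambda>N. proj e N y)" using proj_tendsto LIMSEQ_imp_Cauchy by blast
    then obtain M where M: "\<And>m n. m \<ge> M \<Longrightarrow> n \<ge> M \<Longrightarrow> dist (proj e m y) (proj e n y) < \<epsilon> / (c + 1)"
      using \<epsilon> c metric_CauchyD[of _ "\<epsilon> / (c + 1)"] by fastforce
    show "\<exists>M. \<forall>m\<ge>M. \<forall>n\<ge>M. dist (G m y) (G n y) < \<epsilon>"
    proof (intro exI allI impI)
      fix m n assume "m \<ge> M" "n \<ge> M"
      have "dist (G m y) (G n y) \<le> c * dist (proj e m y) (proj e n y)"
        using Gd by (simp add: dist_norm)
      also have "\<dots> \<le> (c + 1) * dist (proj e m y) (proj e n y)"
        by (intro mult_right_mono) auto
      also have "\<dots> < \<epsilon>" using M[OF \<open>m \<ge> M\<close> \<open>n \<ge> M\<close>] c by (simp add: field_simps)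
      finally show "dist (G m y) (G n y) < \<epsilon>" .
    qed
  qed
  then have lim: "(\<lambda>N. G N y) \<longlonglongrightarrow> lim (\<lambda>N. G N y)" for y
    by (simp add: convergent_LIMSEQ_iff)
  define E where "E y = lim (\<lambda>N. G N y)" for y
  have E: "(\<lambda>N. G N y) \<longlonglongrightarrow> E y" for y unfolding E_def by (rule lim)
  have Gs: "G N y = (\<Sum>n<N. (bv n \<bullet> y) *\<^sub>R j (F' v (iv (bv n))))" for N y
    by (simp add: G_def iv_proj blinfun.sum_right blinfun.scaleR_right j.sum j.scaleR)
  have bl: "bounded_linear E"
  proof (rule bounded_linear_intro[where K = c])
    show "E (y + z) = E y + E z" for y z
    proof (rule LIMSEQ_unique[OF E])
      have "G N (y + z) = G N y + G N z" for N
        by (simp add: Gs inner_add_right scaleR_add_left sum.distrib)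
      then show "(\<lambda>N. G N (y + z)) \<longlonglongrightarrow> E y + E z"
        by (simp only:) (intro tendsto_intros E)
    qed
    show "E (r *\<^sub>R y) = r *\<^sub>R E y" for r y
    proof (rule LIMSEQ_unique[OF E])
      have "G N (r *\<^sub>R y) = r *\<^sub>R G N y" for N
        by (simp add: Gs scaleR_sum_right)
      then show "(\<lambda>N. G N (r *\<^sub>R y)) \<longlonglongrightarrow> r *\<^sub>R E y"
        by (simp only:) (intro tendsto_intros E)
    qed
    show "norm (E y) \<le> norm y * c" for y
    proof (rule LIMSEQ_le_const2[OF tendsto_norm[OF E]], intro exI allI impI)
      fix N
      have "norm (G N y) \<le> c * norm (proj e N y)"
        using F'_H[of v "iv (proj e N y)"] by (simp add: G_def j_iv[OF proj_in_frac_dom order_refl])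
      also have "\<dots> \<le> c * norm y" by (intro mult_left_mono norm_proj_le c)
      finally show "norm (G N y) \<le> norm y * c" by (simp add: mult.commute)
    qed
  qed
  have Ej: "E (j u) = j (F' v u)" for u
  proof (rule LIMSEQ_unique[OF E])
    show "(\<lambda>N. G N (j u)) \<longlonglongrightarrow> j (F' v u)"
    proof (rule tendsto_norm_bound[where C = c])
      show "(\<lambda>N. proj e N (j u) - j u) \<longlonglongrightarrow> 0" using proj_tendsto by (simp add: LIM_zero_iff)
      show "norm (G N (j u) - j (F' v u)) \<le> c * norm (proj e N (j u) - j u)" for N
        using F'_H[of v "iv (proj e N (j u)) - u"]
        by (simp add: G_def j.diff blinfun.diff_right j_iv[OF proj_in_frac_dom order_refl])
    qed
  qed
  have "H_extension j (F' v) = E"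
    unfolding H_extension_def
  proof (rule the_equality)
    show "bounded_linear E \<and> (\<forall>w. E (j w) = j (F' v w))" using bl Ej by blast
    fix E' assume E': "bounded_linear E' \<and> (\<forall>w. E' (j w) = j (F' v w))"
    show "E' = E"
    proof
      fix y
      have "E' (proj e N y) = G N y" for N
        using E' j_iv[OF proj_in_frac_dom order_refl, of N y] unfolding G_def by metis
      moreover have "(\<lambda>N. E' (proj e N y)) \<longlonglongrightarrow> E' y"
        by (rule bounded_linear.tendsto[OF _ proj_tendsto]) (use E' in blast)
      ultimately have "(\<lambda>N. G N y) \<longlonglongrightarrow> E' y" by simp
      then show "E' y = E y" by (rule LIMSEQ_unique[OF _ E])
    qed
  qed
  with bl Ej[of "iv w"] show "bounded_linear (H_extension j (F' v))"
    "H_extension j (F' v) w = j (F' v (iv w))"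
    by (auto simp: j_iv[OF w])
qed

text \<open>The increment \<open>S \<delta> x - x\<close> is of order \<open>\<delta>\<close> only in the dual of \<open>D(1/2)\<close>; the adjoint
  hypothesis on the derivative lets the semigroup on the left absorb the missing smoothness.\<close>

lemma S_ddrift_increment:
  assumes \<tau>: "0 < \<tau>" and \<delta>: "0 \<le> \<delta>" and x: "x \<in> D (1/2)"
  shows "norm (S \<tau> (ddrift x (S \<delta> x - x)))
    \<le> c * \<delta> * \<tau> powr (-1/2) * (1 + fnorm (1/2) x)\<^sup>2"
proof -
  let ?n = "fnorm (1/2) x"
  define w where "w = S \<delta> x - x"
  have w: "w \<in> D (1/2)" unfolding w_def using x \<delta> by (intro frac_dom_diff frac_dom_S)
  define z where "z = S \<tau> (ddrift x w)"
  define G where "G = H_extension j (F' (iv x))"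
  have G: "bounded_linear G" "G w = ddrift x w"
    using H_extension_works[OF w] by (auto simp: G_def ddrift_def)
  \<comment> \<open>In \<open>z \<bullet> z\<close> the semigroup moves onto the second factor by
    self-adjointness. Smoothing bounds \<open>y\<close> by \<open>norm z\<close>, which cancels at
    the end.\<close>
  define y where "y = S \<tau> z"
  have y: "y \<in> D (1/2)" "fnorm (1/2) y \<le> \<tau> powr (-1/2) * norm z"
    using S_smoothing[OF \<tau>, of "1/2" z] by (auto simp: y_def)
  define u where "u = adjoint G y"
  have u: "u \<in> D (1/2)" "fnorm (1/2) u \<le> c * (1 + ?n) * fnorm (1/2) y"
    using F'_adjoint[OF x y(1)] by (auto simp: u_def G_def)
  have "norm z * norm z = z \<bullet> z" by (simp add: dot_square_norm power2_eq_square)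
  also have "\<dots> = ddrift x w \<bullet> y"
    using S_self_adjoint[of \<tau> "ddrift x w" z] \<tau> by (simp add: z_def y_def)
  also have "\<dots> = w \<bullet> u"
    using adjoint_works[OF G(1), of w y] by (simp add: G u_def)
  also have "\<dots> \<le> \<delta> * ?n * fnorm (1/2) u"
    using S_minus_id_dual[OF \<delta> x u(1)] by (simp add: w_def)
  also have "\<dots> \<le> \<delta> * (1 + ?n) * (c * (1 + ?n) * (\<tau> powr (-1/2) * norm z))"
    using \<delta> c by (intro mult_mono order_trans[OF u(2)] mult_left_mono y(2)) auto
  finally have "norm z * norm z \<le> (c * \<delta> * \<tau> powr (-1/2) * (1 + ?n)\<^sup>2) * norm z"
    by (simp add: power2_eq_square mult_ac)
  then have "norm z \<le> c * \<delta> * \<tau> powr (-1/2) * (1 + ?n)\<^sup>2"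
    using c \<delta> by (cases "norm z = 0") auto
  then show ?thesis by (simp add: z_def w_def)
qed

text \<open>\<open>iv\<close> need not be continuous for the norm of \<open>H\<close>. On
  projections it is a finite combination of coordinates, and these values converge because
  \<open>D(1/2)\<close> embeds continuously in \<open>V\<close>.\<close>

lemma measurable_iv:
  assumes X: "X \<in> borel_measurable M" and D: "\<And>\<omega>. \<omega> \<in> space M \<Longrightarrow> X \<omega> \<in> D (1/2)"
  shows "(\<lambda>\<omega>. iv (X \<omega>)) \<in> borel_measurable M"
proof (rule borel_measurable_LIMSEQ_metric)
  show "(\<lambda>\<omega>. iv (proj e N (X \<omega>))) \<in> borel_measurable M" for N
    unfolding iv_proj using X by measurable
  fix \<omega> assume "\<omega> \<in> space M"
  then have d: "X \<omega> \<in> D (1/2)" by (rule D)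
  show "(\<lambda>N. iv (proj e N (X \<omega>))) \<longlonglongrightarrow> iv (X \<omega>)"
  proof (rule tendsto_norm_bound[where C = K, OF fnorm_proj_tail_tendsto[OF d]])
    show "norm (iv (proj e N (X \<omega>)) - iv (X \<omega>)) \<le> K * norm (fnorm (1/2) (proj e N (X \<omega>) - X \<omega>))" for N
      using norm_iv_le[OF frac_dom_diff(1)[OF proj_in_frac_dom d]]
      by (simp add: iv_diff[OF proj_in_frac_dom d])
  qed
qed

lemma measurable_drift:
  assumes "X \<in> borel_measurable M" "\<And>\<omega>. \<omega> \<in> space M \<Longrightarrow> X \<omega> \<in> D (1/2)"
  shows "(\<lambda>\<omega>. drift (X \<omega>)) \<in> borel_measurable M"
proof -
  have "(\<lambda>v. j (F v)) \<in> borel_measurable borel"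
    by (intro borel_measurable_continuous_onI j.continuous_on continuous_F)
  from measurable_compose[OF measurable_iv[OF assms] this] show ?thesis by (simp add: drift_def)
qed

text \<open>The space of operators on \<open>V\<close> need not be separable, so \<open>F' v w\<close> is shown measurable as a
  limit of difference quotients.\<close>

lemma measurable_ddrift:
  assumes X: "X \<in> borel_measurable M" "\<And>\<omega>. \<omega> \<in> space M \<Longrightarrow> X \<omega> \<in> D (1/2)"
    and W: "W \<in> borel_measurable M" "\<And>\<omega>. \<omega> \<in> space M \<Longrightarrow> W \<omega> \<in> D (1/2)"
  shows "(\<lambda>\<omega>. ddrift (X \<omega>) (W \<omega>)) \<in> borel_measurable M"
proof -
  define a where "a n = inverse (real (Suc n))" for n
  note [measurable] = measurable_iv[OF X] measurable_iv[OF W]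
  have F[measurable]: "F \<in> borel_measurable borel"
    by (intro borel_measurable_continuous_onI continuous_F)
  have J[measurable]: "j \<in> borel_measurable borel"
    by (intro borel_measurable_continuous_onI j.continuous_on continuous_on_id)
  have "(\<lambda>\<omega>. F' (iv (X \<omega>)) (iv (W \<omega>))) \<in> borel_measurable M"
  proof (rule borel_measurable_LIMSEQ_metric)
    show "(\<lambda>\<omega>. (F (iv (X \<omega>) + a n *\<^sub>R iv (W \<omega>)) - F (iv (X \<omega>))) /\<^sub>R a n) \<in> borel_measurable M" for n
      by measurable
    fix \<omega>
    let ?v = "iv (X \<omega>)" and ?w = "iv (W \<omega>)"
    show "(\<lambda>n. (F (?v + a n *\<^sub>R ?w) - F ?v) /\<^sub>R a n) \<longlonglongrightarrow> F' ?v ?w"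
    proof (rule tendsto_norm_bound[where C = "c * (norm ?w)\<^sup>2"])
      show "a \<longlonglongrightarrow> 0" unfolding a_def by (rule LIMSEQ_inverse_real_of_nat)
      show "norm ((F (?v + a n *\<^sub>R ?w) - F ?v) /\<^sub>R a n - F' ?v ?w) \<le> c * (norm ?w)\<^sup>2 * norm (a n)" for n
      proof -
        have a: "0 < a n" by (simp add: a_def)
        have "(F (?v + a n *\<^sub>R ?w) - F ?v) /\<^sub>R a n - F' ?v ?w
            = (F (?v + a n *\<^sub>R ?w) - F ?v - F' ?v (a n *\<^sub>R ?w)) /\<^sub>R a n"
          using a by (simp add: blinfun.scaleR_right scaleR_diff_right)
        also have "norm \<dots> \<le> (c * (norm (a n *\<^sub>R ?w))\<^sup>2) / a n"
          using F_taylor[of "?v + a n *\<^sub>R ?w" ?v] a by (simp add: divide_right_mono divide_inverse_commute)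
        also have "\<dots> = c * (norm ?w)\<^sup>2 * norm (a n)"
          using a by (simp add: power_mult_distrib power2_eq_square)
        finally show ?thesis .
      qed
    qed
  qed
  from measurable_compose[OF this J] show ?thesis by (simp add: ddrift_def)
qed

end

section \<open>Pathwise estimates\<close>

lemma integral_grid:
  fixes g :: "real \<Rightarrow> 'a::banach"
  assumes "0 \<le> d" "continuous_on {a..a + real n * d} g"
  shows "integral {a..a + real n * d} g
    = (\<Sum>k<n. integral {a + real k * d..a + real (Suc k) * d} g)"
  using assms(2)
proof (induction n)
  case (Suc n)
  have le: "a \<le> a + real n * d" "a + real n * d \<le> a + real (Suc n) * d"
    using assms(1) by (auto simp: algebra_simps)
  have "continuous_on {a..a + real n * d} g"
    by (rule continuous_on_subset[OF Suc.prems]) (use le in auto)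
  moreover have "integral {a..a + real n * d} g + integral {a + real n * d..a + real (Suc n) * d} g
      = integral {a..a + real (Suc n) * d} g"
    by (rule Henstock_Kurzweil_Integration.integral_combine[OF le integrable_continuous_interval[OF Suc.prems]])
  ultimately show ?case using Suc.IH by simp
qed simp

text \<open>Right endpoints keep the relative positions of the nodes in \<open>{0<..1}\<close>, as
  the estimates for noise increments need a strictly later time.\<close>

lemma riemann_sum_tendsto:
  fixes g :: "real \<Rightarrow> 'a::banach"
  assumes h: "0 < h" and g: "continuous_on {a..a + h} g"
  shows "(\<lambda>n. (h / real (Suc n)) *\<^sub>R (\<Sum>i<Suc n. g (a + real (Suc i) / real (Suc n) * h)))
    \<longlonglongrightarrow> integral {a..a + h} g"
proof (rule LIMSEQ_I)
  fix r :: real assume r: "0 < r"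
  define \<epsilon> where "\<epsilon> = r / (2 * h)"
  have \<epsilon>: "0 < \<epsilon>" using r h by (simp add: \<epsilon>_def)
  have "uniformly_continuous_on {a..a + h} g"
    by (rule compact_uniformly_continuous[OF g]) simp
  then obtain \<delta> where \<delta>: "0 < \<delta>"
    "\<And>x y. x \<in> {a..a + h} \<Longrightarrow> y \<in> {a..a + h} \<Longrightarrow> dist y x < \<delta> \<Longrightarrow> dist (g y) (g x) < \<epsilon>"
    using \<epsilon> unfolding uniformly_continuous_on_def by meson
  obtain n0 :: nat where n0: "h / \<delta> < real n0" using reals_Archimedean2 by blast
  show "\<exists>no. \<forall>n\<ge>no. norm ((h / real (Suc n)) *\<^sub>R (\<Sum>i<Suc n. g (a + real (Suc i) / real (Suc n) * h))
      - integral {a..a + h} g) < r"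
  proof (intro exI allI impI)
    fix n assume n: "n \<ge> n0"
    define d where "d = h / real (Suc n)"
    have d: "0 < d" "real (Suc n) * d = h" using h by (auto simp: d_def)
    have "h / \<delta> < real (Suc n)" using n0 n by simp
    then have d\<delta>: "d < \<delta>" using \<delta>(1) h by (simp add: d_def field_simps)
    have node: "real (Suc i) / real (Suc n) * h = real (Suc i) * d" for i by (simp add: d_def)
    have bnd: "norm (d *\<^sub>R g (a + real (Suc i) * d) - integral {a + real i * d..a + real (Suc i) * d} g) \<le> \<epsilon> * d"
      if i: "i < Suc n" for i
    proof -
      define p where "p = a + real i * d"
      define q where "q = a + real (Suc i) * d"
      have pq: "p \<le> q" "q - p = d" using d by (auto simp: p_def q_def algebra_simps)
      have "real (Suc i) * d \<le> real (Suc n) * d"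
        using i d by (intro mult_right_mono) auto
      then have sub: "{p..q} \<subseteq> {a..a + h}"
        unfolding d(2) using d(1) by (auto simp: p_def q_def intro: order_trans[rotated])
      have gc: "continuous_on {p..q} g" by (rule continuous_on_subset[OF g sub])
      have "integral {p..q} (\<lambda>s. g s - g q) = integral {p..q} g - integral {p..q} (\<lambda>s. g q)"
        by (intro Henstock_Kurzweil_Integration.integral_diff integrable_continuous_interval gc continuous_on_const)
      then have "integral {p..q} (\<lambda>s. g s - g q) = integral {p..q} g - d *\<^sub>R g q"
        using pq by simp
      moreover have "norm (integral {p..q} (\<lambda>s. g s - g q)) \<le> \<epsilon> * (q - p)"
      proof (rule integral_bound[OF pq(1)])
        show "continuous_on {p..q} (\<lambda>s. g s - g q)" by (intro continuous_intros gc)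
        fix s assume s: "s \<in> {p..q}"
        have q: "q \<in> {p..q}" using pq by simp
        have "dist s q < \<delta>" using s pq d\<delta> by (auto simp: dist_real_def)
        then have "dist (g s) (g q) < \<epsilon>" using \<delta>(2)[of q s] s q sub by blast
        then show "norm (g s - g q) \<le> \<epsilon>" by (simp add: dist_norm)
      qed
      ultimately have "norm (d *\<^sub>R g q - integral {p..q} g) \<le> \<epsilon> * d"
        by (simp add: pq(2) norm_minus_commute)
      then show ?thesis by (simp only: p_def q_def)
    qed
    have "integral {a..a + h} g = (\<Sum>i<Suc n. integral {a + real i * d..a + real (Suc i) * d} g)"
      using integral_grid[of d a "Suc n" g] g d by (simp only: d(2))
    then have "norm ((h / real (Suc n)) *\<^sub>R (\<Sum>i<Suc n. g (a + real (Suc i) / real (Suc n) * h)) - integral {a..a + h} g)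
      = norm (\<Sum>i<Suc n. d *\<^sub>R g (a + real (Suc i) * d) - integral {a + real i * d..a + real (Suc i) * d} g)"
      unfolding node d_def[symmetric] by (simp only: sum_subtractf scaleR_sum_right)
    also have "\<dots> \<le> (\<Sum>i<Suc n. \<epsilon> * d)"
      by (rule sum_norm_le) (rule bnd, simp)
    also have "\<dots> = real (Suc n) * (\<epsilon> * d)" by (simp only: sum_constant card_lessThan)
    also have "\<dots> = \<epsilon> * h" unfolding d(2)[symmetric] by (simp only: mult_ac)
    also have "\<dots> < r" using r h by (simp add: \<epsilon>_def)
    finally show "norm ((h / real (Suc n)) *\<^sub>R (\<Sum>i<Suc n. g (a + real (Suc i) / real (Suc n) * h))
      - integral {a..a + h} g) < r" .
  qed
qed

lemma continuous_on_powr_const: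
  fixes f :: "'a::topological_space \<Rightarrow> real"
  assumes "continuous_on U f" "\<And>s. s \<in> U \<Longrightarrow> 0 \<le> f s" "0 < a"
  shows "continuous_on U (\<lambda>s. f s powr a)"
  by (rule continuous_on_powr') (use assms in auto)

lemma power2_sum_le: "(a + b)\<^sup>2 \<le> 2 * a\<^sup>2 + 2 * b\<^sup>2" for a b :: real
  using sum_squares_bound[of a b] by (simp add: power2_sum)

lemma sum_inverse_le_ln: "(\<Sum>i<p. 1 / real (Suc i)) \<le> 1 + ln (real p)"
\<comment> \<open>The base case rests on the convention \<open>ln 0 = 0\<close>.\<close>
proof (induction p)
  case (Suc p)
  show ?case
  proof (cases "p = 0")
    case False
    then have p: "0 < real p" by simp
    have "ln (real p / real (Suc p)) \<le> real p / real (Suc p) - 1"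
      by (rule ln_le_minus_one) (use p in simp)
    then have "1 / real (Suc p) \<le> ln (real (Suc p)) - ln (real p)"
      using p by (simp add: ln_div field_simps)
    then show ?thesis using Suc by simp
  qed simp
qed simp

text \<open>Read backwards, this is a lower sum for the integral of \<open>s powr (-1/2)\<close>.
  The singularity is integrable, so no logarithm arises.\<close>

lemma sum_inverse_sqrt_le:
  assumes h: "0 < h"
  shows "(\<Sum>k<m. h * (real m * h - real k * h) powr (-1/2)) \<le> 2 * sqrt (real m * h)"
proof -
  have "(\<Sum>i<m. h * (real (Suc i) * h) powr (-1/2)) \<le> 2 * sqrt (real m * h)"
  proof (induction m)
    case (Suc m)
    define a where "a = sqrt (real (Suc m) * h)"
    define b where "b = sqrt (real m * h)"
    have a: "0 < a" "a\<^sup>2 = real (Suc m) * h" and b: "0 \<le> b" "b\<^sup>2 = real m * h"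
      using h by (auto simp: a_def b_def)
    have ba: "b \<le> a" unfolding a_def b_def using h by (intro real_sqrt_le_mono mult_right_mono) auto
    have "h = (a - b) * (a + b)" using a b by (simp add: algebra_simps power2_eq_square)
    also have "\<dots> \<le> (a - b) * (2 * a)" using ba by (intro mult_left_mono) auto
    finally have "h / a \<le> 2 * a - 2 * b" using a by (simp add: field_simps)
    moreover have "h * (real (Suc m) * h) powr (-1/2) = h / a"
      using h by (simp add: a_def powr_minus_divide powr_half_sqrt)
    ultimately show ?case using Suc by (simp add: a_def b_def)
  qed simp
  moreover have "(\<Sum>k<m. h * (real m * h - real k * h) powr (-1/2)) = (\<Sum>i<m. h * (real (Suc i) * h) powr (-1/2))"
  proof -
    have "(\<Sum>k<m. h * (real m * h - real k * h) powr (-1/2)) = (\<Sum>k<m. h * (real (Suc (m - Suc k)) * h) powr (-1/2))"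
      by (intro sum.cong refl) (auto simp: of_nat_diff algebra_simps)
    then show ?thesis
      using sum.nat_diff_reindex[of "\<lambda>i. h * (real (Suc i) * h) powr (-1/2)" m] by simp
  qed
  ultimately show ?thesis by simp
qed

locale mild_setting = nemytskii lam e j F F' F'' c K
  for lam and e :: "nat \<Rightarrow> 'h::{real_inner, banach, second_countable_topology}"
    and j :: "'v::{banach, second_countable_topology} \<Rightarrow> 'h" and F F' F'' c K +
  fixes T \<gamma> :: real
  assumes T: "0 < T" and \<gamma>: "1/2 \<le> \<gamma>" "\<gamma> < 1"
begin

text \<open>The three summands come from the initial value, the noise and \<open>drift 0\<close>;
  the factor 2 and the rate \<open>2 * c + 1\<close> come from the weighted supremum in
  \<open>norm_x_le\<close>.\<close>

definition "C_sup = 2 * (lam 1 powr (-1) + lam 1 powr (-\<gamma>) + T * norm (drift 0)) * exp ((2 * c + 1) * T)"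
definition "C_drift = norm (drift 0) + c * C_sup"
text \<open>Initial value, drift integral and noise;
  \<open>T powr (1 - \<gamma>) / (1 - \<gamma>)\<close> is the integral of
  \<open>s powr (-\<gamma>)\<close> up to \<open>T\<close>.\<close>

definition "C_frac = lam 1 powr (\<gamma> - 1) + C_drift * (T powr (1 - \<gamma>) / (1 - \<gamma>)) + 1"
definition "C_half = lam 1 powr (1/2 - \<gamma>) * C_frac"
text \<open>The 1 is due to the initial value, and 6 = 4 + 2 to the drift integrals before and after
  the earlier time.\<close>

definition "C_inc = 1 + 6 * C_drift"
definition "C_rem = onorm j * c * (2 * (K * C_inc)\<^sup>2 + 2)"
text \<open>\<open>2 * sqrt T\<close> bounds the grid sum of \<open>h * \<tau> powr (-1/2)\<close>;
  the other two terms are summed with total weight at most \<open>T\<close>.\<close>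

definition "C_loc = 2 * sqrt T * c * (1 + C_half)\<^sup>2 + T * c * C_drift + T * C_rem"

lemma C_sup_nonneg: "0 \<le> C_sup" unfolding C_sup_def using T by simp
lemma C_drift_nonneg: "0 \<le> C_drift" unfolding C_drift_def using c C_sup_nonneg by simp
lemma C_frac_nonneg: "0 \<le> C_frac" unfolding C_frac_def using C_drift_nonneg \<gamma> by simp
lemma C_rem_nonneg: "0 \<le> C_rem"
  unfolding C_rem_def using c onorm_pos_le[OF bounded_linear_j] by simp
lemma grid:
  assumes "0 < h" "real m * h \<le> T" "k < m" "0 < r" "r \<le> 1"
  shows "0 \<le> real k * h" "real k * h < real k * h + r * h" "real k * h + r * h \<le> T"
    "0 < real m * h - real k * h"
proof -
  have "real (Suc k) * h \<le> real m * h" using assms by (intro mult_right_mono) auto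
  moreover have "r * h \<le> h" using assms by (simp add: mult_left_le_one_le)
  moreover have "real (Suc k) * h = real k * h + h" by (simp add: algebra_simps)
  ultimately show "real k * h + r * h \<le> T" "0 < real m * h - real k * h"
    using assms(1,2) by linarith+
qed (use assms in auto)

end

text \<open>One sample path. \<open>R\<close> bounds the initial value and the noise only; every
  bound on \<open>x\<close> is derived from the mild equation.\<close>

locale mild_path = mild_setting lam e j F F' F'' c K T \<gamma>
  for lam :: "nat \<Rightarrow> real" and e :: "nat \<Rightarrow> 'h::{real_inner, banach, second_countable_topology}"
    and j :: "'v::{banach, second_countable_topology} \<Rightarrow> 'h" and F F' F'' c K T \<gamma> +
  fixes R :: real and x0 :: 'h and z x :: "real \<Rightarrow> 'h"
  assumes R: "1 \<le> R"
    and x0: "x0 \<in> frac_dom lam e 1" "frac_norm lam e 1 x0 \<le> R"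
    and z: "\<And>t. t \<in> {0..T} \<Longrightarrow> z t \<in> frac_dom lam e \<gamma>"
      "\<And>t. t \<in> {0..T} \<Longrightarrow> frac_norm lam e \<gamma> (z t) \<le> R"
    and x: "\<And>t. t \<in> {0..T} \<Longrightarrow> x t \<in> frac_dom lam e \<gamma>"
      "continuous_on {0..T} (\<lambda>t. frac_pow lam e \<gamma> (x t))"
    and mild: "\<And>t. t \<in> {0..T} \<Longrightarrow>
      x t = semigrp lam e t x0 + integral {0..t} (\<lambda>s. semigrp lam e (t - s) (drift (x s))) + z t"
begin

section \<open>A priori bounds and time regularity of one path\<close>

lemma x_half: "t \<in> {0..T} \<Longrightarrow> x t \<in> D (1/2)" and z_half: "t \<in> {0..T} \<Longrightarrow> z t \<in> D (1/2)"
  using x(1) z(1) frac_mono(1)[OF \<gamma>(1)] by auto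

lemma continuous_x: "continuous_on {0..T} x"
  by (rule continuous_on_fpow_imp[OF x(2,1)]) (use \<gamma> in auto)

lemma continuous_drift: "continuous_on {0..T} (\<lambda>s. drift (x s))"
  by (rule continuous_on_drift[OF x(2,1)]) (use \<gamma> in auto)

lemma continuous_S_drift:
  assumes "0 \<le> a" "b \<le> t" "b \<le> T"
  shows "continuous_on {a..b} (\<lambda>s. S (t - s) (drift (x s)))"
  by (rule continuous_on_S_compose)
     (use assms in \<open>auto intro!: continuous_intros continuous_on_subset[OF continuous_drift]\<close>)

lemma norm_drift_le: "t \<in> {0..T} \<Longrightarrow> norm (drift (x t)) \<le> norm (drift 0) + c * norm (x t)"
  using drift_lipschitz[OF x_half zero_in_frac_dom, of t] norm_triangle_sub[of "drift (x t)" "drift 0"]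
  by simp

text \<open>Gronwall's argument at the maximum \<open>t0\<close> of the exponentially weighted norm:
  there the mild equation bounds the norm by the data plus half of itself.\<close>

lemma norm_x_le:
  assumes t: "t \<in> {0..T}"
  shows "norm (x t) \<le> C_sup * R"
proof -
  \<comment> \<open>This rate gives \<open>c / b \<le> 1/2\<close>, so the drift integral is
    absorbed on the left; the added 1 keeps \<open>b\<close> positive when
    \<open>c = 0\<close>.\<close>
  define b where "b = 2 * c + 1"
  have b: "0 < b" "2 * c \<le> b" using c by (auto simp: b_def)
  have "continuous_on {0..T} (\<lambda>s. exp (- b * s) * norm (x s))"
    by (intro continuous_intros continuous_x)
  then obtain t0 where t0: "t0 \<in> {0..T}"
    and max: "\<And>s. s \<in> {0..T} \<Longrightarrow> exp (- b * s) * norm (x s) \<le> exp (- b * t0) * norm (x t0)"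
    using continuous_attains_sup[of "{0..T}" "\<lambda>s. exp (- b * s) * norm (x s)"] T by auto
  define m where "m = exp (- b * t0) * norm (x t0)"
  have m0: "0 \<le> m" by (simp add: m_def)
  have xm: "norm (x s) \<le> m * exp (b * s)" if "s \<in> {0..T}" for s
    using max[OF that] by (simp add: m_def exp_minus field_simps)
  define a where "a = (lam 1 powr (-1) + lam 1 powr (-\<gamma>) + T * norm (drift 0)) * R"
  define G where "G s = norm (drift 0) * s + c * m * exp (b * s) / b" for s
  have "norm (integral {0..t0} (\<lambda>s. S (t0 - s) (drift (x s)))) \<le> G t0 - G 0"
  proof (rule norm_integral_le_antiderivative)
    show "continuous_on {0..t0} (\<lambda>s. S (t0 - s) (drift (x s)))"
      using t0 by (intro continuous_S_drift) auto
    show "continuous_on {0..t0} G" unfolding G_def using b by (intro continuous_intros) auto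
    show "(G has_real_derivative (norm (drift 0) + c * (m * exp (b * s)))) (at s)" for s
      unfolding G_def using b by (auto intro!: derivative_eq_intros)
    fix s assume s: "0 < s" "s < t0"
    then have sT: "s \<in> {0..T}" using t0 by auto
    have "norm (S (t0 - s) (drift (x s))) \<le> norm (drift (x s))"
      using s by (intro norm_S_le) simp
    also have "\<dots> \<le> norm (drift 0) + c * norm (x s)" by (rule norm_drift_le[OF sT])
    also have "\<dots> \<le> norm (drift 0) + c * (m * exp (b * s))"
      by (intro add_left_mono mult_left_mono xm sT c)
    finally show "norm (S (t0 - s) (drift (x s))) \<le> norm (drift 0) + c * (m * exp (b * s))" .
  qed (use t0 in simp)
  also have "G t0 - G 0 \<le> norm (drift 0) * T * R + m * exp (b * t0) / 2"
  proof -
    have "norm (drift 0) * t0 \<le> norm (drift 0) * (T * R)"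
      using t0 R T by (intro mult_left_mono) (auto intro: order_trans[OF _ mult_left_mono[of 1 R T]])
    moreover have "c * m * exp (b * t0) / b \<le> m * exp (b * t0) / 2"
      using mult_right_mono[OF b(2), of "m * exp (b * t0)"] b m0 by (simp add: field_simps)
    moreover have "0 \<le> c * m / b" using c m0 b by simp
    moreover have "G t0 - G 0 = norm (drift 0) * t0 + c * m * exp (b * t0) / b - c * m / b"
      by (simp add: G_def)
    ultimately show ?thesis unfolding mult.assoc by linarith
  qed
  finally have I: "norm (integral {0..t0} (\<lambda>s. S (t0 - s) (drift (x s))))
      \<le> norm (drift 0) * T * R + m * exp (b * t0) / 2" .
  have "norm (S t0 x0) \<le> norm x0" using t0 by (intro norm_S_le) simp
  also have "\<dots> \<le> lam 1 powr (-1) * fnorm 1 x0" by (rule norm_le_fnorm) (use x0 in auto)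
  also have "\<dots> \<le> lam 1 powr (-1) * R" by (intro mult_left_mono x0) simp
  finally have 1: "norm (S t0 x0) \<le> lam 1 powr (-1) * R" .
  have "norm (z t0) \<le> lam 1 powr (-\<gamma>) * fnorm \<gamma> (z t0)"
    by (rule norm_le_fnorm) (use z t0 \<gamma> in auto)
  also have "\<dots> \<le> lam 1 powr (-\<gamma>) * R" by (intro mult_left_mono z t0) simp
  finally have 2: "norm (z t0) \<le> lam 1 powr (-\<gamma>) * R" .
  have "m * exp (b * t0) = norm (x t0)" by (simp add: m_def exp_minus)
  also have "\<dots> \<le> norm (S t0 x0) + norm (integral {0..t0} (\<lambda>s. S (t0 - s) (drift (x s)))) + norm (z t0)"
    by (subst mild[OF t0]) (intro norm_triangle_le add_mono norm_triangle_ineq order_refl)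
  also have "\<dots> \<le> a + m * exp (b * t0) / 2"
    using I 1 2 by (simp add: a_def algebra_simps)
  finally have "m * exp (b * t0) \<le> 2 * a" by simp
  moreover have "m \<le> m * exp (b * t0)" using m0 b t0 by (simp add: mult_left_mono[of 1 "exp (b*t0)" m, simplified])
  ultimately have m2: "m \<le> 2 * a" by simp
  have "norm (x t) \<le> m * exp (b * t)" by (rule xm[OF t])
  also have "\<dots> \<le> (2 * a) * exp (b * T)"
    using m2 m0 t b by (intro mult_mono) auto
  also have "\<dots> = C_sup * R" by (simp add: C_sup_def a_def b_def)
  finally show ?thesis .
qed

lemma norm_drift:
  assumes "t \<in> {0..T}" shows "norm (drift (x t)) \<le> C_drift * R"
proof -
  have "norm (drift (x t)) \<le> norm (drift 0) * 1 + c * norm (x t)" using norm_drift_le[OF assms] by simp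
  also have "\<dots> \<le> norm (drift 0) * R + c * (C_sup * R)"
    by (intro add_mono mult_left_mono norm_x_le assms R c) simp
  finally show ?thesis by (simp add: C_drift_def algebra_simps)
qed

lemma C_drift_R: "0 \<le> C_drift * R" using C_drift_nonneg R by simp

text \<open>Smoothing bounds the integrand by a multiple of \<open>(t - s) powr (-\<gamma>)\<close>,
  integrable since \<open>\<gamma> < 1\<close>; \<open>G\<close> is its antiderivative.\<close>

lemma fnorm_x:
  assumes t: "t \<in> {0..T}" shows "fnorm \<gamma> (x t) \<le> C_frac * R"
proof -
  have g1: "0 < 1 - \<gamma>" using \<gamma> by simp
  define G where "G s = - (C_drift * R * (t - s) powr (1 - \<gamma>) / (1 - \<gamma>))" for s
  have gc: "continuous_on {0..t} (\<lambda>s. S (t - s) (drift (x s)))"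
    using t by (intro continuous_S_drift) auto
  have Gc: "continuous_on {0..t} G"
    unfolding G_def using g1
    by (intro continuous_on_minus continuous_on_divide continuous_on_mult continuous_on_const
          continuous_on_powr_const continuous_on_diff continuous_on_id) auto
  have G': "(G has_real_derivative C_drift * R * (t - s) powr (-\<gamma>)) (at s)" if "0 < s" "s < t" for s
  proof -
    have "(G has_real_derivative - (C_drift * R * ((1 - \<gamma>) * (t - s) powr (1 - \<gamma> - 1) * (- 1)) / (1 - \<gamma>))) (at s)"
      unfolding G_def using that by (auto intro!: derivative_eq_intros)
    moreover have "- (C_drift * R * ((1 - \<gamma>) * (t - s) powr (1 - \<gamma> - 1) * (- 1)) / (1 - \<gamma>)) = C_drift * R * (t - s) powr (-\<gamma>)"
      using g1 by (simp add: field_simps)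
    ultimately show ?thesis by simp
  qed
  have key: "S (t - s) (drift (x s)) \<in> D \<gamma> \<and> fnorm \<gamma> (S (t - s) (drift (x s))) \<le> C_drift * R * (t - s) powr (-\<gamma>)"
    if "0 < s" "s < t" for s
  proof -
    have s: "s \<in> {0..T}" "0 < t - s" using t that by auto
    have "fnorm \<gamma> (S (t - s) (drift (x s))) \<le> (t - s) powr (-\<gamma>) * norm (drift (x s))"
      by (rule S_smoothing(2)) (use s \<gamma> in auto)
    also have "\<dots> \<le> (t - s) powr (-\<gamma>) * (C_drift * R)" by (intro mult_left_mono norm_drift s) simp
    finally show ?thesis using S_smoothing(1)[of "t - s" \<gamma>] s \<gamma> by (simp add: mult_ac)
  qed
  have t0: "0 \<le> t" using t by simp
  note I = frac_integral_le[OF t0 gc Gc G' key]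
  have "G t - G 0 = C_drift * R * (t powr (1 - \<gamma>) / (1 - \<gamma>))" using g1 by (simp add: G_def)
  also have "\<dots> \<le> C_drift * R * (T powr (1 - \<gamma>) / (1 - \<gamma>))"
    using t g1 C_drift_R by (intro mult_left_mono divide_right_mono powr_mono2) auto
  finally have GG: "G t - G 0 \<le> C_drift * R * (T powr (1 - \<gamma>) / (1 - \<gamma>))" .
  have x0\<gamma>: "x0 \<in> D \<gamma>" "fnorm \<gamma> x0 \<le> lam 1 powr (\<gamma> - 1) * fnorm 1 x0"
    using frac_mono[of \<gamma> 1 x0] x0 \<gamma> by auto
  have "lam 1 powr (\<gamma> - 1) * fnorm 1 x0 \<le> lam 1 powr (\<gamma> - 1) * R" by (intro mult_left_mono x0) simp
  then have S0: "S t x0 \<in> D \<gamma>" "fnorm \<gamma> (S t x0) \<le> lam 1 powr (\<gamma> - 1) * R"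
    using frac_dom_S[OF t0 x0\<gamma>(1)] x0\<gamma>(2) by (blast, linarith)
  have "fnorm \<gamma> (x t) \<le> fnorm \<gamma> (S t x0) + fnorm \<gamma> (integral {0..t} (\<lambda>s. S (t - s) (drift (x s)))) + fnorm \<gamma> (z t)"
    unfolding mild[OF t]
    using fnorm_triangle[OF S0(1) I(1)] fnorm_triangle[OF frac_dom_add(1)[OF S0(1) I(1)] z(1)[OF t]] by linarith
  also have "\<dots> \<le> C_frac * R"
    using S0(2) I(2) GG z(2)[OF t] by (simp add: C_frac_def algebra_simps)
  finally show ?thesis .
qed

lemma fnorm_half_x:
  assumes t: "t \<in> {0..T}" shows "fnorm (1/2) (x t) \<le> C_half * R"
proof -
  have "fnorm (1/2) (x t) \<le> lam 1 powr (1/2 - \<gamma>) * fnorm \<gamma> (x t)"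
    by (rule frac_mono(2)[OF \<gamma>(1) x(1)[OF t]])
  also have "\<dots> \<le> lam 1 powr (1/2 - \<gamma>) * (C_frac * R)" by (intro mult_left_mono fnorm_x t) simp
  finally show ?thesis by (simp add: C_half_def)
qed

text \<open>Without the noise a path is Hoelder of order 1/2 in \<open>D(1/2)\<close>, hence in
  \<open>V\<close>. Squared in the Taylor remainder, this gives order \<open>s - t\<close>.\<close>

lemma increment_half:
  assumes t: "0 \<le> t" and ts: "t \<le> s" and s: "s \<le> T"
  shows "fnorm (1/2) ((x s - z s) - (x t - z t)) \<le> C_inc * R * (s - t) powr (1/2)"
proof -
  define \<delta> where "\<delta> = s - t"
  have \<delta>: "0 \<le> \<delta>" using ts by (simp add: \<delta>_def)
  have tT: "t \<in> {0..T}" and sT: "s \<in> {0..T}" using assms by auto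
  define g where "g r = S (s - r) (drift (x r)) - S (t - r) (drift (x r))" for r
  \<comment> \<open>\<open>A\<close> is the change of the initial term, \<open>B\<close> the change
    of the semigroup in the integral over the past, \<open>E\<close> the new part of the
    integral.\<close>
  define A where "A = S s x0 - S t x0"
  define B where "B = integral {0..t} g"
  define E where "E = integral {t..s} (\<lambda>r. S (s - r) (drift (x r)))"
  have "integral {0..s} (\<lambda>r. S (s - r) (drift (x r)))
      = integral {0..t} (\<lambda>r. S (s - r) (drift (x r))) + E"
    unfolding E_def
    by (rule Henstock_Kurzweil_Integration.integral_combine[symmetric, OF t ts integrable_continuous_interval[OF continuous_S_drift]])
       (use assms in auto)
  moreover have "B = integral {0..t} (\<lambda>r. S (s - r) (drift (x r))) - integral {0..t} (\<lambda>r. S (t - r) (drift (x r)))"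
    unfolding B_def g_def using assms
    by (intro Henstock_Kurzweil_Integration.integral_diff integrable_continuous_interval continuous_S_drift) auto
  ultimately have eq: "(x s - z s) - (x t - z t) = A + B + E"
    using mild[OF tT] mild[OF sT] by (simp add: A_def)
  have A: "A \<in> D (1/2)" "fnorm (1/2) A \<le> R * \<delta> powr (1/2)"
  proof -
    have Aeq: "A = S t (S \<delta> x0 - x0)" using t \<delta> by (simp add: A_def S_diff S_S \<delta>_def)
    have d: "S \<delta> x0 - x0 \<in> D (1/2)" "fnorm (1/2) (S \<delta> x0 - x0) \<le> \<delta> powr (1/2) * fnorm 1 x0"
      using S_minus_id_half[of \<delta> x0 "1/2"] \<delta> x0 by auto
    have "fnorm (1/2) A \<le> fnorm (1/2) (S \<delta> x0 - x0)" unfolding Aeq by (rule frac_dom_S(2)[OF t d(1)])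
    also have "\<dots> \<le> \<delta> powr (1/2) * fnorm 1 x0" by (rule d(2))
    also have "\<dots> \<le> \<delta> powr (1/2) * R" by (intro mult_left_mono x0) simp
    finally show "fnorm (1/2) A \<le> R * \<delta> powr (1/2)" by (simp add: mult.commute)
    show "A \<in> D (1/2)" unfolding Aeq by (rule frac_dom_S(1)[OF t d(1)])
  qed
  \<comment> \<open>Antiderivative of the bound in \<open>S_diff_half\<close>. Both singular powers
    become continuous square roots, and the one of \<open>t - r\<close> vanishes at
    \<open>r = t\<close>.\<close>
  define G where "G r = 4 * (C_drift * R) * ((s - r) powr (1/2) - (t - r) powr (1/2))" for r
  have key: "g r \<in> D (1/2) \<and> fnorm (1/2) (g r) \<le> 2 * (C_drift * R) * ((t - r) powr (-1/2) - (s - r) powr (-1/2))"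
    if r: "0 < r" "r < t" for r
  proof -
    have sr: "s - r = (t - r) + \<delta>" by (simp add: \<delta>_def)
    have rT: "r \<in> {0..T}" using r tT by auto
    have k0: "0 \<le> 2 * ((t - r) powr (-1/2) - (t - r + \<delta>) powr (-1/2))"
      using r \<delta> by (auto intro!: powr_mono2')
    have "fnorm (1/2) (g r) \<le> 2 * ((t - r) powr (-1/2) - (t - r + \<delta>) powr (-1/2)) * norm (drift (x r))"
      unfolding g_def sr by (rule S_diff_half(2)) (use r \<delta> in auto)
    also have "\<dots> \<le> 2 * ((t - r) powr (-1/2) - (t - r + \<delta>) powr (-1/2)) * (C_drift * R)"
      by (rule mult_left_mono[OF norm_drift[OF rT] k0])
    finally have "fnorm (1/2) (g r) \<le> 2 * (C_drift * R) * ((t - r) powr (-1/2) - (s - r) powr (-1/2))"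
      by (simp only: sr mult_ac)
    moreover have "g r \<in> D (1/2)"
      unfolding g_def sr by (rule S_diff_half(1)) (use r \<delta> in auto)
    ultimately show ?thesis by blast
  qed
  have G': "(G has_real_derivative 2 * (C_drift * R) * ((t - r) powr (-1/2) - (s - r) powr (-1/2))) (at r)"
    if r: "0 < r" "r < t" for r
  proof -
    have "(G has_real_derivative 4 * (C_drift * R) * ((1/2) * (s - r) powr (1/2 - 1) * (-1) - (1/2) * (t - r) powr (1/2 - 1) * (-1))) (at r)"
      unfolding G_def using r ts by (auto intro!: derivative_eq_intros)
    then show ?thesis by (simp add: algebra_simps)
  qed
  have gc: "continuous_on {0..t} g"
    unfolding g_def using assms by (intro continuous_on_diff continuous_S_drift) auto
  have Gc: "continuous_on {0..t} G"
    unfolding G_def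
    by (intro continuous_on_diff continuous_on_mult continuous_on_const
          continuous_on_powr_const continuous_on_id) (use ts in auto)
  note Bb = frac_integral_le[OF t gc Gc G' key, folded B_def]
  \<comment> \<open>The contribution of the lower limit has a favourable sign and is
    dropped.\<close>
  have "s powr (1/2) \<ge> t powr (1/2)" using t ts by (intro powr_mono2) auto
  then have "4 * (C_drift * R) * (\<delta> powr (1/2) - (s powr (1/2) - t powr (1/2))) \<le> 4 * (C_drift * R) * \<delta> powr (1/2)"
    using C_drift_R by (intro mult_left_mono) auto
  then have B: "B \<in> D (1/2)" "fnorm (1/2) B \<le> 4 * (C_drift * R) * \<delta> powr (1/2)"
    using Bb by (auto simp: G_def \<delta>_def algebra_simps)
  define H where "H r = - (2 * (C_drift * R) * (s - r) powr (1/2))" for r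
  have H': "(H has_real_derivative C_drift * R * (s - r) powr (-1/2)) (at r)" if r: "t < r" "r < s" for r
  proof -
    have "(H has_real_derivative - (2 * (C_drift * R) * ((1/2) * (s - r) powr (1/2 - 1) * (-1)))) (at r)"
      unfolding H_def using r by (auto intro!: derivative_eq_intros)
    then show ?thesis by (rule DERIV_cong) simp
  qed
  have Hkey: "S (s - r) (drift (x r)) \<in> D (1/2) \<and>
      fnorm (1/2) (S (s - r) (drift (x r))) \<le> C_drift * R * (s - r) powr (-1/2)" if r: "t < r" "r < s" for r
  proof -
    have rT: "r \<in> {0..T}" using r assms by auto
    have "fnorm (1/2) (S (s - r) (drift (x r))) \<le> (s - r) powr (-(1/2)) * norm (drift (x r))"
      by (rule S_smoothing(2)) (use r in auto)
    also have "\<dots> \<le> (s - r) powr (-(1/2)) * (C_drift * R)" by (intro mult_left_mono norm_drift rT) simp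
    finally show ?thesis using S_smoothing(1)[of "s - r" "1/2" "drift (x r)"] r by (simp add: mult_ac)
  qed
  have Ec: "continuous_on {t..s} (\<lambda>r. S (s - r) (drift (x r)))"
    using assms by (intro continuous_S_drift) auto
  have Hc: "continuous_on {t..s} H"
    unfolding H_def
    by (intro continuous_on_minus continuous_on_diff continuous_on_mult continuous_on_const
          continuous_on_powr_const continuous_on_id) auto
  have E: "E \<in> D (1/2)" "fnorm (1/2) E \<le> 2 * (C_drift * R) * \<delta> powr (1/2)"
    using frac_integral_le[OF ts Ec Hc H' Hkey] by (auto simp: E_def H_def \<delta>_def)
  have "fnorm (1/2) (A + B + E) \<le> fnorm (1/2) A + fnorm (1/2) B + fnorm (1/2) E"
    using fnorm_triangle[OF A(1) B(1)] fnorm_triangle[OF frac_dom_add(1)[OF A(1) B(1)] E(1)] by linarith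
  also have "\<dots> \<le> C_inc * R * \<delta> powr (1/2)"
    using A(2) B(2) E(2) by (simp add: C_inc_def algebra_simps)
  finally show ?thesis by (simp add: eq \<delta>_def)
qed

text \<open>By the semigroup law the initial term and the integral over the past cancel, leaving an
  integral over an interval of length \<open>s - t\<close>; hence full order in
  \<open>H\<close>.\<close>

lemma mild_increment:
  assumes t: "0 \<le> t" and ts: "t \<le> s" and s: "s \<le> T"
  shows "norm ((x s - z s) - S (s - t) (x t - z t)) \<le> (s - t) * (C_drift * R)"
proof -
  have tT: "t \<in> {0..T}" and sT: "s \<in> {0..T}" using assms by auto
  define E where "E = integral {t..s} (\<lambda>r. S (s - r) (drift (x r)))"
  have "integral {0..s} (\<lambda>r. S (s - r) (drift (x r)))
      = integral {0..t} (\<lambda>r. S (s - r) (drift (x r))) + E"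
    unfolding E_def
    by (rule Henstock_Kurzweil_Integration.integral_combine[symmetric, OF t ts integrable_continuous_interval[OF continuous_S_drift]])
       (use assms in auto)
  moreover have "S (s - t) (integral {0..t} (\<lambda>r. S (t - r) (drift (x r)))) = integral {0..t} (\<lambda>r. S (s - r) (drift (x r)))"
  proof -
    have "integral {0..t} (S (s - t) \<circ> (\<lambda>r. S (t - r) (drift (x r)))) = S (s - t) (integral {0..t} (\<lambda>r. S (t - r) (drift (x r))))"
      using assms by (intro integral_linear integrable_continuous_interval continuous_S_drift bounded_linear_S) auto
    moreover have "integral {0..t} (S (s - t) \<circ> (\<lambda>r. S (t - r) (drift (x r)))) = integral {0..t} (\<lambda>r. S (s - r) (drift (x r)))"
      using ts by (intro Henstock_Kurzweil_Integration.integral_cong) (auto simp: S_S)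
    ultimately show ?thesis by simp
  qed
  ultimately have eq: "(x s - z s) - S (s - t) (x t - z t) = E"
    using mild[OF tT] mild[OF sT] t ts by (simp add: S_add S_S)
  have "norm E \<le> C_drift * R * (s - t)"
    unfolding E_def
  proof (rule integral_bound[OF ts])
    show "continuous_on {t..s} (\<lambda>r. S (s - r) (drift (x r)))"
      using assms by (intro continuous_S_drift) auto
    fix r assume r: "r \<in> {t..s}"
    then have "norm (S (s - r) (drift (x r))) \<le> norm (drift (x r))" by (intro norm_S_le) auto
    also have "\<dots> \<le> C_drift * R" using r assms by (intro norm_drift) auto
    finally show "norm (S (s - r) (drift (x r))) \<le> C_drift * R" .
  qed
  then show ?thesis by (simp add: eq mult.commute)
qed

text \<open>The increment of \<open>x\<close> splits into the semigroup defect \<open>w\<close>, the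
  drift part \<open>I\<close> and the noise part \<open>N\<close>. The first costs
  \<open>\<tau> powr (-1/2)\<close>, the second has full order. The linear term in \<open>N\<close>
  stays inside the norm, since its smallness shows only in the mean.\<close>

lemma drift_increment:
  assumes t: "0 \<le> t" and ts: "t \<le> s" and s: "s \<le> T" and \<tau>: "0 < \<tau>"
  shows "norm (S \<tau> (drift (x s) - drift (x t)) - S \<tau> (ddrift (x t) (z s - S (s - t) (z t))))
    \<le> c * (s - t) * \<tau> powr (-1/2) * (1 + C_half)\<^sup>2 * R\<^sup>2 + c * (s - t) * C_drift * R
       + C_rem * ((s - t) * R\<^sup>2 + (norm (iv (z s - z t)))\<^sup>2)"
proof -
  define \<delta> where "\<delta> = s - t"
  have \<delta>: "0 \<le> \<delta>" using ts by (simp add: \<delta>_def)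
  have tT: "t \<in> {0..T}" and sT: "s \<in> {0..T}" using assms by auto
  note d = x_half[OF tT] x_half[OF sT] z_half[OF tT] z_half[OF sT]
  define I where "I = (x s - z s) - S \<delta> (x t - z t)"
  define N where "N = z s - S \<delta> (z t)"
  define w where "w = S \<delta> (x t) - x t"
  have w: "w \<in> D (1/2)" unfolding w_def using d \<delta> by (intro frac_dom_diff frac_dom_S)
  have I: "I \<in> D (1/2)" unfolding I_def using d \<delta> by (intro frac_dom_diff frac_dom_S)
  have N: "N \<in> D (1/2)" unfolding N_def using d \<delta> by (intro frac_dom_diff frac_dom_S)
  have split: "x s - x t = w + I + N"
    using \<delta> by (simp add: w_def I_def N_def S_diff)
  define rem where "rem = drift (x s) - drift (x t) - ddrift (x t) (x s - x t)"
  have "rem = j (F (iv (x s)) - F (iv (x t)) - F' (iv (x t)) (iv (x s) - iv (x t)))"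
    by (simp add: rem_def drift_def ddrift_def iv_diff[OF d(2,1)] j.diff)
  then have "norm rem \<le> onorm j * norm (F (iv (x s)) - F (iv (x t)) - F' (iv (x t)) (iv (x s) - iv (x t)))"
    using onorm[OF bounded_linear_j] by simp
  also have "\<dots> \<le> onorm j * (c * (norm (iv (x s) - iv (x t)))\<^sup>2)"
    by (intro mult_left_mono F_taylor onorm_pos_le bounded_linear_j)
  \<comment> \<open>The noise increment is kept explicit, as its Hoelder bound in \<open>V\<close>
    holds for moments only.\<close>
  also have "(norm (iv (x s) - iv (x t)))\<^sup>2 \<le> (2 * (K * C_inc)\<^sup>2 + 2) * (\<delta> * R\<^sup>2 + (norm (iv (z s - z t)))\<^sup>2)"
  proof -
    let ?u = "(x s - z s) - (x t - z t)"
    have u: "?u \<in> D (1/2)" using d by (intro frac_dom_diff)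
    have "x s - x t = ?u + (z s - z t)" by simp
    then have "iv (x s) - iv (x t) = iv ?u + iv (z s - z t)"
      using iv_add[OF u frac_dom_diff(1)[OF d(4,3)]] iv_diff[OF d(2,1)] by simp
    then have "norm (iv (x s) - iv (x t)) \<le> norm (iv ?u) + norm (iv (z s - z t))"
      by (simp add: norm_triangle_ineq)
    also have "norm (iv ?u) \<le> K * fnorm (1/2) ?u" by (rule norm_iv_le[OF u])
    also have "\<dots> \<le> K * (C_inc * R * \<delta> powr (1/2))"
      using increment_half[OF t ts s] by (intro mult_left_mono K) (simp add: \<delta>_def)
    finally have "(norm (iv (x s) - iv (x t)))\<^sup>2 \<le> (K * C_inc * R * \<delta> powr (1/2) + norm (iv (z s - z t)))\<^sup>2"
      by (intro power_mono) (simp_all add: mult_ac)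
    also have "\<dots> \<le> 2 * (K * C_inc * R * \<delta> powr (1/2))\<^sup>2 + 2 * (norm (iv (z s - z t)))\<^sup>2"
      by (rule power2_sum_le)
    also have "(K * C_inc * R * \<delta> powr (1/2))\<^sup>2 = (K * C_inc)\<^sup>2 * (\<delta> * R\<^sup>2)"
      using \<delta> by (simp add: power_mult_distrib powr_sq)
    also have "2 * ((K * C_inc)\<^sup>2 * (\<delta> * R\<^sup>2)) + 2 * (norm (iv (z s - z t)))\<^sup>2
      \<le> (2 * (K * C_inc)\<^sup>2 + 2) * (\<delta> * R\<^sup>2 + (norm (iv (z s - z t)))\<^sup>2)"
      using \<delta> by (simp add: algebra_simps)
    finally show ?thesis .
  qed
  finally have rem: "norm rem \<le> C_rem * (\<delta> * R\<^sup>2 + (norm (iv (z s - z t)))\<^sup>2)"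
    using c onorm_pos_le[OF bounded_linear_j] by (simp add: C_rem_def mult_left_mono mult.assoc)
  have "S \<tau> (drift (x s) - drift (x t)) - S \<tau> (ddrift (x t) N) = S \<tau> (ddrift (x t) w) + S \<tau> (ddrift (x t) I) + S \<tau> rem"
  proof -
    have "drift (x s) - drift (x t) = ddrift (x t) w + ddrift (x t) I + ddrift (x t) N + rem"
      unfolding rem_def split
      by (simp add: ddrift_add[OF frac_dom_add(1)[OF w I] N] ddrift_add[OF w I])
    then show ?thesis using \<tau> by (simp add: S_add)
  qed
  then have "norm (S \<tau> (drift (x s) - drift (x t)) - S \<tau> (ddrift (x t) N))
      \<le> norm (S \<tau> (ddrift (x t) w)) + norm (S \<tau> (ddrift (x t) I)) + norm (S \<tau> rem)"
    by (simp only:) (intro norm_triangle_le add_mono norm_triangle_ineq order_refl)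
  moreover have "norm (S \<tau> (ddrift (x t) w)) \<le> c * \<delta> * \<tau> powr (-1/2) * ((1 + C_half)\<^sup>2 * R\<^sup>2)"
  proof -
    have "1 + fnorm (1/2) (x t) \<le> (1 + C_half) * R"
      using fnorm_half_x[OF tT] R by (simp add: algebra_simps)
    then have "(1 + fnorm (1/2) (x t))\<^sup>2 \<le> (1 + C_half)\<^sup>2 * R\<^sup>2"
      unfolding power_mult_distrib[symmetric] by (intro power_mono) auto
    then have "c * \<delta> * \<tau> powr (-1/2) * (1 + fnorm (1/2) (x t))\<^sup>2 \<le> c * \<delta> * \<tau> powr (-1/2) * ((1 + C_half)\<^sup>2 * R\<^sup>2)"
      using c \<delta> by (intro mult_left_mono) auto
    then show ?thesis using S_ddrift_increment[OF \<tau> \<delta> d(1)] by (simp add: w_def)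
  qed
  moreover have "norm (S \<tau> (ddrift (x t) I)) \<le> c * (\<delta> * (C_drift * R))"
  proof -
    have "norm (S \<tau> (ddrift (x t) I)) \<le> norm (ddrift (x t) I)" using \<tau> by (intro norm_S_le) simp
    also have "\<dots> \<le> c * norm I" by (rule norm_ddrift_le[OF I])
    also have "\<dots> \<le> c * (\<delta> * (C_drift * R))"
      using mild_increment[OF t ts s] by (intro mult_left_mono c) (simp add: I_def \<delta>_def)
    finally show ?thesis .
  qed
  moreover have "norm (S \<tau> rem) \<le> norm rem" using \<tau> by (intro norm_S_le) simp
  ultimately show ?thesis using rem unfolding N_def \<delta>_def by (simp add: mult.assoc)
qed

text \<open>\<open>r\<close> is a relative position, the same in every cell. Averaging over
  \<open>r\<close> restores the integral, while for fixed \<open>r\<close> only finitely many times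
  are involved.\<close>

definition local_error :: "real \<Rightarrow> nat \<Rightarrow> real \<Rightarrow> 'h" where
  "local_error h m r = (\<Sum>k<m. h *\<^sub>R S (real m * h - real k * h)
     (drift (x (real k * h + r * h)) - drift (x (real k * h))))"

definition noise_error :: "real \<Rightarrow> nat \<Rightarrow> real \<Rightarrow> 'h" where
  "noise_error h m r = (\<Sum>k<m. h *\<^sub>R S (real m * h - real k * h)
     (ddrift (x (real k * h)) (z (real k * h + r * h) - S (r * h) (z (real k * h)))))"

lemma norm_local_error:
  assumes h: "0 < h" and m: "real m * h \<le> T" and r: "0 < r" "r \<le> 1"
  shows "norm (local_error h m r) \<le> norm (noise_error h m r) + C_loc * R\<^sup>2 * h
    + C_rem * (\<Sum>k<m. h * (norm (iv (z (real k * h + r * h) - z (real k * h))))\<^sup>2)"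
proof -
  let ?Z = "\<lambda>k. (norm (iv (z (real k * h + r * h) - z (real k * h))))\<^sup>2"
  let ?\<tau> = "\<lambda>k. real m * h - real k * h"
  have RR: "R \<le> R\<^sup>2" using R by (simp add: power2_eq_square)
  have "norm (local_error h m r - noise_error h m r) \<le> (\<Sum>k<m. h * (c * h * ?\<tau> k powr (-1/2) * (1 + C_half)\<^sup>2 * R\<^sup>2 + c * h * C_drift * R\<^sup>2
       + C_rem * (h * R\<^sup>2 + ?Z k)))"
    unfolding local_error_def noise_error_def sum_subtractf[symmetric] scaleR_diff_right[symmetric]
  proof (rule sum_norm_le)
    fix k assume "k \<in> {..<m}"
    then have k: "k < m" by simp
    note g = grid[OF h m k r]
    have rh: "0 \<le> r * h" "r * h \<le> h" using r h by (auto simp: mult_left_le_one_le)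
    have "norm (S (?\<tau> k) (drift (x (real k * h + r * h)) - drift (x (real k * h)))
        - S (?\<tau> k) (ddrift (x (real k * h)) (z (real k * h + r * h) - S (r * h) (z (real k * h)))))
      \<le> c * (r * h) * ?\<tau> k powr (-1/2) * (1 + C_half)\<^sup>2 * R\<^sup>2 + c * (r * h) * C_drift * R
       + C_rem * ((r * h) * R\<^sup>2 + ?Z k)"
      using drift_increment[OF g(1) less_imp_le[OF g(2)] g(3,4)] by simp
    also have "\<dots> \<le> c * h * ?\<tau> k powr (-1/2) * (1 + C_half)\<^sup>2 * R\<^sup>2 + c * h * C_drift * R\<^sup>2
       + C_rem * (h * R\<^sup>2 + ?Z k)"
      using rh RR R c C_drift_nonneg C_rem_nonneg h
      by (intro add_mono mult_mono mult_right_mono mult_left_mono order_refl add_right_mono) auto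
    finally show "norm (h *\<^sub>R (S (?\<tau> k) (drift (x (real k * h + r * h)) - drift (x (real k * h)))
        - S (?\<tau> k) (ddrift (x (real k * h)) (z (real k * h + r * h) - S (r * h) (z (real k * h))))))
      \<le> h * (c * h * ?\<tau> k powr (-1/2) * (1 + C_half)\<^sup>2 * R\<^sup>2 + c * h * C_drift * R\<^sup>2
       + C_rem * (h * R\<^sup>2 + ?Z k))"
      using h by simp
  qed
  also have "\<dots> = (c * h * (1 + C_half)\<^sup>2 * R\<^sup>2) * (\<Sum>k<m. h * ?\<tau> k powr (-1/2))
      + (real m * h) * (c * h * C_drift * R\<^sup>2) + (real m * h) * (C_rem * h * R\<^sup>2) + C_rem * (\<Sum>k<m. h * ?Z k)"
    by (simp add: sum.distrib sum_distrib_left algebra_simps)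
  also have "\<dots> \<le> (c * h * (1 + C_half)\<^sup>2 * R\<^sup>2) * (2 * sqrt T)
      + T * (c * h * C_drift * R\<^sup>2) + T * (C_rem * h * R\<^sup>2) + C_rem * (\<Sum>k<m. h * ?Z k)"
  proof (intro add_mono mult_left_mono mult_right_mono order_refl)
    have "(\<Sum>k<m. h * ?\<tau> k powr (-1/2)) \<le> 2 * sqrt (real m * h)" by (rule sum_inverse_sqrt_le[OF h])
    also have "\<dots> \<le> 2 * sqrt T" using m by simp
    finally show "(\<Sum>k<m. h * ?\<tau> k powr (-1/2)) \<le> 2 * sqrt T" .
  qed (use m c h C_drift_nonneg C_rem_nonneg in auto)
  also have "\<dots> = C_loc * R\<^sup>2 * h + C_rem * (\<Sum>k<m. h * ?Z k)"
    by (simp add: C_loc_def algebra_simps)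
  finally show ?thesis
    using norm_triangle_sub[of "local_error h m r" "noise_error h m r"] by linarith
qed

text \<open>The bound \<open>h / (t - s)\<close> on the change of the semigroup, summed over the
  cells, is a harmonic sum; that is the logarithm.\<close>

lemma quadrature_error:
  assumes h: "0 < h" and m: "real m * h \<le> T"
  shows "norm (\<Sum>k<m. integral {real k * h..real (Suc k) * h}
      (\<lambda>s. S (real m * h - s) (drift (x s)) - S (real m * h - real k * h) (drift (x s))))
    \<le> 3 * C_drift * R * h * (1 + ln (real m))"
proof (cases m)
  case 0 then show ?thesis using C_drift_nonneg R h by simp
next
  case (Suc p)
  define g where "g k s = S (real m * h - s) (drift (x s)) - S (real m * h - real k * h) (drift (x s))" for k s
  \<comment> \<open>With \<open>m = Suc p\<close>, times in cell \<open>k\<close> are at distance at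
    least \<open>(p - k) * h\<close> from the final time. In the last cell, \<open>k = p\<close>,
    this is 0, and contractivity of both semigroups gives 2.\<close>
  define B where "B k = (if k < p then 1 / real (p - k) else 2)" for k
  have bnd: "norm (integral {real k * h..real (Suc k) * h} (g k)) \<le> h * B k * (C_drift * R)"
    if k: "k < m" for k
  proof -
    have "real (Suc k) * h \<le> real m * h" using k h by (intro mult_right_mono) auto
    then have kk: "0 \<le> real k * h" "real (Suc k) * h \<le> T" "real k * h \<le> real (Suc k) * h" "real (Suc k) * h \<le> real m * h"
      using m h by (auto simp: algebra_simps)
    have "norm (integral {real k * h..real (Suc k) * h} (g k)) \<le> B k * (C_drift * R) * (real (Suc k) * h - real k * h)"
    proof (rule integral_bound[OF kk(3)])
      have "continuous_on {real k * h..real (Suc k) * h} (\<lambda>s. S (real m * h - s) (drift (x s)))"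
        by (rule continuous_S_drift) (use kk in auto)
      moreover have "continuous_on {real k * h..real (Suc k) * h} (\<lambda>s. S (real m * h - real k * h) (drift (x s)))"
        by (rule continuous_on_S_compose)
           (use kk in \<open>auto intro!: continuous_intros continuous_on_subset[OF continuous_drift]\<close>)
      ultimately show "continuous_on {real k * h..real (Suc k) * h} (g k)"
        unfolding g_def by (intro continuous_on_diff)
      fix s assume s: "s \<in> {real k * h..real (Suc k) * h}"
      then have sT: "s \<in> {0..T}" using kk by auto
      have "norm (g k s) \<le> B k * norm (drift (x s))"
      proof (cases "k < p")
        case False
        have "norm (g k s) \<le> norm (S (real m * h - s) (drift (x s))) + norm (S (real m * h - real k * h) (drift (x s)))"
          unfolding g_def by (rule norm_triangle_ineq4)
        also have "\<dots> \<le> norm (drift (x s)) + norm (drift (x s))"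
          using s kk by (intro add_mono norm_S_le) auto
        finally show ?thesis using False by (simp add: B_def)
      next
        case True
        define t where "t = real m * h - s"
        define d where "d = s - real k * h"
        have d: "0 \<le> d" "d \<le> h" using s by (auto simp: d_def algebra_simps)
        have "real (p - k) * h = real m * h - real (Suc k) * h"
          using True Suc by (simp add: of_nat_diff algebra_simps)
        then have t: "real (p - k) * h \<le> t" using s by (simp add: t_def)
        have pk: "0 < real (p - k) * h" using True h by simp
        have t0: "0 < t" using t pk by linarith
        have "norm (S (t + d) (drift (x s)) - S t (drift (x s))) \<le> d / t * norm (drift (x s))"
          by (rule norm_S_diff_le[OF t0 d(1)])
        also have "\<dots> \<le> h / (real (p - k) * h) * norm (drift (x s))"
          by (rule mult_right_mono[OF frac_le[OF less_imp_le[OF h] d(2) pk t] norm_ge_zero])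
        also have "h / (real (p - k) * h) = B k" using True h by (simp add: B_def)
        finally show ?thesis by (simp add: g_def t_def d_def norm_minus_commute)
      qed
      also have "\<dots> \<le> B k * (C_drift * R)"
        by (intro mult_left_mono norm_drift sT) (simp add: B_def)
      finally show "norm (g k s) \<le> B k * (C_drift * R)" .
    qed
    also have "real (Suc k) * h - real k * h = h" by (simp add: algebra_simps)
    finally show ?thesis by (simp add: mult_ac)
  qed
  have "norm (\<Sum>k<m. integral {real k * h..real (Suc k) * h} (g k)) \<le> (\<Sum>k<m. h * B k * (C_drift * R))"
    by (rule sum_norm_le) (rule bnd, simp)
  also have "\<dots> = h * (C_drift * R) * (\<Sum>k<m. B k)"
    by (subst sum_distrib_left) (simp only: mult_ac)
  also have "(\<Sum>k<m. B k) = (\<Sum>k<p. 1 / real (p - k)) + 2"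
    by (simp add: Suc B_def)
  also have "(\<Sum>k<p. 1 / real (p - k)) = (\<Sum>k<p. 1 / real (Suc (p - Suc k)))"
    by (intro sum.cong refl) (simp add: Suc_diff_Suc)
  also have "\<dots> = (\<Sum>i<p. 1 / real (Suc i))"
    by (rule sum.nat_diff_reindex)
  also have "h * (C_drift * R) * ((\<Sum>i<p. 1 / real (Suc i)) + 2) \<le> h * (C_drift * R) * (3 * (1 + ln (real m)))"
  proof (rule mult_left_mono)
    define L where "L = ln (real m)"
    define \<sigma> where "\<sigma> = (\<Sum>i<p. 1 / real (Suc i))"
    have pL: "ln (real p) \<le> L" unfolding L_def using Suc by (cases "p = 0") auto
    have L0: "0 \<le> L" unfolding L_def using Suc by simp
    have "\<sigma> \<le> 1 + ln (real p)" unfolding \<sigma>_def by (rule sum_inverse_le_ln)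
    also have "\<dots> \<le> 1 + L" using pL by simp
    finally have "\<sigma> + 2 \<le> (1 + L) + 2" by simp
    also have "\<dots> \<le> 3 * (1 + L)" using L0 by (simp add: algebra_simps)
    finally have "\<sigma> + 2 \<le> 3 * (1 + L)" .
    then show "(\<Sum>i<p. 1 / real (Suc i)) + 2 \<le> 3 * (1 + ln (real m))" by (simp only: \<sigma>_def L_def)
  qed (use h C_drift_R in simp)
  finally show ?thesis unfolding g_def by (simp only: mult_ac)
qed

text \<open>The averaged local errors converge to the second summand of the global error, so that
  moments of the latter are controlled by moments at fixed times only.\<close>

lemma error_decomposition:
  fixes d :: "nat \<Rightarrow> 'h"
  assumes h: "0 < h" and m: "real m * h \<le> T"
  obtains A B where
    "integral {0..real m * h} (\<lambda>s. S (real m * h - s) (drift (x s)))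
       - (\<Sum>k<m. h *\<^sub>R S (real m * h - real k * h) (d k))
     = A + B + (\<Sum>k<m. h *\<^sub>R S (real m * h - real k * h) (drift (x (real k * h)) - d k))"
    "norm A \<le> 3 * C_drift * R * h * (1 + ln (real m))"
    "(\<lambda>n. (1 / real (Suc n)) *\<^sub>R (\<Sum>i<Suc n. local_error h m (real (Suc i) / real (Suc n)))) \<longlonglongrightarrow> B"
proof
  let ?\<tau> = "\<lambda>k. real m * h - real k * h"
  let ?J = "\<lambda>k. {real k * h..real (Suc k) * h}"
  let ?B = "\<Sum>k<m. S (?\<tau> k) (integral (?J k) (\<lambda>s. drift (x s) - drift (x (real k * h))))"
  let ?A = "\<Sum>k<m. integral (?J k) (\<lambda>s. S (real m * h - s) (drift (x s)) - S (?\<tau> k) (drift (x s)))"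
  have kk: "0 \<le> real k * h \<and> real (Suc k) * h \<le> T \<and> real k * h \<le> real (Suc k) * h \<and> real (Suc k) * h \<le> real m * h" if "k < m" for k
  proof -
    have "real (Suc k) * h \<le> real m * h" using that h by (intro mult_right_mono) auto
    then show ?thesis using m h by (auto simp: algebra_simps)
  qed
  have cd: "continuous_on (?J k) (\<lambda>s. drift (x s))" if "k < m" for k
    by (rule continuous_on_subset[OF continuous_drift]) (use kk[OF that] in auto)
  have I: "integral {0..real m * h} (\<lambda>s. S (real m * h - s) (drift (x s)))
      = (\<Sum>k<m. integral (?J k) (\<lambda>s. S (real m * h - s) (drift (x s))))"
    using integral_grid[of h 0 m "\<lambda>s. S (real m * h - s) (drift (x s))"] h m
    by (simp add: continuous_S_drift)
  have "(\<Sum>k<m. integral (?J k) (\<lambda>s. S (real m * h - s) (drift (x s))) - h *\<^sub>R S (?\<tau> k) (d k)) = (\<Sum>k<m. integral (?J k) (\<lambda>s. S (real m * h - s) (drift (x s)) - S (?\<tau> k) (drift (x s)))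
      + S (?\<tau> k) (integral (?J k) (\<lambda>s. drift (x s) - drift (x (real k * h))))
      + h *\<^sub>R S (?\<tau> k) (drift (x (real k * h)) - d k))"
  proof (rule sum.cong[OF refl])
    fix k assume "k \<in> {..<m}"
    then have k: "k < m" by simp
    note K = kk[OF k]
    have \<tau>: "0 \<le> ?\<tau> k" using K by linarith
    have c1: "continuous_on (?J k) (\<lambda>s. S (real m * h - s) (drift (x s)))"
      by (rule continuous_S_drift) (use K in auto)
    have c2: "continuous_on (?J k) (\<lambda>s. S (?\<tau> k) (drift (x s)))"
      by (rule bounded_linear.continuous_on[OF bounded_linear_S[OF \<tau>] cd[OF k]])
    have i2: "integral (?J k) (\<lambda>s. S (?\<tau> k) (drift (x s))) = S (?\<tau> k) (integral (?J k) (\<lambda>s. drift (x s)))"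
      using integral_linear[OF integrable_continuous_interval[OF cd[OF k]] bounded_linear_S[OF \<tau>]]
      by (simp add: o_def)
    have len: "real (Suc k) * h - real k * h = h" by (simp add: algebra_simps)
    have i3: "integral (?J k) (\<lambda>s. drift (x s) - drift (x (real k * h))) = integral (?J k) (\<lambda>s. drift (x s)) - h *\<^sub>R drift (x (real k * h))"
    proof -
      have "integral (?J k) (\<lambda>s. drift (x s) - drift (x (real k * h)))
          = integral (?J k) (\<lambda>s. drift (x s)) - integral (?J k) (\<lambda>s. drift (x (real k * h)))"
        by (intro Henstock_Kurzweil_Integration.integral_diff integrable_continuous_interval cd[OF k]
              continuous_on_const)
      moreover have "real k * h \<le> real (Suc k) * h" using K by blast
      ultimately show ?thesis by (simp only: integral_const_real content_real len)
    qed
    show "integral (?J k) (\<lambda>s. S (real m * h - s) (drift (x s))) - h *\<^sub>R S (?\<tau> k) (d k)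
      = integral (?J k) (\<lambda>s. S (real m * h - s) (drift (x s)) - S (?\<tau> k) (drift (x s)))
      + S (?\<tau> k) (integral (?J k) (\<lambda>s. drift (x s) - drift (x (real k * h))))
      + h *\<^sub>R S (?\<tau> k) (drift (x (real k * h)) - d k)"
      unfolding i3 Henstock_Kurzweil_Integration.integral_diff[OF integrable_continuous_interval[OF c1] integrable_continuous_interval[OF c2]] i2
      using \<tau> by (simp add: S_diff S_scaleR scaleR_diff_right)
  qed
  then show "integral {0..real m * h} (\<lambda>s. S (real m * h - s) (drift (x s)))
       - (\<Sum>k<m. h *\<^sub>R S (?\<tau> k) (d k))
     = ?A + ?B + (\<Sum>k<m. h *\<^sub>R S (?\<tau> k) (drift (x (real k * h)) - d k))"
    by (simp only: I sum.distrib sum_subtractf)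
  show "norm ?A \<le> 3 * C_drift * R * h * (1 + ln (real m))"
    by (rule quadrature_error[OF h m])
  have "(\<lambda>n. \<Sum>k<m. S (?\<tau> k) ((h / real (Suc n)) *\<^sub>R (\<Sum>i<Suc n. drift (x (real k * h + real (Suc i) / real (Suc n) * h)) - drift (x (real k * h)))))
      \<longlonglongrightarrow> ?B"
  proof (intro tendsto_sum)
    fix k assume "k \<in> {..<m}"
    then have k: "k < m" by simp
    note K = kk[OF k]
    have \<tau>: "0 \<le> ?\<tau> k" using K by linarith
    have J: "real (Suc k) * h = real k * h + h" by (simp add: algebra_simps)
    have cd': "continuous_on {real k * h..real k * h + h} (\<lambda>s. drift (x s) - drift (x (real k * h)))"
      using cd[OF k] unfolding J by (intro continuous_intros)
    show "(\<lambda>n. S (?\<tau> k) ((h / real (Suc n)) *\<^sub>R (\<Sum>i<Suc n. drift (x (real k * h + real (Suc i) / real (Suc n) * h)) - drift (x (real k * h)))))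
      \<longlonglongrightarrow> S (?\<tau> k) (integral (?J k) (\<lambda>s. drift (x s) - drift (x (real k * h))))"
      unfolding J
      by (rule bounded_linear.tendsto[OF bounded_linear_S[OF \<tau>] riemann_sum_tendsto[OF h cd']])
  qed
  \<comment> \<open>Exchanging the sums collects the \<open>i\<close>-th nodes of all cells into one
    \<open>local_error\<close>.\<close>
  moreover have "(\<Sum>k<m. S (?\<tau> k) ((h / real (Suc n)) *\<^sub>R (\<Sum>i<Suc n. drift (x (real k * h + real (Suc i) / real (Suc n) * h)) - drift (x (real k * h)))))
     = (1 / real (Suc n)) *\<^sub>R (\<Sum>i<Suc n. local_error h m (real (Suc i) / real (Suc n)))" for n
  proof -
    have "S (?\<tau> k) ((h / real (Suc n)) *\<^sub>R (\<Sum>i<Suc n. drift (x (real k * h + real (Suc i) / real (Suc n) * h)) - drift (x (real k * h))))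
       = (\<Sum>i<Suc n. (1 / real (Suc n)) *\<^sub>R h *\<^sub>R S (?\<tau> k) (drift (x (real k * h + real (Suc i) / real (Suc n) * h)) - drift (x (real k * h))))"
      if "k < m" for k
    proof -
      have \<tau>: "0 \<le> ?\<tau> k" using kk[OF that] by linarith
      show ?thesis by (simp only: S_scaleR[OF \<tau>] S_sum[OF \<tau>] scaleR_sum_right scaleR_scaleR) simp
    qed
    then have "(\<Sum>k<m. S (?\<tau> k) ((h / real (Suc n)) *\<^sub>R (\<Sum>i<Suc n. drift (x (real k * h + real (Suc i) / real (Suc n) * h)) - drift (x (real k * h)))))
       = (\<Sum>k<m. \<Sum>i<Suc n. (1 / real (Suc n)) *\<^sub>R h *\<^sub>R S (?\<tau> k) (drift (x (real k * h + real (Suc i) / real (Suc n) * h)) - drift (x (real k * h))))"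
      by (intro sum.cong refl) simp
    also have "\<dots> = (1 / real (Suc n)) *\<^sub>R (\<Sum>i<Suc n. local_error h m (real (Suc i) / real (Suc n)))"
      by (subst sum.swap) (simp only: local_error_def scaleR_sum_right)
    finally show ?thesis .
  qed
  ultimately show "(\<lambda>n. (1 / real (Suc n)) *\<^sub>R (\<Sum>i<Suc n. local_error h m (real (Suc i) / real (Suc n)))) \<longlonglongrightarrow> ?B"
    by simp
qed

end

section \<open>Moment estimates\<close>

context spectral_basis
begin

lemma measurable_fnorm:
  assumes W: "W \<in> borel_measurable M" and D: "\<And>\<omega>. \<omega> \<in> space M \<Longrightarrow> W \<omega> \<in> D r"
  shows "(\<lambda>\<omega>. fnorm r (W \<omega>)) \<in> borel_measurable M"
proof (rule borel_measurable_LIMSEQ_real)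
  have eq: "fpow r (proj e N v) = (\<Sum>n<N. (lm n powr r * (bv n \<bullet> v)) *\<^sub>R bv n)" for N v
    by (rule coord_eqI) (simp add: coord_fpow proj_in_frac_dom coord_proj inner_sum_bv)
  show "(\<lambda>\<omega>. fnorm r (proj e N (W \<omega>))) \<in> borel_measurable M" for N
    unfolding frac_norm_def eq using W by measurable
  fix \<omega> assume "\<omega> \<in> space M"
  then have d: "W \<omega> \<in> D r" by (rule D)
  show "(\<lambda>N. fnorm r (proj e N (W \<omega>))) \<longlonglongrightarrow> fnorm r (W \<omega>)"
  proof (rule tendsto_norm_bound[where C = 1, OF fnorm_proj_tail_tendsto[OF d]])
    show "norm (fnorm r (proj e N (W \<omega>)) - fnorm r (W \<omega>)) \<le> 1 * norm (fnorm r (proj e N (W \<omega>) - W \<omega>))" for N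
      using norm_triangle_ineq3[of "fpow r (proj e N (W \<omega>))" "fpow r (W \<omega>)"]
      by (simp add: frac_norm_def frac_dom_diff(2)[OF proj_in_frac_dom d])
  qed
qed

lemma measurable_S [measurable]: "0 \<le> t \<Longrightarrow> S t \<in> borel_measurable borel"
  by (intro borel_measurable_continuous_onI bounded_linear.continuous_on[OF bounded_linear_S] continuous_on_id)

lemma measurable_proj [measurable]: "proj e N \<in> borel_measurable borel"
  by (intro borel_measurable_continuous_onI bounded_linear.continuous_on[OF bounded_linear_proj] continuous_on_id)

end

context prob_space
begin

lemma integrable_expectation_leI:
  assumes "f \<in> borel_measurable M" "\<And>\<omega>. \<omega> \<in> space M \<Longrightarrow> 0 \<le> f \<omega>"
    and le: "(\<integral>\<^sup>+\<omega>. ennreal (f \<omega>) \<partial>M) \<le> ennreal B" and B: "0 \<le> B"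
  shows "integrable M f" "expectation f \<le> B"
proof -
  show "integrable M f"
    using assms(1,2) le_less_trans[OF le] by (intro integrableI_nonneg) auto
  have "expectation f = enn2real (\<integral>\<^sup>+\<omega>. ennreal (f \<omega>) \<partial>M)"
    using assms(1,2) by (intro integral_eq_nn_integral) auto
  also have "\<dots> \<le> enn2real (ennreal B)" by (rule enn2real_mono[OF le]) simp
  finally show "expectation f \<le> B" using B by simp
qed

lemma integrable_expectation_le_mono:
  fixes f g :: "'a \<Rightarrow> real"
  assumes g: "integrable M g" and f: "f \<in> borel_measurable M"
    and le: "\<And>\<omega>. \<omega> \<in> space M \<Longrightarrow> 0 \<le> f \<omega> \<and> f \<omega> \<le> g \<omega>"
  shows "integrable M f" "expectation f \<le> expectation g"
proof -
  show i: "integrable M f"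
    by (rule Bochner_Integration.integrable_bound[OF g f]) (use le in \<open>auto intro!: AE_I2 order_trans[OF _ abs_ge_self]\<close>)
  show "expectation f \<le> expectation g"
    by (rule integral_mono[OF i g]) (use le in auto)
qed

end

lemma norm_add_scaleR_sq: "(norm (a + h *\<^sub>R w))\<^sup>2 = (norm a)\<^sup>2 + 2 * h * (a \<bullet> w) + h\<^sup>2 * (norm w)\<^sup>2"
  for a w :: "'b::real_inner"
  by (simp add: power2_norm_eq_inner inner_add_left inner_add_right inner_commute[of w a])
     (simp add: power2_eq_square algebra_simps)

lemma power2_sum3_le: "(a + b + d)\<^sup>2 \<le> 3 * a\<^sup>2 + 3 * b\<^sup>2 + 3 * d\<^sup>2" for a b d :: real
  using sum_squares_bound[of a b] sum_squares_bound[of a d] sum_squares_bound[of b d]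
  by (simp add: power2_eq_square algebra_simps)

text \<open>Independence is stated for single coordinates against real random variables, the form in
  which \<open>W_coord\<close> uses it. \<open>CZ\<close> bounds the normalized fourth moments of
  the noise increments in \<open>V\<close>.\<close>

locale mild_noise = mild_setting lam e j F F' F'' c K T \<gamma> + prob_space P
  for lam :: "nat \<Rightarrow> real" and e :: "nat \<Rightarrow> 'h::{real_inner, banach, second_countable_topology}"
    and j :: "'v::{banach, second_countable_topology} \<Rightarrow> 'h" and F F' F'' c K T \<gamma>
    and P :: "'w measure" +
  fixes Filt :: "real \<Rightarrow> 'w measure" and \<theta> CZ :: real
    and Z X :: "real \<Rightarrow> 'w \<Rightarrow> 'h" and \<xi> :: "'w \<Rightarrow> 'h" and R :: "'w \<Rightarrow> real"
  assumes \<theta>: "0 < \<theta>" "\<theta> \<le> 1/2" and CZ: "0 \<le> CZ"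
    and subalg: "\<And>t. t \<in> {0..T} \<Longrightarrow> subalgebra P (Filt t)"
    and Filt_mono: "\<And>s t. 0 \<le> s \<Longrightarrow> s \<le> t \<Longrightarrow> t \<le> T \<Longrightarrow> sets (Filt s) \<subseteq> sets (Filt t)"
    and X_meas: "\<And>t. t \<in> {0..T} \<Longrightarrow> X t \<in> borel_measurable (Filt t)"
    and Z_meas: "\<And>t. t \<in> {0..T} \<Longrightarrow> Z t \<in> borel_measurable (Filt t)"
    and R_meas: "R \<in> borel_measurable P" and R_int: "integrable P (\<lambda>\<omega>. R \<omega> ^ 4)"
    and path: "\<And>\<omega>. \<omega> \<in> space P \<Longrightarrow>
      mild_path lam e j F F' F'' c K T \<gamma> (R \<omega>) (\<xi> \<omega>) (\<lambda>t. Z t \<omega>) (\<lambda>t. X t \<omega>)"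
    and Z_inc: "\<And>s t. 0 \<le> s \<Longrightarrow> s < t \<Longrightarrow> t \<le> T \<Longrightarrow>
      (\<integral>\<^sup>+\<omega>. ennreal (norm (inv j (Z t \<omega> - Z s \<omega>)) ^ 4) \<partial>P) \<le> ennreal (CZ * (t - s) powr (4 * \<theta>))"
    and Z_mean: "\<And>t. t \<in> {0..T} \<Longrightarrow> integrable P (Z t)" "\<And>t. t \<in> {0..T} \<Longrightarrow> integral\<^sup>L P (Z t) = 0"
    and Z_indep: "\<And>s t n (\<psi> :: 'w \<Rightarrow> real). 0 \<le> s \<Longrightarrow> s < t \<Longrightarrow> t \<le> T \<Longrightarrow>
      \<psi> \<in> borel_measurable (Filt s) \<Longrightarrow>
      prob_space.indep_var P borel \<psi> borel (\<lambda>\<omega>. e (Suc n) \<bullet> (Z t \<omega> - semigrp lam e (t - s) (Z s \<omega>)))"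
begin

definition "M4 = expectation (\<lambda>\<omega>. R \<omega> ^ 4)"
text \<open>As \<open>2 * \<theta> \<le> 1\<close>, this factor trades a full power of a step
  \<open>h \<le> T\<close> for \<open>h powr (2 * \<theta>)\<close>.\<close>

definition "T1 = T powr (1 - 2 * \<theta>)"
definition "C_W = 2 * (onorm j)\<^sup>2 * (1 + CZ) + 2 * (lam 1 powr (1/2 - \<gamma>))\<^sup>2 * T1 * M4"
definition "C_noise = T * c\<^sup>2 * C_W * T1"
text \<open>Second moment of a local error: linear noise term, smooth part and Taylor remainder,
  each with the factor 3 for the square of a sum of three.\<close>

definition "C_L = 3 * C_noise + 3 * C_loc\<^sup>2 * T1\<^sup>2 * M4 + 3 * C_rem\<^sup>2 * T\<^sup>2 * CZ"

section \<open>Measurability and moments of the noise increments\<close>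

lemma space_Filt: "t \<in> {0..T} \<Longrightarrow> space (Filt t) = space P"
  using subalg[of t] by (simp add: subalgebra_def)

lemma measurable_Filt: "t \<in> {0..T} \<Longrightarrow> f \<in> borel_measurable (Filt t) \<Longrightarrow> f \<in> borel_measurable P"
  using measurable_from_subalg[OF subalg] by blast

lemma measurable_Filt_mono:
  assumes "0 \<le> s" "s \<le> t" "t \<le> T" "f \<in> borel_measurable (Filt s)" shows "f \<in> borel_measurable (Filt t)"
proof (rule measurable_from_subalg[OF _ assms(4)])
  show "subalgebra (Filt t) (Filt s)"
    using Filt_mono[OF assms(1-3)] space_Filt[of s] space_Filt[of t] assms by (simp add: subalgebra_def)
qed

lemma X_measP: "t \<in> {0..T} \<Longrightarrow> X t \<in> borel_measurable P"
  and Z_measP: "t \<in> {0..T} \<Longrightarrow> Z t \<in> borel_measurable P"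
  using measurable_Filt X_meas Z_meas by blast+

lemma R_ge_1: "\<omega> \<in> space P \<Longrightarrow> 1 \<le> R \<omega>"
  using mild_path.R[OF path] .

lemma X_half: "\<omega> \<in> space P \<Longrightarrow> t \<in> {0..T} \<Longrightarrow> X t \<omega> \<in> D (1/2)"
  and Z_half: "\<omega> \<in> space P \<Longrightarrow> t \<in> {0..T} \<Longrightarrow> Z t \<omega> \<in> D (1/2)"
  using mild_path.x_half[OF path] mild_path.z_half[OF path] by auto

lemma M4_nonneg: "0 \<le> M4"
  unfolding M4_def using R_ge_1 by (intro Bochner_Integration.integral_nonneg) auto

lemma T1_nonneg: "0 \<le> T1" by (simp add: T1_def)
lemma C_W_nonneg: "0 \<le> C_W" using CZ T1_nonneg M4_nonneg by (simp add: C_W_def)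
lemma C_noise_nonneg: "0 \<le> C_noise" using C_W_nonneg T T1_nonneg by (simp add: C_noise_def)
lemma C_L_nonneg: "0 \<le> C_L" using C_noise_nonneg M4_nonneg CZ by (simp add: C_L_def)

lemma step_le_powr:
  assumes "0 < h" "h \<le> T" shows "h \<le> T1 * h powr (2 * \<theta>)"
proof -
  have "h = h powr (1 - 2 * \<theta>) * h powr (2 * \<theta>)" using assms by (simp flip: powr_add)
  also have "\<dots> \<le> T1 * h powr (2 * \<theta>)"
    unfolding T1_def using assms \<theta> by (intro mult_right_mono powr_mono2) auto
  finally show ?thesis .
qed

text \<open>The innovation: the part of \<open>Z t\<close> that is independent of the past up to
  \<open>s\<close>.\<close>

definition W :: "real \<Rightarrow> real \<Rightarrow> 'w \<Rightarrow> 'h" where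
  "W s t \<omega> = Z t \<omega> - S (t - s) (Z s \<omega>)"

context
  fixes s t assumes s: "0 \<le> s" and st: "s < t" and t: "t \<le> T"
begin

lemma sT: "s \<in> {0..T}" and tT: "t \<in> {0..T}"
  using s st t by auto

lemma W_half: "\<omega> \<in> space P \<Longrightarrow> W s t \<omega> \<in> D (1/2)"
  unfolding W_def using st by (intro frac_dom_diff frac_dom_S Z_half sT tT) auto

lemma W_meas: "W s t \<in> borel_measurable (Filt t)"
proof -
  have [measurable]: "Z t \<in> borel_measurable (Filt t)" "Z s \<in> borel_measurable (Filt t)"
    using Z_meas[OF tT] measurable_Filt_mono[OF s less_imp_le[OF st] t Z_meas[OF sT]] by auto
  have [measurable]: "S (t - s) \<in> borel_measurable borel" using st by (intro measurable_S) simp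
  show ?thesis unfolding W_def by measurable
qed

lemma inc_meas: "(\<lambda>\<omega>. iv (Z t \<omega> - Z s \<omega>)) \<in> borel_measurable P"
  by (rule measurable_iv[OF borel_measurable_diff[OF Z_measP[OF tT] Z_measP[OF sT]]])
     (rule frac_dom_diff(1)[OF Z_half[OF _ tT] Z_half[OF _ sT]])

lemma inc_moment:
  "integrable P (\<lambda>\<omega>. norm (iv (Z t \<omega> - Z s \<omega>)) ^ 4)"
  "expectation (\<lambda>\<omega>. norm (iv (Z t \<omega> - Z s \<omega>)) ^ 4) \<le> CZ * (t - s) powr (4 * \<theta>)"
proof -
  have m: "(\<lambda>\<omega>. norm (iv (Z t \<omega> - Z s \<omega>)) ^ 4) \<in> borel_measurable P"
    using inc_meas by measurable
  show "integrable P (\<lambda>\<omega>. norm (iv (Z t \<omega> - Z s \<omega>)) ^ 4)"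
    "expectation (\<lambda>\<omega>. norm (iv (Z t \<omega> - Z s \<omega>)) ^ 4) \<le> CZ * (t - s) powr (4 * \<theta>)"
    using integrable_expectation_leI[OF m _ Z_inc[OF s st t]] CZ by auto
qed

text \<open>Weights are chosen so that taking expectations turns fourth moments of order
  \<open>4 * \<theta>\<close> directly into a second moment of order \<open>2 * \<theta>\<close>.
  The term with \<open>R\<close> comes from the semigroup acting on \<open>Z s\<close>.\<close>

lemma norm_W_sq_le:
  assumes \<omega>: "\<omega> \<in> space P"
  shows "(norm (W s t \<omega>))\<^sup>2 \<le> 2 * (onorm j)\<^sup>2 * ((t - s) powr (2 * \<theta>)
       + (t - s) powr (- 2 * \<theta>) * norm (iv (Z t \<omega> - Z s \<omega>)) ^ 4)
     + 2 * (lam 1 powr (1/2 - \<gamma>))\<^sup>2 * (t - s) * R \<omega> ^ 4"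
proof -
  interpret p: mild_path lam e j F F' F'' c K T \<gamma> "R \<omega>" "\<xi> \<omega>" "\<lambda>t. Z t \<omega>" "\<lambda>t. X t \<omega>"
    by (rule path[OF \<omega>])
  define \<delta> where "\<delta> = t - s"
  have \<delta>: "0 < \<delta>" using st by (simp add: \<delta>_def)
  define y where "y = norm (iv (Z t \<omega> - Z s \<omega>))"
  note zs = Z_half[OF \<omega> sT] and zt = Z_half[OF \<omega> tT]
  have "norm (Z t \<omega> - Z s \<omega>) = norm (j (iv (Z t \<omega> - Z s \<omega>)))"
    using j_iv[OF frac_dom_diff(1)[OF zt zs]] by simp
  also have "\<dots> \<le> onorm j * y" unfolding y_def by (rule onorm[OF bounded_linear_j])
  finally have 1: "norm (Z t \<omega> - Z s \<omega>) \<le> onorm j * y" .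
  have "norm (S \<delta> (Z s \<omega>) - Z s \<omega>) \<le> \<delta> powr (1/2) * fnorm (1/2) (Z s \<omega>)"
    by (rule norm_S_minus_id_le[OF less_imp_le[OF \<delta>] zs])
  also have "\<dots> \<le> \<delta> powr (1/2) * (lam 1 powr (1/2 - \<gamma>) * fnorm \<gamma> (Z s \<omega>))"
    by (intro mult_left_mono frac_mono(2)[OF \<gamma>(1) p.z(1)[OF sT]]) simp
  also have "\<dots> \<le> \<delta> powr (1/2) * (lam 1 powr (1/2 - \<gamma>) * R \<omega>)"
    by (intro mult_left_mono p.z(2)[OF sT]) auto
  finally have 2: "norm (S \<delta> (Z s \<omega>) - Z s \<omega>) \<le> \<delta> powr (1/2) * (lam 1 powr (1/2 - \<gamma>) * R \<omega>)" .
  have "W s t \<omega> = (Z t \<omega> - Z s \<omega>) - (S \<delta> (Z s \<omega>) - Z s \<omega>)" by (simp add: W_def \<delta>_def)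
  then have "norm (W s t \<omega>) \<le> norm (Z t \<omega> - Z s \<omega>) + norm (S \<delta> (Z s \<omega>) - Z s \<omega>)"
    using norm_triangle_ineq4 by metis
  also have "\<dots> \<le> onorm j * y + \<delta> powr (1/2) * (lam 1 powr (1/2 - \<gamma>) * R \<omega>)"
    by (rule add_mono[OF 1 2])
  finally have "(norm (W s t \<omega>))\<^sup>2 \<le> (onorm j * y + \<delta> powr (1/2) * (lam 1 powr (1/2 - \<gamma>) * R \<omega>))\<^sup>2"
    by (intro power_mono) simp_all
  also have "\<dots> \<le> 2 * (onorm j * y)\<^sup>2 + 2 * (\<delta> powr (1/2) * (lam 1 powr (1/2 - \<gamma>) * R \<omega>))\<^sup>2"
    by (rule power2_sum_le)
  also have "\<dots> = 2 * (onorm j)\<^sup>2 * y\<^sup>2 + 2 * (lam 1 powr (1/2 - \<gamma>))\<^sup>2 * \<delta> * (R \<omega>)\<^sup>2"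
    using \<delta> powr_sq[of \<delta> "1/2"] by (simp add: power_mult_distrib mult_ac)
  also have "\<dots> \<le> 2 * (onorm j)\<^sup>2 * (\<delta> powr (2 * \<theta>) + \<delta> powr (- 2 * \<theta>) * y ^ 4)
     + 2 * (lam 1 powr (1/2 - \<gamma>))\<^sup>2 * \<delta> * R \<omega> ^ 4"
  proof (intro add_mono mult_left_mono)
    \<comment> \<open>Young's inequality for \<open>a\<close> and \<open>y\<^sup>2 / a\<close>, with
      \<open>a\<close> at the expected size of the increment \<open>y\<close>.\<close>
    define a where "a = \<delta> powr \<theta>"
    have a: "0 < a" "\<delta> powr (2 * \<theta>) = a\<^sup>2" "\<delta> powr (- 2 * \<theta>) = inverse (a\<^sup>2)"
      using \<delta> by (auto simp: a_def powr_sq mult.commute powr_minus)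
    have "2 * a * (y\<^sup>2 / a) \<le> a\<^sup>2 + (y\<^sup>2 / a)\<^sup>2" by (rule sum_squares_bound)
    also have "(y\<^sup>2 / a)\<^sup>2 = inverse (a\<^sup>2) * y ^ 4" by (simp add: divide_inverse power2_eq_square power4_eq_xxxx mult_ac)
    finally have "2 * y\<^sup>2 \<le> a\<^sup>2 + inverse (a\<^sup>2) * y ^ 4" using a(1) by simp
    moreover have "0 \<le> y\<^sup>2" by simp
    ultimately show "y\<^sup>2 \<le> \<delta> powr (2 * \<theta>) + \<delta> powr (- 2 * \<theta>) * y ^ 4"
      unfolding a by linarith
    show "(R \<omega>)\<^sup>2 \<le> R \<omega> ^ 4" using R_ge_1[OF \<omega>] by (intro power_increasing) auto
  qed (use \<delta> in auto)
  finally show ?thesis by (simp add: y_def \<delta>_def)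
qed

lemma W_moment:
  "integrable P (\<lambda>\<omega>. (norm (W s t \<omega>))\<^sup>2)"
  "expectation (\<lambda>\<omega>. (norm (W s t \<omega>))\<^sup>2) \<le> C_W * (t - s) powr (2 * \<theta>)"
proof -
  let ?\<delta> = "t - s"
  let ?g = "\<lambda>\<omega>. 2 * (onorm j)\<^sup>2 * (?\<delta> powr (2 * \<theta>) + ?\<delta> powr (- 2 * \<theta>) * norm (iv (Z t \<omega> - Z s \<omega>)) ^ 4)
     + 2 * (lam 1 powr (1/2 - \<gamma>))\<^sup>2 * ?\<delta> * R \<omega> ^ 4"
  have m: "(\<lambda>\<omega>. (norm (W s t \<omega>))\<^sup>2) \<in> borel_measurable P"
    using measurable_Filt[OF tT W_meas] by measurable
  note I = inc_moment(1) R_int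
  have g: "integrable P ?g"
    by (intro Bochner_Integration.integrable_add integrable_mult_right I integrable_const)
  have le: "0 \<le> (norm (W s t \<omega>))\<^sup>2 \<and> (norm (W s t \<omega>))\<^sup>2 \<le> ?g \<omega>" if "\<omega> \<in> space P" for \<omega>
    using norm_W_sq_le[OF that] by simp
  note r = integrable_expectation_le_mono[OF g m le]
  show "integrable P (\<lambda>\<omega>. (norm (W s t \<omega>))\<^sup>2)" by (rule r(1))
  have "expectation ?g = 2 * (onorm j)\<^sup>2 * (?\<delta> powr (2 * \<theta>) + ?\<delta> powr (- 2 * \<theta>) * expectation (\<lambda>\<omega>. norm (iv (Z t \<omega> - Z s \<omega>)) ^ 4))
     + 2 * (lam 1 powr (1/2 - \<gamma>))\<^sup>2 * ?\<delta> * M4"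
    using I by (simp add: M4_def prob_space)
  also have "\<dots> \<le> 2 * (onorm j)\<^sup>2 * (?\<delta> powr (2 * \<theta>) + ?\<delta> powr (- 2 * \<theta>) * (CZ * ?\<delta> powr (4 * \<theta>)))
     + 2 * (lam 1 powr (1/2 - \<gamma>))\<^sup>2 * (T1 * ?\<delta> powr (2 * \<theta>)) * M4"
    using inc_moment(2) step_le_powr[of ?\<delta>] s st t M4_nonneg
    by (intro add_mono mult_left_mono mult_right_mono order_refl) auto
  also have "\<dots> = C_W * ?\<delta> powr (2 * \<theta>)"
  proof -
    have "?\<delta> powr (- 2 * \<theta>) * ?\<delta> powr (4 * \<theta>) = ?\<delta> powr (2 * \<theta>)"
      by (simp flip: powr_add)
    then have "?\<delta> powr (- 2 * \<theta>) * (CZ * ?\<delta> powr (4 * \<theta>)) = CZ * ?\<delta> powr (2 * \<theta>)"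
      by (metis mult.left_commute)
    then show ?thesis unfolding C_W_def by (simp only:) (simp add: algebra_simps)
  qed
  finally show "expectation (\<lambda>\<omega>. (norm (W s t \<omega>))\<^sup>2) \<le> C_W * (t - s) powr (2 * \<theta>)"
    using r(2) by linarith
qed

text \<open>The innovation is centered because expectation commutes with the bounded semigroup;
  independence then factors the product.\<close>

lemma W_coord:
  assumes \<psi>: "\<psi> \<in> borel_measurable (Filt s)" "integrable P \<psi>"
  shows "integrable P (\<lambda>\<omega>. \<psi> \<omega> * (bv n \<bullet> W s t \<omega>))" "expectation (\<lambda>\<omega>. \<psi> \<omega> * (bv n \<bullet> W s t \<omega>)) = 0"
proof -
  have ind: "indep_var borel \<psi> borel (\<lambda>\<omega>. bv n \<bullet> W s t \<omega>)"
    using Z_indep[OF s st t \<psi>(1)] by (simp add: W_def)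
  have \<delta>: "0 \<le> t - s" using st by simp
  have iS: "integrable P (\<lambda>\<omega>. S (t - s) (Z s \<omega>))"
    by (rule integrable_bounded_linear[OF bounded_linear_S[OF \<delta>] Z_mean(1)[OF sT]])
  have iW: "integrable P (W s t)"
    unfolding W_def by (intro Bochner_Integration.integrable_diff Z_mean tT iS)
  have "integral\<^sup>L P (W s t) = integral\<^sup>L P (Z t) - S (t - s) (integral\<^sup>L P (Z s))"
    unfolding W_def
    using Bochner_Integration.integral_diff[OF Z_mean(1)[OF tT] iS]
      integral_bounded_linear[OF bounded_linear_S[OF \<delta>] Z_mean(1)[OF sT]] by simp
  also have "\<dots> = 0"
    using Z_mean(2) sT tT linear_0[OF bounded_linear.linear[OF bounded_linear_S[OF \<delta>]]] by simp
  finally have W0: "integral\<^sup>L P (W s t) = 0" .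
  have ib: "integrable P (\<lambda>\<omega>. bv n \<bullet> W s t \<omega>)" using iW by simp
  have "expectation (\<lambda>\<omega>. bv n \<bullet> W s t \<omega>) = 0" using integral_inner_right[of "bv n" P "W s t"] iW W0 by simp
  then show "expectation (\<lambda>\<omega>. \<psi> \<omega> * (bv n \<bullet> W s t \<omega>)) = 0"
    using indep_var_lebesgue_integral[OF ind \<psi>(2) ib] by simp
  show "integrable P (\<lambda>\<omega>. \<psi> \<omega> * (bv n \<bullet> W s t \<omega>))"
    by (rule indep_var_integrable[OF ind \<psi>(2) ib])
qed

lemma noise_meas:
  assumes "0 \<le> \<tau>"
  shows "(\<lambda>\<omega>. S \<tau> (ddrift (X s \<omega>) (W s t \<omega>))) \<in> borel_measurable (Filt t)"
proof -
  have "(\<lambda>\<omega>. ddrift (X s \<omega>) (W s t \<omega>)) \<in> borel_measurable (Filt t)"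
    using measurable_Filt_mono[OF s less_imp_le[OF st] t X_meas[OF sT]] X_half[OF _ sT] W_half W_meas
    by (intro measurable_ddrift) (auto simp: space_Filt[OF tT])
  from measurable_compose[OF this measurable_S[OF assms]] show ?thesis .
qed

lemma norm_noise_le:
  assumes "0 \<le> \<tau>" "\<omega> \<in> space P"
  shows "norm (S \<tau> (ddrift (X s \<omega>) (W s t \<omega>))) \<le> c * norm (W s t \<omega>)"
  using norm_S_le[OF assms(1)] norm_ddrift_le[OF W_half[OF assms(2)]] order_trans by blast

text \<open>Expanding the increment in the basis reduces the martingale-difference property to the
  independence of real random variables, so no operator-valued measurability is needed.\<close>

lemma noise_orthogonal:
  assumes a: "a \<in> borel_measurable (Filt s)" "integrable P (\<lambda>\<omega>. (norm (a \<omega>))\<^sup>2)" and \<tau>: "0 \<le> \<tau>"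
  shows "integrable P (\<lambda>\<omega>. a \<omega> \<bullet> S \<tau> (ddrift (X s \<omega>) (W s t \<omega>)))"
    "expectation (\<lambda>\<omega>. a \<omega> \<bullet> S \<tau> (ddrift (X s \<omega>) (W s t \<omega>))) = 0"
proof -
  define \<psi> where "\<psi> n \<omega> = a \<omega> \<bullet> S \<tau> (ddrift (X s \<omega>) (bv n))" for n \<omega>
  have aP[measurable]: "a \<in> borel_measurable P" by (rule measurable_Filt[OF sT a(1)])
  have na: "integrable P (\<lambda>\<omega>. norm (a \<omega>))"
  proof (rule Bochner_Integration.integrable_bound)
    show "integrable P (\<lambda>\<omega>. 1 + (norm (a \<omega>))\<^sup>2)" using a(2) by simp
    have "norm (a \<omega>) \<le> 1 + (norm (a \<omega>))\<^sup>2" for \<omega>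
      using sum_squares_bound[of 1 "norm (a \<omega>)"] by (simp add: power2_eq_square) (smt (verit) norm_ge_zero)
    then show "AE \<omega> in P. norm (norm (a \<omega>)) \<le> norm (1 + (norm (a \<omega>))\<^sup>2)"
      by (intro AE_I2) simp
  qed simp
  have \<psi>m: "\<psi> n \<in> borel_measurable (Filt s)" for n
  proof -
    have "(\<lambda>\<omega>. ddrift (X s \<omega>) (bv n)) \<in> borel_measurable (Filt s)"
      using X_meas[OF sT] X_half[OF _ sT] bv_in_frac_dom
      by (intro measurable_ddrift) (auto simp: space_Filt[OF sT])
    from measurable_compose[OF this measurable_S[OF \<tau>]] a(1)
    show ?thesis unfolding \<psi>_def by measurable
  qed
  have \<psi>i: "integrable P (\<psi> n)" for n
  proof (rule Bochner_Integration.integrable_bound)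
    show "integrable P (\<lambda>\<omega>. c * norm (a \<omega>))" using na by simp
    show "\<psi> n \<in> borel_measurable P" by (rule measurable_Filt[OF sT \<psi>m])
    have "norm (\<psi> n \<omega>) \<le> norm (c * norm (a \<omega>))" for \<omega>
    proof -
      have "norm (\<psi> n \<omega>) \<le> norm (a \<omega>) * norm (S \<tau> (ddrift (X s \<omega>) (bv n)))"
        unfolding \<psi>_def real_norm_def by (rule Cauchy_Schwarz_ineq2)
      also have "\<dots> \<le> norm (a \<omega>) * (c * norm (bv n))"
        by (intro mult_left_mono order_trans[OF norm_S_le[OF \<tau>] norm_ddrift_le[OF bv_in_frac_dom]]) simp
      finally show ?thesis using c by (simp add: mult.commute)
    qed
    then show "AE \<omega> in P. norm (\<psi> n \<omega>) \<le> norm (c * norm (a \<omega>))" by simp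
  qed
  define f where "f \<omega> = a \<omega> \<bullet> S \<tau> (ddrift (X s \<omega>) (W s t \<omega>))" for \<omega>
  define g where "g N \<omega> = (\<Sum>n<N. \<psi> n \<omega> * (bv n \<bullet> W s t \<omega>))" for N \<omega>
  have g_eq: "g N \<omega> = a \<omega> \<bullet> S \<tau> (ddrift (X s \<omega>) (proj e N (W s t \<omega>)))" for N \<omega>
    by (simp add: g_def \<psi>_def ddrift_proj S_sum[OF \<tau>] S_scaleR[OF \<tau>] inner_sum_right mult.commute)
  have gi: "integrable P (g N)" "expectation (g N) = 0" for N
    unfolding g_def using W_coord[OF \<psi>m \<psi>i] by (auto simp: Bochner_Integration.integral_sum)
  have fm: "f \<in> borel_measurable P"
    unfolding f_def using measurable_Filt[OF tT noise_meas[OF \<tau>]] by measurable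
  have lim: "(\<lambda>N. g N \<omega>) \<longlonglongrightarrow> f \<omega>" if \<omega>: "\<omega> \<in> space P" for \<omega>
  proof -
    note w = W_half[OF \<omega>]
    have "(\<lambda>N. ddrift (X s \<omega>) (proj e N (W s t \<omega>))) \<longlonglongrightarrow> ddrift (X s \<omega>) (W s t \<omega>)"
    proof (rule tendsto_norm_bound[where C = c])
      show "(\<lambda>N. proj e N (W s t \<omega>) - W s t \<omega>) \<longlonglongrightarrow> 0" using proj_tendsto by (simp add: LIM_zero_iff)
      show "norm (ddrift (X s \<omega>) (proj e N (W s t \<omega>)) - ddrift (X s \<omega>) (W s t \<omega>))
          \<le> c * norm (proj e N (W s t \<omega>) - W s t \<omega>)" for N
        using norm_ddrift_le[OF frac_dom_diff(1)[OF proj_in_frac_dom w], of "X s \<omega>" N]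
        by (simp add: ddrift_diff[OF proj_in_frac_dom w])
    qed
    from tendsto_inner[OF tendsto_const bounded_linear.tendsto[OF bounded_linear_S[OF \<tau>] this]]
    show ?thesis unfolding g_eq f_def .
  qed
  \<comment> \<open>Contractivity of the projections makes the majorant independent of
    \<open>N\<close>, as dominated convergence requires.\<close>
  have bnd: "norm (g N \<omega>) \<le> c * ((norm (a \<omega>))\<^sup>2 + (norm (W s t \<omega>))\<^sup>2)" for N \<omega>
  proof -
    have "norm (g N \<omega>) \<le> norm (a \<omega>) * norm (S \<tau> (ddrift (X s \<omega>) (proj e N (W s t \<omega>))))"
      unfolding g_eq real_norm_def by (rule Cauchy_Schwarz_ineq2)
    also have "\<dots> \<le> norm (a \<omega>) * (c * norm (proj e N (W s t \<omega>)))"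
      by (intro mult_left_mono order_trans[OF norm_S_le[OF \<tau>] norm_ddrift_le[OF proj_in_frac_dom]]) simp
    also have "\<dots> \<le> norm (a \<omega>) * (c * norm (W s t \<omega>))"
      by (intro mult_left_mono norm_proj_le c) simp
    also have "\<dots> = c * (norm (a \<omega>) * norm (W s t \<omega>))" by simp
    also have "\<dots> \<le> c * ((norm (a \<omega>))\<^sup>2 + (norm (W s t \<omega>))\<^sup>2)"
    proof (rule mult_left_mono[OF _ c])
      have "0 \<le> norm (a \<omega>) * norm (W s t \<omega>)" by simp
      with sum_squares_bound[of "norm (a \<omega>)" "norm (W s t \<omega>)"]
      show "norm (a \<omega>) * norm (W s t \<omega>) \<le> (norm (a \<omega>))\<^sup>2 + (norm (W s t \<omega>))\<^sup>2" by linarith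
    qed
    finally show ?thesis .
  qed
  have wi: "integrable P (\<lambda>\<omega>. c * ((norm (a \<omega>))\<^sup>2 + (norm (W s t \<omega>))\<^sup>2))"
    using a(2) W_moment(1) by simp
  have gm: "g N \<in> borel_measurable P" for N using gi(1) by auto
  have "integrable P f"
    by (rule integrable_dominated_convergence[where s = g, OF fm gm wi AE_I2[OF lim] AE_I2[OF bnd]])
  moreover have "(\<lambda>N. expectation (g N)) \<longlonglongrightarrow> expectation f"
    by (rule integral_dominated_convergence[where s = g, OF fm gm wi AE_I2[OF lim] AE_I2[OF bnd]])
  then have "expectation f = 0" by (simp add: gi LIMSEQ_const_iff)
  ultimately show "integrable P (\<lambda>\<omega>. a \<omega> \<bullet> S \<tau> (ddrift (X s \<omega>) (W s t \<omega>)))"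
    "expectation (\<lambda>\<omega>. a \<omega> \<bullet> S \<tau> (ddrift (X s \<omega>) (W s t \<omega>))) = 0"
    by (auto simp: f_def[abs_def])
qed

end

text \<open>The final time \<open>m\<close> in the semigroup is fixed and the induction runs over
  partial sums. Each partial sum is measurable at the start of the next cell, so the cross term has
  mean zero and variances add. This gives \<open>q * h\<^sup>2\<close> where the triangle inequality
  would give \<open>(q * h)\<^sup>2\<close>. The bound \<open>r \<le> 1\<close> keeps each
  innovation inside its cell.\<close>

lemma noise_moment:
  assumes h: "0 < h" and m: "real m * h \<le> T" and r: "0 < r" "r \<le> 1"
  defines "v k \<omega> \<equiv> h *\<^sub>R S (real m * h - real k * h) (ddrift (X (real k * h) \<omega>) (W (real k * h) (real k * h + r * h) \<omega>))"
  assumes q: "q \<le> m"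
  shows "(\<lambda>\<omega>. \<Sum>k<q. v k \<omega>) \<in> borel_measurable (Filt (real q * h))
    \<and> integrable P (\<lambda>\<omega>. (norm (\<Sum>k<q. v k \<omega>))\<^sup>2)
    \<and> expectation (\<lambda>\<omega>. (norm (\<Sum>k<q. v k \<omega>))\<^sup>2) \<le> real q * (h\<^sup>2 * c\<^sup>2 * C_W * h powr (2 * \<theta>))"
  using q
proof (induction q)
  case 0
  show ?case by simp
next
  case (Suc q)
  let ?s = "real q * h" and ?t = "real q * h + r * h"
  let ?a = "\<lambda>\<omega>. \<Sum>k<q. v k \<omega>"
  let ?w = "\<lambda>\<omega>. S (real m * h - ?s) (ddrift (X ?s \<omega>) (W ?s ?t \<omega>))"
  have IH: "?a \<in> borel_measurable (Filt ?s)" "integrable P (\<lambda>\<omega>. (norm (?a \<omega>))\<^sup>2)"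
    "expectation (\<lambda>\<omega>. (norm (?a \<omega>))\<^sup>2) \<le> real q * (h\<^sup>2 * c\<^sup>2 * C_W * h powr (2 * \<theta>))"
    using Suc by auto
  have qm: "real (Suc q) * h \<le> real m * h" using Suc.prems h by (intro mult_right_mono) auto
  have q1: "real (Suc q) * h = ?s + h" by (simp add: algebra_simps)
  have rh: "0 < r * h" "r * h \<le> h" using r h by (auto simp: mult_left_le_one_le)
  have s0: "0 \<le> ?s" using h by simp
  have s: "0 \<le> ?s" "?s < ?t" "?t \<le> T" "0 \<le> real m * h - ?s" "real (Suc q) * h \<le> T" "?t \<le> real (Suc q) * h" "0 \<le> ?t" "?s \<le> real (Suc q) * h"
    using s0 rh qm q1 m h by linarith+
  have tT: "?t \<in> {0..T}" using s by simp
  note orth = noise_orthogonal[OF s(1-3) IH(1,2) s(4)]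
  note Wm = W_moment[OF s(1-3)]
  have vq: "v q \<omega> = h *\<^sub>R ?w \<omega>" for \<omega> by (simp add: v_def)
  have wm: "?w \<in> borel_measurable (Filt ?t)" by (rule noise_meas[OF s(1-3) s(4)])
  have wmP: "?w \<in> borel_measurable P" by (rule measurable_Filt[OF tT wm])
  have w2m: "(\<lambda>\<omega>. (norm (?w \<omega>))\<^sup>2) \<in> borel_measurable P" using wmP by measurable
  have w2g: "integrable P (\<lambda>\<omega>. c\<^sup>2 * (norm (W ?s ?t \<omega>))\<^sup>2)" using Wm(1) by simp
  have w2le: "0 \<le> (norm (?w \<omega>))\<^sup>2 \<and> (norm (?w \<omega>))\<^sup>2 \<le> c\<^sup>2 * (norm (W ?s ?t \<omega>))\<^sup>2" if "\<omega> \<in> space P" for \<omega>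
    using power_mono[OF norm_noise_le[OF s(1-3) s(4) that] norm_ge_zero, of 2]
    by (simp add: power_mult_distrib)
  note w2 = integrable_expectation_le_mono[OF w2g w2m w2le]
  have "expectation (\<lambda>\<omega>. (norm (?w \<omega>))\<^sup>2) \<le> c\<^sup>2 * expectation (\<lambda>\<omega>. (norm (W ?s ?t \<omega>))\<^sup>2)"
    using w2(2) by simp
  also have "\<dots> \<le> c\<^sup>2 * (C_W * (r * h) powr (2 * \<theta>))"
    using Wm(2) by (intro mult_left_mono) auto
  also have "\<dots> \<le> c\<^sup>2 * (C_W * h powr (2 * \<theta>))"
    using rh \<theta> C_W_nonneg by (intro mult_left_mono powr_mono2) auto
  finally have w2E: "expectation (\<lambda>\<omega>. (norm (?w \<omega>))\<^sup>2) \<le> c\<^sup>2 * (C_W * h powr (2 * \<theta>))" .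
  have expand: "(norm (\<Sum>k<Suc q. v k \<omega>))\<^sup>2 = (norm (?a \<omega>))\<^sup>2 + 2 * h * (?a \<omega> \<bullet> ?w \<omega>) + h\<^sup>2 * (norm (?w \<omega>))\<^sup>2" for \<omega>
    by (simp only: sum.lessThan_Suc vq norm_add_scaleR_sq)
  have int: "integrable P (\<lambda>\<omega>. (norm (?a \<omega>))\<^sup>2 + 2 * h * (?a \<omega> \<bullet> ?w \<omega>) + h\<^sup>2 * (norm (?w \<omega>))\<^sup>2)"
    by (intro Bochner_Integration.integrable_add integrable_mult_right IH orth w2)
  have E: "expectation (\<lambda>\<omega>. (norm (?a \<omega>))\<^sup>2 + 2 * h * (?a \<omega> \<bullet> ?w \<omega>) + h\<^sup>2 * (norm (?w \<omega>))\<^sup>2)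
      = expectation (\<lambda>\<omega>. (norm (?a \<omega>))\<^sup>2) + h\<^sup>2 * expectation (\<lambda>\<omega>. (norm (?w \<omega>))\<^sup>2)"
    using IH(2) orth w2(1) by simp
  have "h\<^sup>2 * expectation (\<lambda>\<omega>. (norm (?w \<omega>))\<^sup>2) \<le> h\<^sup>2 * (c\<^sup>2 * (C_W * h powr (2 * \<theta>)))"
    by (intro mult_left_mono w2E) simp
  then have "expectation (\<lambda>\<omega>. (norm (\<Sum>k<Suc q. v k \<omega>))\<^sup>2) \<le> real (Suc q) * (h\<^sup>2 * c\<^sup>2 * C_W * h powr (2 * \<theta>))"
    unfolding expand E using IH(3) by (simp add: algebra_simps)
  moreover have "integrable P (\<lambda>\<omega>. (norm (\<Sum>k<Suc q. v k \<omega>))\<^sup>2)"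
    unfolding expand by (rule int)
  moreover have "(\<lambda>\<omega>. \<Sum>k<Suc q. v k \<omega>) \<in> borel_measurable (Filt (real (Suc q) * h))"
  proof -
    have [measurable]: "?a \<in> borel_measurable (Filt (real (Suc q) * h))"
      by (rule measurable_Filt_mono[OF s(1) s(8) s(5) IH(1)])
    have [measurable]: "?w \<in> borel_measurable (Filt (real (Suc q) * h))"
      by (rule measurable_Filt_mono[OF s(7) s(6) s(5) wm])
    show ?thesis unfolding sum.lessThan_Suc vq by measurable
  qed
  ultimately show ?case by blast
qed

text \<open>The path quantity \<open>local_error\<close> as a function of the sample point, so that
  measurability and moments can be stated.\<close>

definition local_err :: "real \<Rightarrow> nat \<Rightarrow> real \<Rightarrow> 'w \<Rightarrow> 'h" where
  "local_err h m r \<omega> = (\<Sum>k<m. h *\<^sub>R S (real m * h - real k * h)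
     (drift (X (real k * h + r * h) \<omega>) - drift (X (real k * h) \<omega>)))"

lemma local_err_meas:
  assumes h: "0 < h" and m: "real m * h \<le> T" and r: "0 < r" "r \<le> 1"
  shows "local_err h m r \<in> borel_measurable P"
  unfolding local_err_def
proof (intro borel_measurable_sum borel_measurable_scaleR borel_measurable_const)
  fix k assume "k \<in> {..<m}"
  then have "k < m" by simp
  note g = grid[OF h m this r]
  have d: "(\<lambda>\<omega>. drift (X t \<omega>)) \<in> borel_measurable P" if "t \<in> {0..T}" for t
    using X_measP[OF that] X_half[OF _ that] by (rule measurable_drift)
  have "(\<lambda>\<omega>. drift (X (real k * h + r * h) \<omega>) - drift (X (real k * h) \<omega>)) \<in> borel_measurable P"
    using g by (intro borel_measurable_diff d) auto
  from measurable_compose[OF this measurable_S[of "real m * h - real k * h"]] g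
  show "(\<lambda>\<omega>. S (real m * h - real k * h) (drift (X (real k * h + r * h) \<omega>) - drift (X (real k * h) \<omega>))) \<in> borel_measurable P"
    by simp
qed

lemma local_err_moment:
  assumes h: "0 < h" "h \<le> T" and m: "real m * h \<le> T" and r: "0 < r" "r \<le> 1"
  shows "(\<integral>\<^sup>+\<omega>. ennreal ((norm (local_err h m r \<omega>))\<^sup>2) \<partial>P) \<le> ennreal (C_L * h powr (4 * \<theta>))"
proof -
  define N where "N \<omega> = (\<Sum>k<m. h *\<^sub>R S (real m * h - real k * h) (ddrift (X (real k * h) \<omega>) (W (real k * h) (real k * h + r * h) \<omega>)))" for \<omega>
  define y where "y k \<omega> = norm (iv (Z (real k * h + r * h) \<omega> - Z (real k * h) \<omega>))" for k \<omega>
  have nm: "integrable P (\<lambda>\<omega>. (norm (N \<omega>))\<^sup>2)"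
    "expectation (\<lambda>\<omega>. (norm (N \<omega>))\<^sup>2) \<le> real m * (h\<^sup>2 * c\<^sup>2 * C_W * h powr (2 * \<theta>))"
    using noise_moment[OF h(1) m r order_refl] by (auto simp: N_def)
  have y4: "integrable P (\<lambda>\<omega>. y k \<omega> ^ 4)" "expectation (\<lambda>\<omega>. y k \<omega> ^ 4) \<le> CZ * h powr (4 * \<theta>)" if "k < m" for k
  proof -
    note g = grid[OF h(1) m that r]
    note i = inc_moment[OF g(1-3)]
    show "integrable P (\<lambda>\<omega>. y k \<omega> ^ 4)" using i(1) by (simp add: y_def)
    have "(r * h) powr (4 * \<theta>) \<le> h powr (4 * \<theta>)"
      using r h \<theta> by (intro powr_mono2) (auto simp: mult_left_le_one_le)
    then have "CZ * (r * h) powr (4 * \<theta>) \<le> CZ * h powr (4 * \<theta>)" using CZ by (intro mult_left_mono)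
    then show "expectation (\<lambda>\<omega>. y k \<omega> ^ 4) \<le> CZ * h powr (4 * \<theta>)"
      using i(2) by (simp add: y_def)
  qed
  define G where "G \<omega> = 3 * (norm (N \<omega>))\<^sup>2 + 3 * (C_loc\<^sup>2 * h\<^sup>2 * R \<omega> ^ 4) + 3 * (C_rem\<^sup>2 * (T * (\<Sum>k<m. h * y k \<omega> ^ 4)))" for \<omega>
  have Gi: "integrable P G"
    unfolding G_def using y4(1)
    by (intro Bochner_Integration.integrable_add integrable_mult_right nm R_int Bochner_Integration.integrable_sum) auto
  have Gle: "0 \<le> (norm (local_err h m r \<omega>))\<^sup>2 \<and> (norm (local_err h m r \<omega>))\<^sup>2 \<le> G \<omega>" if \<omega>: "\<omega> \<in> space P" for \<omega>
  proof -
    interpret p: mild_path lam e j F F' F'' c K T \<gamma> "R \<omega>" "\<xi> \<omega>" "\<lambda>t. Z t \<omega>" "\<lambda>t. X t \<omega>"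
      by (rule path[OF \<omega>])
    have "norm (local_err h m r \<omega>) \<le> norm (N \<omega>) + C_loc * (R \<omega>)\<^sup>2 * h + C_rem * (\<Sum>k<m. h * (y k \<omega>)\<^sup>2)"
      using p.norm_local_error[OF h(1) m r]
      by (simp add: local_err_def p.local_error_def p.noise_error_def N_def y_def W_def)
    then have "(norm (local_err h m r \<omega>))\<^sup>2 \<le> (norm (N \<omega>) + C_loc * (R \<omega>)\<^sup>2 * h + C_rem * (\<Sum>k<m. h * (y k \<omega>)\<^sup>2))\<^sup>2"
      by (intro power_mono) auto
    also have "\<dots> \<le> 3 * (norm (N \<omega>))\<^sup>2 + 3 * (C_loc * (R \<omega>)\<^sup>2 * h)\<^sup>2 + 3 * (C_rem * (\<Sum>k<m. h * (y k \<omega>)\<^sup>2))\<^sup>2"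
      by (rule power2_sum3_le)
    also have "(C_loc * (R \<omega>)\<^sup>2 * h)\<^sup>2 = C_loc\<^sup>2 * h\<^sup>2 * R \<omega> ^ 4"
      by (simp add: power_mult_distrib mult_ac)
    also have "(C_rem * (\<Sum>k<m. h * (y k \<omega>)\<^sup>2))\<^sup>2 \<le> C_rem\<^sup>2 * (T * (\<Sum>k<m. h * y k \<omega> ^ 4))"
    proof -
      \<comment> \<open>Splitting \<open>h\<close> into two square roots makes Cauchy-Schwarz return
        weighted sums, one of which is at most \<open>T\<close>.\<close>
      have "(\<Sum>k<m. h * (y k \<omega>)\<^sup>2)\<^sup>2 = (\<Sum>k<m. sqrt h * (sqrt h * (y k \<omega>)\<^sup>2))\<^sup>2"
        using h by (simp flip: mult.assoc)
      also have "\<dots> \<le> (\<Sum>k<m. (sqrt h)\<^sup>2) * (\<Sum>k<m. (sqrt h * (y k \<omega>)\<^sup>2)\<^sup>2)"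
        by (rule Cauchy_Schwarz_ineq_sum)
      also have "\<dots> = (real m * h) * (\<Sum>k<m. h * y k \<omega> ^ 4)"
        using h by (simp add: power_mult_distrib)
      also have "\<dots> \<le> T * (\<Sum>k<m. h * y k \<omega> ^ 4)"
        using m h by (intro mult_right_mono sum_nonneg) auto
      finally show ?thesis by (simp add: power_mult_distrib mult_left_mono)
    qed
    finally show ?thesis by (simp add: G_def)
  qed
  have ys: "integrable P (\<lambda>\<omega>. \<Sum>k<m. h * y k \<omega> ^ 4)"
    "expectation (\<lambda>\<omega>. \<Sum>k<m. h * y k \<omega> ^ 4) = (\<Sum>k<m. h * expectation (\<lambda>\<omega>. y k \<omega> ^ 4))"
  proof -
    have i: "integrable P (\<lambda>\<omega>. h * y k \<omega> ^ 4)" if "k \<in> {..<m}" for k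
      using y4(1) that by simp
    show "integrable P (\<lambda>\<omega>. \<Sum>k<m. h * y k \<omega> ^ 4)" by (rule Bochner_Integration.integrable_sum[OF i])
    show "expectation (\<lambda>\<omega>. \<Sum>k<m. h * y k \<omega> ^ 4) = (\<Sum>k<m. h * expectation (\<lambda>\<omega>. y k \<omega> ^ 4))"
      by (subst Bochner_Integration.integral_sum[OF i]) simp_all
  qed
  have "expectation G = 3 * expectation (\<lambda>\<omega>. (norm (N \<omega>))\<^sup>2) + 3 * (C_loc\<^sup>2 * h\<^sup>2 * M4)
      + 3 * (C_rem\<^sup>2 * (T * (\<Sum>k<m. h * expectation (\<lambda>\<omega>. y k \<omega> ^ 4))))"
    unfolding G_def M4_def ys(2)[symmetric] using nm(1) R_int ys(1) by simp
  also have "\<dots> \<le> 3 * (C_noise * h powr (4 * \<theta>)) + 3 * (C_loc\<^sup>2 * (T1\<^sup>2 * h powr (4 * \<theta>)) * M4)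
      + 3 * (C_rem\<^sup>2 * (T * (T * (CZ * h powr (4 * \<theta>)))))"
  proof (intro add_mono mult_left_mono mult_right_mono)
    have hh: "h powr (2 * \<theta>) * h powr (2 * \<theta>) = h powr (4 * \<theta>)" by (simp flip: powr_add)
    \<comment> \<open>The gain from orthogonality: \<open>m * h\<^sup>2\<close> is at most
      \<open>T * h\<close>, and the spare \<open>h\<close> supplies the second factor
      \<open>h powr (2 * \<theta>)\<close>.\<close>
    have "real m * (h\<^sup>2 * c\<^sup>2 * C_W * h powr (2 * \<theta>)) = (real m * h) * (c\<^sup>2 * C_W * (h * h powr (2 * \<theta>)))"
      by (simp add: power2_eq_square mult_ac)
    also have "\<dots> \<le> T * (c\<^sup>2 * C_W * ((T1 * h powr (2 * \<theta>)) * h powr (2 * \<theta>)))"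
      using m h T step_le_powr[OF h] C_W_nonneg by (intro mult_mono mult_left_mono mult_right_mono) auto
    also have "\<dots> = C_noise * h powr (4 * \<theta>)"
      unfolding C_noise_def hh[symmetric] by (simp add: mult_ac)
    finally show "expectation (\<lambda>\<omega>. (norm (N \<omega>))\<^sup>2) \<le> C_noise * h powr (4 * \<theta>)" using nm(2) by simp
    have "h\<^sup>2 \<le> (T1 * h powr (2 * \<theta>))\<^sup>2" using step_le_powr[OF h] h by (intro power_mono) auto
    then show "h\<^sup>2 \<le> T1\<^sup>2 * h powr (4 * \<theta>)" unfolding hh[symmetric] by (simp add: power2_eq_square mult_ac)
    have "(\<Sum>k<m. h * expectation (\<lambda>\<omega>. y k \<omega> ^ 4)) \<le> (\<Sum>k<m. h * (CZ * h powr (4 * \<theta>)))"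
      using y4(2) h by (intro sum_mono mult_left_mono) auto
    also have "\<dots> = (real m * h) * (CZ * h powr (4 * \<theta>))" by simp
    also have "\<dots> \<le> T * (CZ * h powr (4 * \<theta>))" using m CZ by (intro mult_right_mono) auto
    finally show "(\<Sum>k<m. h * expectation (\<lambda>\<omega>. y k \<omega> ^ 4)) \<le> T * (CZ * h powr (4 * \<theta>))" .
  qed (use M4_nonneg T in auto)
  also have "\<dots> = C_L * h powr (4 * \<theta>)" by (simp add: C_L_def algebra_simps power2_eq_square)
  finally have EG: "expectation G \<le> C_L * h powr (4 * \<theta>)" .
  have "(\<integral>\<^sup>+\<omega>. ennreal ((norm (local_err h m r \<omega>))\<^sup>2) \<partial>P) \<le> (\<integral>\<^sup>+\<omega>. ennreal (G \<omega>) \<partial>P)"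
    using Gle by (intro nn_integral_mono ennreal_leI) blast
  also have "\<dots> = ennreal (expectation G)"
    using Gle by (intro nn_integral_eq_integral Gi AE_I2) (meson order_trans)
  also have "\<dots> \<le> ennreal (C_L * h powr (4 * \<theta>))" by (intro ennreal_leI EG)
  finally show ?thesis .
qed

text \<open>A measurable majorant for the squared norm of \<open>B\<close> from
  \<open>error_decomposition\<close>. That limit is obtained path by path; the limes inferior of
  averages of squares is measurable by construction and suits Fatou's lemma.\<close>

definition avg_err :: "real \<Rightarrow> nat \<Rightarrow> 'w \<Rightarrow> ennreal" where
  "avg_err h m \<omega> = liminf (\<lambda>n. ennreal (1 / real (Suc n)) *
     (\<Sum>i<Suc n. ennreal ((norm (local_err h m (real (Suc i) / real (Suc n)) \<omega>))\<^sup>2)))"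

lemma avg_err_moment:
  assumes h: "0 < h" "h \<le> T" and m: "real m * h \<le> T"
  shows "avg_err h m \<in> borel_measurable P"
    "(\<integral>\<^sup>+\<omega>. avg_err h m \<omega> \<partial>P) \<le> ennreal (C_L * h powr (4 * \<theta>))"
proof -
  have r: "0 < real (Suc i) / real (Suc n)" "real (Suc i) / real (Suc n) \<le> 1" if "i < Suc n" for i n
    using that by auto
  let ?u = "\<lambda>n \<omega>. ennreal (1 / real (Suc n)) * (\<Sum>i<Suc n. ennreal ((norm (local_err h m (real (Suc i) / real (Suc n)) \<omega>))\<^sup>2))"
  have lm: "(\<lambda>\<omega>. ennreal ((norm (local_err h m (real (Suc i) / real (Suc n)) \<omega>))\<^sup>2)) \<in> borel_measurable P" if "i < Suc n" for i n
    using local_err_meas[OF h(1) m r[OF that]] by measurable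
  have sm: "(\<lambda>\<omega>. \<Sum>i<Suc n. ennreal ((norm (local_err h m (real (Suc i) / real (Suc n)) \<omega>))\<^sup>2)) \<in> borel_measurable P" for n
    by (rule borel_measurable_sum) (rule lm, simp)
  have um: "?u n \<in> borel_measurable P" for n
    by (rule borel_measurable_times_ennreal[OF borel_measurable_const sm])
  have un: "(\<integral>\<^sup>+\<omega>. ?u n \<omega> \<partial>P) \<le> ennreal (C_L * h powr (4 * \<theta>))" for n
  proof -
    have "(\<integral>\<^sup>+\<omega>. ?u n \<omega> \<partial>P) = ennreal (1 / real (Suc n)) *
      (\<Sum>i<Suc n. \<integral>\<^sup>+\<omega>. ennreal ((norm (local_err h m (real (Suc i) / real (Suc n)) \<omega>))\<^sup>2) \<partial>P)"
      by (subst nn_integral_cmult[OF sm], subst nn_integral_sum) (use lm in auto)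
    also have "\<dots> \<le> ennreal (1 / real (Suc n)) * (\<Sum>i<Suc n. ennreal (C_L * h powr (4 * \<theta>)))"
      by (intro mult_left_mono sum_mono local_err_moment[OF h m r]) auto
    also have "(\<Sum>i<Suc n. ennreal (C_L * h powr (4 * \<theta>))) = ennreal (\<Sum>i<Suc n. C_L * h powr (4 * \<theta>))"
      using C_L_nonneg by (intro sum_ennreal) auto
    also have "ennreal (1 / real (Suc n)) * ennreal (\<Sum>i<Suc n. C_L * h powr (4 * \<theta>)) = ennreal (C_L * h powr (4 * \<theta>))"
      using C_L_nonneg by (subst ennreal_mult[symmetric]) (auto intro!: sum_nonneg simp: field_simps)
    finally show ?thesis .
  qed
  show "avg_err h m \<in> borel_measurable P"
    unfolding avg_err_def by (rule borel_measurable_liminf[OF um])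
  \<comment> \<open>Fatou's lemma; the moments on the right are bounded uniformly in
    \<open>n\<close>.\<close>
  have "(\<integral>\<^sup>+\<omega>. avg_err h m \<omega> \<partial>P) \<le> liminf (\<lambda>n. \<integral>\<^sup>+\<omega>. ?u n \<omega> \<partial>P)"
    unfolding avg_err_def by (rule nn_integral_liminf[OF um])
  also have "\<dots> \<le> liminf (\<lambda>n::nat. ennreal (C_L * h powr (4 * \<theta>)))"
    by (intro Liminf_mono always_eventually allI un)
  finally show "(\<integral>\<^sup>+\<omega>. avg_err h m \<omega> \<partial>P) \<le> ennreal (C_L * h powr (4 * \<theta>))"
    by (simp add: Liminf_const)
qed

text \<open>The squared norm of a mean is at most the mean of the squared norms, here by
  Cauchy-Schwarz with constant weights.\<close>

lemma norm_limit_le_avg_err: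
  assumes "(\<lambda>n. (1 / real (Suc n)) *\<^sub>R (\<Sum>i<Suc n. local_err h m (real (Suc i) / real (Suc n)) \<omega>)) \<longlonglongrightarrow> B"
  shows "ennreal ((norm B)\<^sup>2) \<le> avg_err h m \<omega>"
proof -
  let ?L = "\<lambda>n i. local_err h m (real (Suc i) / real (Suc n)) \<omega>"
  let ?b = "\<lambda>n. (1 / real (Suc n)) *\<^sub>R (\<Sum>i<Suc n. ?L n i)"
  have "(\<lambda>n. ennreal ((norm (?b n))\<^sup>2)) \<longlonglongrightarrow> ennreal ((norm B)\<^sup>2)"
    by (intro tendsto_intros assms)
  then have "ennreal ((norm B)\<^sup>2) = liminf (\<lambda>n. ennreal ((norm (?b n))\<^sup>2))"
    by (rule lim_imp_Liminf[OF sequentially_bot, symmetric])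
  also have "\<dots> \<le> avg_err h m \<omega>"
    unfolding avg_err_def
  proof (intro Liminf_mono always_eventually allI)
    fix n
    have "(norm (?b n))\<^sup>2 = (1 / real (Suc n))\<^sup>2 * (norm (\<Sum>i<Suc n. ?L n i))\<^sup>2"
      by (simp only: norm_scaleR power_mult_distrib power2_abs)
    also have "\<dots> \<le> (1 / real (Suc n))\<^sup>2 * (\<Sum>i<Suc n. 1 * norm (?L n i))\<^sup>2"
      by (intro mult_left_mono power_mono) (simp_all only: mult_1 norm_sum norm_ge_zero zero_le_power2)
    also have "\<dots> \<le> (1 / real (Suc n))\<^sup>2 * ((\<Sum>i<Suc n. 1\<^sup>2) * (\<Sum>i<Suc n. (norm (?L n i))\<^sup>2))"
      by (intro mult_left_mono Cauchy_Schwarz_ineq_sum) simp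
    also have "\<dots> = 1 / real (Suc n) * (\<Sum>i<Suc n. (norm (?L n i))\<^sup>2)"
    proof -
      have "(\<Sum>i<Suc n. 1\<^sup>2 :: real) = real (Suc n)" by simp
      then show ?thesis by (simp only:) (simp add: power2_eq_square del: of_nat_Suc sum.lessThan_Suc)
    qed
    finally have "ennreal ((norm (?b n))\<^sup>2) \<le> ennreal (1 / real (Suc n) * (\<Sum>i<Suc n. (norm (?L n i))\<^sup>2))"
      by (rule ennreal_leI)
    also have "\<dots> = ennreal (1 / real (Suc n)) * (\<Sum>i<Suc n. ennreal ((norm (?L n i))\<^sup>2))"
      by (subst ennreal_mult) (auto intro!: sum_nonneg simp del: sum.lessThan_Suc simp: sum_ennreal)
    finally show "ennreal ((norm (?b n))\<^sup>2) \<le> ennreal (1 / real (Suc n)) * (\<Sum>i<Suc n. ennreal ((norm (?L n i))\<^sup>2))" .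
  qed
  finally show ?thesis .
qed

end

section \<open>The numerical scheme\<close>

context nemytskii
begin

text \<open>Discrete variation of constants. The noise telescopes, since the step adds
  \<open>zk (Suc m) - S h (zk m)\<close> to the propagated \<open>zk m\<close>, so the scheme
  contains the exact projected noise.\<close>

lemma scheme_unroll:
  fixes y :: "nat \<Rightarrow> 'h" and zk :: "nat \<Rightarrow> 'h"
  assumes h: "0 \<le> h" and y0: "y 0 = proj e N x0 + proj e N (zk 0)"
    and ySuc: "\<And>k. k < M \<Longrightarrow> y (Suc k) = S h (y k + h *\<^sub>R proj e N (drift (y k)))
      + proj e N (zk (Suc k) - S h (zk k))"
    and "m \<le> M"
  shows "y m = proj e N (S (real m * h) x0
    + (\<Sum>k<m. h *\<^sub>R S (real m * h - real k * h) (drift (y k))) + zk m)"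
  using \<open>m \<le> M\<close>
proof (induction m)
  case 0 then show ?case using y0 by (simp add: proj_add)
next
  case (Suc m)
  let ?\<Sigma> = "\<Sum>k<m. h *\<^sub>R S (real m * h - real k * h) (drift (y k))"
  have IH: "y m = proj e N (S (real m * h) x0 + ?\<Sigma> + zk m)" using Suc by simp
  have S\<Sigma>: "S h ?\<Sigma> = (\<Sum>k<m. h *\<^sub>R S (real (Suc m) * h - real k * h) (drift (y k)))"
    unfolding S_sum[OF h]
  proof (rule sum.cong[OF refl])
    fix k assume "k \<in> {..<m}"
    then have "real k * h \<le> real m * h" using h by (intro mult_right_mono) auto
    then show "S h (h *\<^sub>R S (real m * h - real k * h) (drift (y k)))
        = h *\<^sub>R S (real (Suc m) * h - real k * h) (drift (y k))"
      using h by (simp add: S_scaleR S_S algebra_simps)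
  qed
  have last: "real (Suc m) * h - real m * h = h" by (simp add: algebra_simps)
  have S0: "S h (S (real m * h) x0) = S (real (Suc m) * h) x0"
    using h by (simp add: S_S algebra_simps)
  have "y (Suc m) = S h (y m) + h *\<^sub>R S h (proj e N (drift (y m))) + proj e N (zk (Suc m) - S h (zk m))"
    using ySuc[of m] Suc.prems by (simp add: S_add[OF h] S_scaleR[OF h])
  also have "S h (y m) = proj e N (S h (S (real m * h) x0 + ?\<Sigma> + zk m))"
    by (subst IH) (rule S_proj[OF h])
  also have "S h (proj e N (drift (y m))) = proj e N (S h (drift (y m)))"
    by (rule S_proj[OF h])
  also have "proj e N (S h (S (real m * h) x0 + ?\<Sigma> + zk m)) + h *\<^sub>R proj e N (S h (drift (y m))) + proj e N (zk (Suc m) - S h (zk m))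
      = proj e N (S h (S (real m * h) x0 + ?\<Sigma> + zk m) + h *\<^sub>R S h (drift (y m)) + (zk (Suc m) - S h (zk m)))"
    by (simp only: proj_add linear_scale[OF bounded_linear.linear[OF bounded_linear_proj]])
  also have "\<dots> = proj e N (S (real (Suc m) * h) x0
      + (\<Sum>k<Suc m. h *\<^sub>R S (real (Suc m) * h - real k * h) (drift (y k))) + zk (Suc m))"
    by (simp only: S_add[OF h] S\<Sigma> S0 sum.lessThan_Suc last) (simp add: algebra_simps)
  finally show ?case .
qed

end

text \<open>Stated in extended reals because finiteness of the error moments is not known in
  advance; it is part of what the recursion yields.\<close>

lemma discrete_gronwall:
  fixes a :: "nat \<Rightarrow> ennreal"
  assumes "0 \<le> q" "0 \<le> \<kappa>"
    and rec: "\<And>m. m \<le> M \<Longrightarrow> a m \<le> ennreal \<kappa> + ennreal q * (\<Sum>k<m. a k)"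
    and "m \<le> M"
  shows "a m \<le> ennreal (\<kappa> * (1 + q) ^ m)"
  using \<open>m \<le> M\<close>
proof (induction m rule: less_induct)
  case (less m)
  have geo: "q * (\<Sum>k<m. (1 + q) ^ k) = (1 + q) ^ m - 1"
    using power_diff_1_eq[of "1 + q" m] by simp
  have "a m \<le> ennreal \<kappa> + ennreal q * (\<Sum>k<m. a k)" by (rule rec[OF less.prems])
  also have "\<dots> \<le> ennreal \<kappa> + ennreal q * (\<Sum>k<m. ennreal (\<kappa> * (1 + q) ^ k))"
    using less by (intro add_left_mono mult_left_mono sum_mono) auto
  also have "\<dots> = ennreal (\<kappa> + q * (\<Sum>k<m. \<kappa> * (1 + q) ^ k))"
    using assms(1,2) by (simp add: sum_ennreal ennreal_mult[symmetric] sum_nonneg ennreal_plus[symmetric] del: ennreal_plus)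
  also have "\<kappa> + q * (\<Sum>k<m. \<kappa> * (1 + q) ^ k) = \<kappa> + \<kappa> * (q * (\<Sum>k<m. (1 + q) ^ k))"
    by (simp add: sum_distrib_left[symmetric])
  also have "\<dots> = \<kappa> * (1 + q) ^ m" unfolding geo by (simp add: algebra_simps)
  finally show ?case .
qed

lemma power2_sum4_le: "(a + b + d + f)\<^sup>2 \<le> 4 * a\<^sup>2 + 4 * b\<^sup>2 + 4 * d\<^sup>2 + 4 * f\<^sup>2" for a b d f :: real
  using power2_sum_le[of "a + b" "d + f"] power2_sum_le[of a b] power2_sum_le[of d f]
  by (simp add: add.assoc)

section \<open>Strong error of the scheme\<close>

context mild_noise
begin

text \<open>The factors 4 come from squaring a sum of four errors, and 9 from the constant 3 in the
  quadrature error.\<close>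

definition "C_final = 4 * (C_frac\<^sup>2 + 9 * C_drift\<^sup>2 * T\<^sup>2) * M4 + 4 * C_L * T powr (4 * \<theta>)"

lemma C_final_nonneg: "0 \<le> C_final"
  unfolding C_final_def using M4_nonneg C_L_nonneg by simp

definition "C_rate = sqrt (C_final * exp (4 * c\<^sup>2 * T\<^sup>2)) + 1"

text \<open>The form is chosen so that expectations can be taken term by term: projection and
  quadrature errors are bounded by \<open>R\<close>, the local error is replaced by
  \<open>avg_err\<close>, and the last sum feeds the Gronwall recursion.\<close>

lemma scheme_pathwise:
  fixes N M m :: nat and h :: real and y :: "nat \<Rightarrow> 'h"
  defines "\<kappa>1 \<equiv> 4 * (C_frac\<^sup>2 * (lam N powr (-\<gamma>))\<^sup>2 + 9 * C_drift\<^sup>2 * h\<^sup>2 * (1 + ln (real M))\<^sup>2)"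
  assumes \<omega>: "\<omega> \<in> space P" and N: "1 \<le> N" and h: "0 < h" and m: "m \<le> M" and MT: "real M * h = T"
    and y0: "y 0 = proj e N (\<xi> \<omega>) + proj e N (Z 0 \<omega>)"
    and ySuc: "\<And>k. k < M \<Longrightarrow> y (Suc k) = S h (y k + h *\<^sub>R proj e N (drift (y k)))
      + proj e N (Z (real (Suc k) * h) \<omega> - S h (Z (real k * h) \<omega>))"
    and M: "1 \<le> M"
  shows "ennreal ((norm (X (real m * h) \<omega> - y m))\<^sup>2) \<le>
    ennreal (\<kappa>1 * R \<omega> ^ 4)
    + 4 * avg_err h m \<omega> + ennreal (4 * c\<^sup>2 * T * h) * (\<Sum>k<m. ennreal ((norm (X (real k * h) \<omega> - y k))\<^sup>2))"
proof -
  interpret p: mild_path lam e j F F' F'' c K T \<gamma> "R \<omega>" "\<xi> \<omega>" "\<lambda>t. Z t \<omega>" "\<lambda>t. X t \<omega>"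
    by (rule path[OF \<omega>])
  let ?t = "real m * h"
  have mT: "?t \<le> T" unfolding MT[symmetric] using m h by (intro mult_right_mono) auto
  have tT: "?t \<in> {0..T}" using mT h by simp
  have ym: "y k = proj e N (S (real k * h) (\<xi> \<omega>)
    + (\<Sum>i<k. h *\<^sub>R S (real k * h - real i * h) (drift (y i))) + Z (real k * h) \<omega>)" if "k \<le> M" for k
    by (rule scheme_unroll[where M = M and zk = "\<lambda>k. Z (real k * h) \<omega>"]) (use h y0 ySuc that in auto)
  have yD: "y k \<in> D (1/2)" if "k \<le> M" for k
    unfolding ym[OF that] by (rule proj_in_frac_dom)
  obtain A B where
    Q: "integral {0..?t} (\<lambda>s. S (?t - s) (drift (X s \<omega>)))
       - (\<Sum>k<m. h *\<^sub>R S (?t - real k * h) (drift (y k)))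
     = A + B + (\<Sum>k<m. h *\<^sub>R S (?t - real k * h) (drift (X (real k * h) \<omega>) - drift (y k)))"
    and A: "norm A \<le> 3 * C_drift * R \<omega> * h * (1 + ln (real m))"
    and Blim: "(\<lambda>n. (1 / real (Suc n)) *\<^sub>R (\<Sum>i<Suc n. p.local_error h m (real (Suc i) / real (Suc n)))) \<longlonglongrightarrow> B"
    by (rule p.error_decomposition[OF h mT, where d = "\<lambda>k. drift (y k)"])
  have B: "ennreal ((norm B)\<^sup>2) \<le> avg_err h m \<omega>"
    using Blim by (intro norm_limit_le_avg_err) (simp only: p.local_error_def local_err_def)
  let ?E = "\<Sum>k<m. h *\<^sub>R S (?t - real k * h) (drift (X (real k * h) \<omega>) - drift (y k))"
  let ?e = "\<lambda>k. norm (X (real k * h) \<omega> - y k)"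
  have R1: "1 \<le> R \<omega>" by (rule p.R)
  have E: "norm ?E \<le> (\<Sum>k<m. h * (c * ?e k))"
  proof (rule sum_norm_le)
    fix k assume "k \<in> {..<m}"
    then have k: "k < m" "k \<le> M" using m by auto
    have kt: "real k * h \<le> ?t" using k h by (intro mult_right_mono) auto
    have kT: "real k * h \<in> {0..T}" "0 \<le> ?t - real k * h"
      using order_trans[OF kt mT] kt h by (simp, simp only: diff_ge_0_iff_ge)
    have "norm (S (?t - real k * h) (drift (X (real k * h) \<omega>) - drift (y k))) \<le> c * ?e k"
      by (rule order_trans[OF norm_S_le[OF kT(2)] drift_lipschitz[OF p.x_half[OF kT(1)] yD[OF k(2)]]])
    then show "norm (h *\<^sub>R S (?t - real k * h) (drift (X (real k * h) \<omega>) - drift (y k))) \<le> h * (c * ?e k)"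
      using h by simp
  qed
  \<comment> \<open>Inside the projection the initial value and the noise of \<open>X\<close> and
    \<open>y\<close> cancel, leaving the difference of the drift terms.\<close>
  have "X ?t \<omega> - y m = (X ?t \<omega> - proj e N (X ?t \<omega>)) + proj e N (A + B + ?E)"
  proof -
    have split: "X ?t \<omega> - y m = (X ?t \<omega> - proj e N (X ?t \<omega>)) + (proj e N (X ?t \<omega>) - y m)" by simp
    have "proj e N (X ?t \<omega>) - y m = proj e N (A + B + ?E)"
      unfolding ym[OF m] proj_diff[symmetric] Q[symmetric] by (subst p.mild[OF tT]) (simp add: algebra_simps)
    then show ?thesis unfolding split by (simp only:)
  qed
  then have "?e m \<le> norm (X ?t \<omega> - proj e N (X ?t \<omega>)) + norm (proj e N (A + B + ?E))"
    by (simp only:) (rule norm_triangle_ineq)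
  also have "norm (proj e N (A + B + ?E)) \<le> norm A + norm B + norm ?E"
    by (rule order_trans[OF norm_proj_le]) (intro norm_triangle_le add_right_mono norm_triangle_ineq)
  finally have "?e m \<le> norm (X ?t \<omega> - proj e N (X ?t \<omega>)) + norm A + norm B + norm ?E" by simp
  then have "(?e m)\<^sup>2 \<le> (norm (X ?t \<omega> - proj e N (X ?t \<omega>)) + norm A + norm B + norm ?E)\<^sup>2"
    by (intro power_mono) auto
  also have "\<dots> \<le> 4 * (norm (X ?t \<omega> - proj e N (X ?t \<omega>)))\<^sup>2 + 4 * (norm A)\<^sup>2 + 4 * (norm B)\<^sup>2 + 4 * (norm ?E)\<^sup>2"
    by (rule power2_sum4_le)
  also have "\<dots> \<le> 4 * (C_frac\<^sup>2 * (lam N powr (-\<gamma>))\<^sup>2 * R \<omega> ^ 4) + 4 * (9 * C_drift\<^sup>2 * h\<^sup>2 * (1 + ln (real M))\<^sup>2 * R \<omega> ^ 4)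
      + 4 * (norm B)\<^sup>2 + 4 * (c\<^sup>2 * T * h * (\<Sum>k<m. (?e k)\<^sup>2))"
  proof (intro add_mono mult_left_mono)
    have R24: "(R \<omega>)\<^sup>2 \<le> R \<omega> ^ 4" using R1 by (intro power_increasing) auto
    have "norm (X ?t \<omega> - proj e N (X ?t \<omega>)) \<le> lam N powr (-\<gamma>) * fnorm \<gamma> (X ?t \<omega>)"
      by (rule norm_proj_tail[OF _ p.x(1)[OF tT] N]) (use \<gamma> in simp)
    also have "\<dots> \<le> lam N powr (-\<gamma>) * (C_frac * R \<omega>)"
      by (intro mult_left_mono p.fnorm_x tT) simp
    finally have "(norm (X ?t \<omega> - proj e N (X ?t \<omega>)))\<^sup>2 \<le> (lam N powr (-\<gamma>) * (C_frac * R \<omega>))\<^sup>2"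
      by (intro power_mono) auto
    also have "\<dots> = C_frac\<^sup>2 * (lam N powr (-\<gamma>))\<^sup>2 * (R \<omega>)\<^sup>2" by (simp add: power_mult_distrib mult_ac)
    also have "\<dots> \<le> C_frac\<^sup>2 * (lam N powr (-\<gamma>))\<^sup>2 * R \<omega> ^ 4" by (intro mult_left_mono R24) simp
    finally show "(norm (X ?t \<omega> - proj e N (X ?t \<omega>)))\<^sup>2 \<le> C_frac\<^sup>2 * (lam N powr (-\<gamma>))\<^sup>2 * R \<omega> ^ 4" .
    have "ln (real m) \<le> ln (real M)" using m M by (cases "m = 0") auto
    then have "3 * C_drift * R \<omega> * h * (1 + ln (real m)) \<le> 3 * C_drift * R \<omega> * h * (1 + ln (real M))"
      using C_drift_nonneg R1 h by (intro mult_left_mono) auto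
    then have "(norm A)\<^sup>2 \<le> (3 * C_drift * R \<omega> * h * (1 + ln (real M)))\<^sup>2"
      using A by (intro power_mono) auto
    also have "\<dots> = 9 * C_drift\<^sup>2 * h\<^sup>2 * (1 + ln (real M))\<^sup>2 * (R \<omega>)\<^sup>2" by (simp add: power_mult_distrib mult_ac)
    also have "\<dots> \<le> 9 * C_drift\<^sup>2 * h\<^sup>2 * (1 + ln (real M))\<^sup>2 * R \<omega> ^ 4" by (intro mult_left_mono R24) simp
    finally show "(norm A)\<^sup>2 \<le> 9 * C_drift\<^sup>2 * h\<^sup>2 * (1 + ln (real M))\<^sup>2 * R \<omega> ^ 4" .
    \<comment> \<open>Cauchy-Schwarz over the grid leaves one factor \<open>h\<close> in front of
      the sum of squares, which keeps the Gronwall factor bounded as the grid is refined.\<close>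
    have "(norm ?E)\<^sup>2 \<le> (\<Sum>k<m. h * c * ?e k)\<^sup>2"
      using E by (intro power_mono) (auto simp: mult.assoc)
    also have "\<dots> \<le> (\<Sum>k<m. (h * c)\<^sup>2) * (\<Sum>k<m. (?e k)\<^sup>2)" by (rule Cauchy_Schwarz_ineq_sum)
    also have "(\<Sum>k<m. (h * c)\<^sup>2) = ?t * (c\<^sup>2 * h)" by (simp add: power2_eq_square mult_ac)
    also have "?t * (c\<^sup>2 * h) * (\<Sum>k<m. (?e k)\<^sup>2) \<le> T * (c\<^sup>2 * h) * (\<Sum>k<m. (?e k)\<^sup>2)"
      using mT h by (intro mult_right_mono) (auto intro!: sum_nonneg)
    finally show "(norm ?E)\<^sup>2 \<le> c\<^sup>2 * T * h * (\<Sum>k<m. (?e k)\<^sup>2)" by (simp add: mult_ac)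
  qed auto
  finally have main: "(?e m)\<^sup>2 \<le> \<kappa>1 * R \<omega> ^ 4
      + 4 * (norm B)\<^sup>2 + 4 * c\<^sup>2 * T * h * (\<Sum>k<m. (?e k)\<^sup>2)"
    by (simp add: \<kappa>1_def algebra_simps)
  have nn: "0 \<le> \<kappa>1 * R \<omega> ^ 4"
    "0 \<le> 4 * c\<^sup>2 * T * h" "0 \<le> (\<Sum>k<m. (?e k)\<^sup>2)" "0 \<le> 4 * (norm B)\<^sup>2"
    using T h by (auto intro!: sum_nonneg simp: \<kappa>1_def)
  have "ennreal ((?e m)\<^sup>2) \<le> ennreal (\<kappa>1 * R \<omega> ^ 4
      + 4 * (norm B)\<^sup>2 + 4 * c\<^sup>2 * T * h * (\<Sum>k<m. (?e k)\<^sup>2))"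
    by (rule ennreal_leI[OF main])
  also have "\<dots> = ennreal (\<kappa>1 * R \<omega> ^ 4)
      + ennreal (4 * (norm B)\<^sup>2) + ennreal (4 * c\<^sup>2 * T * h * (\<Sum>k<m. (?e k)\<^sup>2))"
    by (simp only: ennreal_plus[OF add_nonneg_nonneg[OF nn(1,4)] mult_nonneg_nonneg[OF nn(2,3)]]
          ennreal_plus[OF nn(1,4)])
  also have "ennreal (4 * (norm B)\<^sup>2) = 4 * ennreal ((norm B)\<^sup>2)"
    by (subst ennreal_mult) auto
  also have "ennreal (4 * c\<^sup>2 * T * h * (\<Sum>k<m. (?e k)\<^sup>2)) = ennreal (4 * c\<^sup>2 * T * h) * (\<Sum>k<m. ennreal ((?e k)\<^sup>2))"
    by (subst ennreal_mult[OF nn(2,3)]) (simp add: sum_ennreal)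
  also have "ennreal (\<kappa>1 * R \<omega> ^ 4)
      + 4 * ennreal ((norm B)\<^sup>2) + ennreal (4 * c\<^sup>2 * T * h) * (\<Sum>k<m. ennreal ((?e k)\<^sup>2))
    \<le> ennreal (\<kappa>1 * R \<omega> ^ 4)
      + 4 * avg_err h m \<omega> + ennreal (4 * c\<^sup>2 * T * h) * (\<Sum>k<m. ennreal ((?e k)\<^sup>2))"
    by (rule add_right_mono[OF add_left_mono[OF mult_left_mono[OF B zero_le]]])
  finally show ?thesis .
qed

text \<open>\<open>measurable_drift\<close> needs values in \<open>D(1/2)\<close>, so membership is
  carried along in the induction.\<close>

lemma scheme_meas:
  assumes h: "0 < h" and MT: "real M * h = T"
    and Y0: "\<And>\<omega>. \<omega> \<in> space P \<Longrightarrow> Y 0 \<omega> = proj e N (\<xi> \<omega>) + proj e N (Z 0 \<omega>)"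
    and YSuc: "\<And>k \<omega>. k < M \<Longrightarrow> \<omega> \<in> space P \<Longrightarrow> Y (Suc k) \<omega> = S h (Y k \<omega> + h *\<^sub>R proj e N (drift (Y k \<omega>)))
      + proj e N (Z (real (Suc k) * h) \<omega> - S h (Z (real k * h) \<omega>))"
    and \<xi>: "\<xi> \<in> borel_measurable P" and "m \<le> M"
  shows "Y m \<in> borel_measurable P \<and> (\<forall>\<omega>\<in>space P. Y m \<omega> \<in> D (1/2))"
  using \<open>m \<le> M\<close>
proof (induction m)
  case 0
  have [measurable]: "Z 0 \<in> borel_measurable P" using Z_measP[of 0] T by simp
  have "(\<lambda>\<omega>. proj e N (\<xi> \<omega>) + proj e N (Z 0 \<omega>)) \<in> borel_measurable P" using \<xi> by measurable
  then show ?case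
    using Y0 by (subst measurable_cong[OF Y0]) (auto intro: frac_dom_add proj_in_frac_dom)
next
  case (Suc k)
  then have IH: "Y k \<in> borel_measurable P" "\<And>\<omega>. \<omega> \<in> space P \<Longrightarrow> Y k \<omega> \<in> D (1/2)" and k: "k < M" by auto
  have "real (Suc k) * h \<le> T" unfolding MT[symmetric] using k h by (intro mult_right_mono) auto
  moreover have "real (Suc k) * h = real k * h + h" by (simp add: algebra_simps)
  ultimately have kT: "real (Suc k) * h \<in> {0..T}" "real k * h \<in> {0..T}" using h by auto
  note [measurable] = Z_measP[OF kT(1)] Z_measP[OF kT(2)] IH(1) measurable_drift[OF IH]
  have [measurable]: "S h \<in> borel_measurable borel" using h by (intro measurable_S) simp
  have "(\<lambda>\<omega>. S h (Y k \<omega> + h *\<^sub>R proj e N (drift (Y k \<omega>)))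
      + proj e N (Z (real (Suc k) * h) \<omega> - S h (Z (real k * h) \<omega>))) \<in> borel_measurable P"
    by measurable
  then have "Y (Suc k) \<in> borel_measurable P"
    using measurable_cong[OF YSuc[OF k], of P "\<lambda>\<omega>. \<omega>"] by simp
  moreover have "Y (Suc k) \<omega> \<in> D (1/2)" if "\<omega> \<in> space P" for \<omega>
    unfolding YSuc[OF k that] using h IH(2)[OF that]
    by (intro frac_dom_add(1) frac_dom_S(1) frac_dom_scaleR(1) proj_in_frac_dom) auto
  ultimately show ?case by blast
qed

lemma strong_rate:
  assumes N: "1 \<le> N" and M: "1 \<le> M" and m: "m \<le> M" and h: "h = T / real M"
    and Y0: "\<And>\<omega>. \<omega> \<in> space P \<Longrightarrow> Y 0 \<omega> = proj e N (\<xi> \<omega>) + proj e N (Z 0 \<omega>)"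
    and YSuc: "\<And>k \<omega>. k < M \<Longrightarrow> \<omega> \<in> space P \<Longrightarrow> Y (Suc k) \<omega> = S h (Y k \<omega> + h *\<^sub>R proj e N (drift (Y k \<omega>)))
      + proj e N (Z (real (Suc k) * h) \<omega> - S h (Z (real k * h) \<omega>))"
    and \<xi>: "\<xi> \<in> borel_measurable P"
  shows "integrable P (\<lambda>\<omega>. (norm (X (real m * h) \<omega> - Y m \<omega>))\<^sup>2)"
    "sqrt (expectation (\<lambda>\<omega>. (norm (X (real m * h) \<omega> - Y m \<omega>))\<^sup>2))
      \<le> C_rate * (1 / lam N powr \<gamma> + (1 + ln (real M)) / real M powr (2 * \<theta>))"
proof -
  have M0: "0 < real M" using M by simp
  have h0: "0 < h" and MT: "real M * h = T" and hT: "h \<le> T"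
    using T M0 M by (auto simp: h field_simps)
  have kT: "real k * h \<in> {0..T}" if "k \<le> M" for k
    unfolding MT[symmetric] using that h0 by (auto intro: mult_right_mono)
  define L where "L = 1 + ln (real M)"
  have L: "1 \<le> L" using M by (simp add: L_def)
  define E where "E = 1 / lam N powr \<gamma> + L / real M powr (2 * \<theta>)"
  have lamN: "0 < lam N" using N by (rule lam_pos)
  have E0: "0 \<le> E" using L by (simp add: E_def)
  define \<kappa>1 where "\<kappa>1 = 4 * (C_frac\<^sup>2 * (lam N powr (-\<gamma>))\<^sup>2 + 9 * C_drift\<^sup>2 * h\<^sup>2 * L\<^sup>2)"
  define \<kappa> where "\<kappa> = \<kappa>1 * M4 + 4 * (C_L * h powr (4 * \<theta>))"
  have \<kappa>1: "0 \<le> \<kappa>1" by (simp add: \<kappa>1_def)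
  have \<kappa>0: "0 \<le> \<kappa>" unfolding \<kappa>_def using \<kappa>1 M4_nonneg C_L_nonneg by simp
  define q where "q = 4 * c\<^sup>2 * T * h"
  have q: "0 \<le> q" using T h0 by (simp add: q_def)
  define a where "a k = (\<integral>\<^sup>+\<omega>. ennreal ((norm (X (real k * h) \<omega> - Y k \<omega>))\<^sup>2) \<partial>P)" for k
  have em: "(\<lambda>\<omega>. (norm (X (real k * h) \<omega> - Y k \<omega>))\<^sup>2) \<in> borel_measurable P" if "k \<le> M" for k
  proof -
    have [measurable]: "X (real k * h) \<in> borel_measurable P" by (rule X_measP[OF kT[OF that]])
    have [measurable]: "Y k \<in> borel_measurable P"
      using scheme_meas[OF h0 MT Y0 YSuc \<xi> that] by blast
    show ?thesis by measurable
  qed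
  have "a k \<le> ennreal \<kappa> + ennreal q * (\<Sum>i<k. a i)" if k: "k \<le> M" for k
  proof -
    have km: "real k * h \<le> T" using kT[OF k] by simp
    note avg = avg_err_moment[OF h0 hT km]
    have em': "(\<lambda>\<omega>. ennreal ((norm (X (real i * h) \<omega> - Y i \<omega>))\<^sup>2)) \<in> borel_measurable P" if "i \<in> {..<k}" for i
      using em[of i] that k by (intro measurable_compose[OF _ measurable_ennreal]) auto
    have sm: "(\<lambda>\<omega>. \<Sum>i<k. ennreal ((norm (X (real i * h) \<omega> - Y i \<omega>))\<^sup>2)) \<in> borel_measurable P"
      by (rule borel_measurable_sum[OF em'])
    have Rm: "(\<lambda>\<omega>. ennreal (\<kappa>1 * R \<omega> ^ 4)) \<in> borel_measurable P" using R_meas by measurable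
    have "a k \<le> (\<integral>\<^sup>+\<omega>. (ennreal (\<kappa>1 * R \<omega> ^ 4) + 4 * avg_err h k \<omega>)
        + ennreal q * (\<Sum>i<k. ennreal ((norm (X (real i * h) \<omega> - Y i \<omega>))\<^sup>2)) \<partial>P)"
      unfolding a_def \<kappa>1_def q_def L_def
      by (intro nn_integral_mono scheme_pathwise[OF _ N h0 k MT Y0 YSuc M])
    also have "\<dots> = (\<integral>\<^sup>+\<omega>. ennreal (\<kappa>1 * R \<omega> ^ 4) \<partial>P) + 4 * (\<integral>\<^sup>+\<omega>. avg_err h k \<omega> \<partial>P) + ennreal q * (\<Sum>i<k. a i)"
    proof -
      note [measurable] = Rm avg(1) sm
      have "(\<integral>\<^sup>+\<omega>. (ennreal (\<kappa>1 * R \<omega> ^ 4) + 4 * avg_err h k \<omega>)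
        + ennreal q * (\<Sum>i<k. ennreal ((norm (X (real i * h) \<omega> - Y i \<omega>))\<^sup>2)) \<partial>P)
        = (\<integral>\<^sup>+\<omega>. ennreal (\<kappa>1 * R \<omega> ^ 4) + 4 * avg_err h k \<omega> \<partial>P)
        + (\<integral>\<^sup>+\<omega>. ennreal q * (\<Sum>i<k. ennreal ((norm (X (real i * h) \<omega> - Y i \<omega>))\<^sup>2)) \<partial>P)"
        by (rule nn_integral_add; measurable)
      also have "(\<integral>\<^sup>+\<omega>. ennreal (\<kappa>1 * R \<omega> ^ 4) + 4 * avg_err h k \<omega> \<partial>P)
        = (\<integral>\<^sup>+\<omega>. ennreal (\<kappa>1 * R \<omega> ^ 4) \<partial>P) + (\<integral>\<^sup>+\<omega>. 4 * avg_err h k \<omega> \<partial>P)"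
        by (rule nn_integral_add; measurable)
      also have "(\<integral>\<^sup>+\<omega>. 4 * avg_err h k \<omega> \<partial>P) = 4 * (\<integral>\<^sup>+\<omega>. avg_err h k \<omega> \<partial>P)"
        by (rule nn_integral_cmult[OF avg(1)])
      also have "(\<integral>\<^sup>+\<omega>. ennreal q * (\<Sum>i<k. ennreal ((norm (X (real i * h) \<omega> - Y i \<omega>))\<^sup>2)) \<partial>P)
        = ennreal q * (\<Sum>i<k. a i)"
        unfolding a_def by (subst nn_integral_cmult[OF sm], subst nn_integral_sum[OF em']) auto
      finally show ?thesis .
    qed
    also have "(\<integral>\<^sup>+\<omega>. ennreal (\<kappa>1 * R \<omega> ^ 4) \<partial>P) = ennreal (\<kappa>1 * M4)"
    proof -
      have "AE \<omega> in P. 0 \<le> \<kappa>1 * R \<omega> ^ 4"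
        using \<kappa>1 R_ge_1 by (intro AE_I2 mult_nonneg_nonneg) auto
      then have "(\<integral>\<^sup>+\<omega>. ennreal (\<kappa>1 * R \<omega> ^ 4) \<partial>P) = ennreal (expectation (\<lambda>\<omega>. \<kappa>1 * R \<omega> ^ 4))"
        by (intro nn_integral_eq_integral integrable_mult_right R_int)
      then show ?thesis by (simp add: M4_def)
    qed
    also have "4 * (\<integral>\<^sup>+\<omega>. avg_err h k \<omega> \<partial>P) \<le> 4 * ennreal (C_L * h powr (4 * \<theta>))"
      by (rule mult_left_mono[OF avg(2)]) simp
    also have "4 * ennreal (C_L * h powr (4 * \<theta>)) = ennreal (4 * (C_L * h powr (4 * \<theta>)))"
      using C_L_nonneg by (subst ennreal_mult[of 4 "C_L * h powr (4 * \<theta>)"]) auto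
    also have "ennreal (\<kappa>1 * M4) + ennreal (4 * (C_L * h powr (4 * \<theta>))) = ennreal \<kappa>"
      unfolding \<kappa>_def using \<kappa>1 M4_nonneg C_L_nonneg by (intro ennreal_plus[symmetric]) auto
    finally show ?thesis by (simp add: add_right_mono)
  qed
  from discrete_gronwall[OF q \<kappa>0 this m]
  have am: "a m \<le> ennreal (\<kappa> * (1 + q) ^ m)" .
  have \<kappa>E: "\<kappa> \<le> C_final * E\<^sup>2"
  proof -
    have l: "(lam N powr (-\<gamma>))\<^sup>2 \<le> E\<^sup>2"
      using L lamN by (intro power_mono) (auto simp: E_def powr_minus_divide)
    have LE: "L / real M powr (2 * \<theta>) \<le> E" by (simp add: E_def)
    \<comment> \<open>Since \<open>2 * \<theta> \<le> 1\<close>, the quadrature error of order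
      \<open>h * L\<close> is no worse than the claimed rate.\<close>
    have M1: "real M powr (2 * \<theta>) \<le> real M" using powr_mono[of "2 * \<theta>" 1 "real M"] \<theta> M by simp
    have "h * L \<le> T * (L / real M powr (2 * \<theta>))"
      using M1 M0 T L by (auto simp: h intro!: divide_left_mono mult_pos_pos)
    also have "\<dots> \<le> T * E" using LE T by (intro mult_left_mono) auto
    finally have "(h * L)\<^sup>2 \<le> (T * E)\<^sup>2" using h0 L by (intro power_mono) auto
    then have hL: "h\<^sup>2 * L\<^sup>2 \<le> T\<^sup>2 * E\<^sup>2" by (simp add: power_mult_distrib)
    have "1 / real M powr (2 * \<theta>) \<le> L / real M powr (2 * \<theta>)" using L by (intro divide_right_mono) auto
    then have "(1 / real M powr (2 * \<theta>))\<^sup>2 \<le> E\<^sup>2" using LE by (intro power_mono) auto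
    moreover have "h powr (4 * \<theta>) = T powr (4 * \<theta>) * (1 / real M powr (2 * \<theta>))\<^sup>2"
      using T M0 powr_sq[of "real M" "2 * \<theta>"] by (simp add: h powr_divide power_divide)
    ultimately have h4: "h powr (4 * \<theta>) \<le> T powr (4 * \<theta>) * E\<^sup>2" by (simp add: mult_left_mono)
    have "\<kappa> = 4 * (C_frac\<^sup>2 * (lam N powr (-\<gamma>))\<^sup>2 + 9 * C_drift\<^sup>2 * (h\<^sup>2 * L\<^sup>2)) * M4 + 4 * C_L * h powr (4 * \<theta>)"
      by (simp add: \<kappa>_def \<kappa>1_def mult.assoc)
    also have "\<dots> \<le> 4 * (C_frac\<^sup>2 * E\<^sup>2 + 9 * C_drift\<^sup>2 * (T\<^sup>2 * E\<^sup>2)) * M4 + 4 * C_L * (T powr (4 * \<theta>) * E\<^sup>2)"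
      using l hL h4 M4_nonneg C_L_nonneg
      by (intro add_mono mult_right_mono mult_left_mono) auto
    also have "\<dots> = C_final * E\<^sup>2" by (simp add: C_final_def algebra_simps)
    finally show ?thesis .
  qed
  \<comment> \<open>As \<open>q\<close> is proportional to \<open>h\<close> and
    \<open>m * h \<le> T\<close>, the Gronwall factor is bounded independently of the grid.\<close>
  have "(1 + q) ^ m \<le> exp q ^ m" using q exp_ge_add_one_self[of q] by (intro power_mono) auto
  also have "\<dots> = exp (real m * q)" by (simp add: exp_of_nat_mult)
  also have "\<dots> \<le> exp (4 * c\<^sup>2 * T\<^sup>2)"
  proof -
    have "real m * q = (real m * h) * (4 * c\<^sup>2 * T)" by (simp add: q_def)
    also have "\<dots> \<le> T * (4 * c\<^sup>2 * T)" using kT[OF m] T by (intro mult_right_mono) auto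
    finally show ?thesis by (simp add: power2_eq_square mult_ac)
  qed
  finally have "\<kappa> * (1 + q) ^ m \<le> (C_final * E\<^sup>2) * exp (4 * c\<^sup>2 * T\<^sup>2)"
    using \<kappa>E \<kappa>0 C_final_nonneg q by (intro mult_mono) auto
  then have am': "a m \<le> ennreal (C_final * exp (4 * c\<^sup>2 * T\<^sup>2) * E\<^sup>2)"
    using am by (auto intro: order_trans ennreal_leI simp: mult_ac)
  note r = integrable_expectation_leI[OF em[OF m] _ am'[unfolded a_def]]
  show "integrable P (\<lambda>\<omega>. (norm (X (real m * h) \<omega> - Y m \<omega>))\<^sup>2)"
    by (rule r(1)) (use C_final_nonneg in auto)
  have "sqrt (expectation (\<lambda>\<omega>. (norm (X (real m * h) \<omega> - Y m \<omega>))\<^sup>2)) \<le> sqrt (C_final * exp (4 * c\<^sup>2 * T\<^sup>2) * E\<^sup>2)"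
    by (rule real_sqrt_le_mono[OF r(2)]) (use C_final_nonneg in auto)
  also have "\<dots> = sqrt (C_final * exp (4 * c\<^sup>2 * T\<^sup>2)) * E" using E0 by (simp add: real_sqrt_mult)
  also have "\<dots> \<le> C_rate * E" unfolding C_rate_def using E0 by (intro mult_right_mono) auto
  finally show "sqrt (expectation (\<lambda>\<omega>. (norm (X (real m * h) \<omega> - Y m \<omega>))\<^sup>2))
      \<le> C_rate * (1 / lam N powr \<gamma> + (1 + ln (real M)) / real M powr (2 * \<theta>))"
    by (simp only: E_def L_def)
qed

lemma C_rate_pos: "0 < C_rate"
  unfolding C_rate_def using C_final_nonneg by (simp add: add_nonneg_pos)

end

text \<open>Independence is assumed for the sigma-algebra that \<open>W\<close> generates from the
  Borel sets of \<open>D r\<close>. Coordinates are measurable with respect to it, so they generate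
  smaller sigma-algebras, which inherit independence.\<close>

lemma (in spectral_basis) indep_coord:
  fixes P :: "'w measure" and G :: "'w measure" and W :: "'w \<Rightarrow> 'h" and \<psi> :: "'w \<Rightarrow> real"
  assumes P: "prob_space P" and G: "subalgebra P G" and r: "0 \<le> r"
    and W: "W \<in> borel_measurable P" "\<And>\<omega>. \<omega> \<in> space P \<Longrightarrow> W \<omega> \<in> D r"
    and \<psi>: "\<psi> \<in> borel_measurable G"
    and indep: "prob_space.indep_set P (sets (vimage_algebra (space P) W (frac_borel lam e r))) (sets G)"
  shows "prob_space.indep_var P borel \<psi> borel (\<lambda>\<omega>. bv n \<bullet> W \<omega>)"
proof -
  interpret prob_space P by (rule P)
  have sp: "space G = space P" using G by (simp add: subalgebra_def)
  have \<psi>P: "\<psi> \<in> borel_measurable P" by (rule measurable_from_subalg[OF G \<psi>])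
  have WP: "(\<lambda>\<omega>. bv n \<bullet> W \<omega>) \<in> borel_measurable P" using W(1) by measurable
  let ?V = "vimage_algebra (space P) W (frac_borel lam e r)"
  have "W \<in> ?V \<rightarrow>\<^sub>M frac_borel lam e r"
    by (rule measurable_vimage_algebra1) (use W(2) in \<open>auto simp: space_frac_borel\<close>)
  then have "W \<in> borel_measurable ?V" by (rule measurable_frac_borelD(1)[OF _ r])
  then have WV: "(\<lambda>\<omega>. bv n \<bullet> W \<omega>) \<in> borel_measurable ?V" by measurable
  have A: "sigma_sets (space P) {\<psi> -` A \<inter> space P | A. A \<in> sets borel} \<subseteq> sets G"
  proof -
    have "{\<psi> -` A \<inter> space P | A. A \<in> sets borel} \<subseteq> sets G"
      using measurable_sets[OF \<psi>] by (auto simp: sp)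
    from sets.sigma_sets_subset[OF this] show ?thesis by (simp add: sp)
  qed
  have B: "sigma_sets (space P) {(\<lambda>\<omega>. bv n \<bullet> W \<omega>) -` A \<inter> space P | A. A \<in> sets borel} \<subseteq> sets ?V"
  proof -
    have "{(\<lambda>\<omega>. bv n \<bullet> W \<omega>) -` A \<inter> space P | A. A \<in> sets borel} \<subseteq> sets ?V"
      using measurable_sets[OF WV] by (auto simp: space_vimage_algebra)
    from sets.sigma_sets_subset[OF this] show ?thesis by (simp add: space_vimage_algebra)
  qed
  show ?thesis
    unfolding indep_var_eq indep_sets2_eq
  proof (intro conjI ballI \<psi>P WP)
    fix a b
    assume "a \<in> sigma_sets (space P) {\<psi> -` A \<inter> space P | A. A \<in> sets borel}"
      and "b \<in> sigma_sets (space P) {(\<lambda>\<omega>. bv n \<bullet> W \<omega>) -` A \<inter> space P | A. A \<in> sets borel}"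
    then have "a \<in> sets G" "b \<in> sets ?V" using A B by auto
    then have "prob (b \<inter> a) = prob b * prob a"
      using indep unfolding indep_sets2_eq by blast
    then show "prob (a \<inter> b) = prob a * prob b" by (simp add: Int_commute mult.commute)
  qed (use A B indep in \<open>auto simp: indep_sets2_eq\<close>)
qed

lemma power4_sum3_le: "(a + b + d) ^ 4 \<le> 27 * (a ^ 4 + b ^ 4 + d ^ 4)" for a b d :: real
proof -
  have "(a + b + d) ^ 4 = ((a + b + d)\<^sup>2)\<^sup>2" by simp
  also have "\<dots> \<le> (3 * a\<^sup>2 + 3 * b\<^sup>2 + 3 * d\<^sup>2)\<^sup>2" by (intro power_mono power2_sum3_le) simp
  also have "\<dots> \<le> 3 * (3 * a\<^sup>2)\<^sup>2 + 3 * (3 * b\<^sup>2)\<^sup>2 + 3 * (3 * d\<^sup>2)\<^sup>2" by (rule power2_sum3_le)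
  also have "\<dots> = 27 * (a ^ 4 + b ^ 4 + d ^ 4)" by (simp add: power_mult_distrib)
  finally show ?thesis .
qed

text \<open>Sample paths are continuous, so the supremum over a countable dense set of times is a
  measurable bound for the whole path.\<close>

lemma (in spectral_basis) measurable_path_bound:
  fixes P :: "'w measure" and Z :: "real \<Rightarrow> 'w \<Rightarrow> 'h"
  assumes T: "0 < T" and Zm: "\<And>t. t \<in> {0..T} \<Longrightarrow> Z t \<in> borel_measurable P"
    and ZD: "\<And>t \<omega>. t \<in> {0..T} \<Longrightarrow> \<omega> \<in> space P \<Longrightarrow> Z t \<omega> \<in> D r"
    and Zc: "\<And>\<omega>. \<omega> \<in> space P \<Longrightarrow> continuous_on {0..T} (\<lambda>t. fpow r (Z t \<omega>))"
  obtains \<rho> where "\<rho> \<in> borel_measurable P"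
    "\<And>t \<omega>. t \<in> {0..T} \<Longrightarrow> \<omega> \<in> space P \<Longrightarrow> fnorm r (Z t \<omega>) \<le> \<rho> \<omega>"
    "\<And>\<omega>. \<omega> \<in> space P \<Longrightarrow> \<exists>t\<in>{0..T}. \<rho> \<omega> \<le> fnorm r (Z t \<omega>)"
proof -
  obtain Q where Q: "countable Q" "Q \<subseteq> {0..T}" "{0..T} \<subseteq> closure Q" by (rule separable)
  have clQ: "closure Q = {0..T}" using Q closure_minimal[OF Q(2)] by auto
  have Q0: "Q \<noteq> {}" using clQ T by auto
  define \<rho> where "\<rho> \<omega> = (SUP t\<in>Q. fnorm r (Z t \<omega>))" for \<omega>
  have c: "continuous_on {0..T} (\<lambda>t. fnorm r (Z t \<omega>))" if "\<omega> \<in> space P" for \<omega>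
    unfolding frac_norm_def by (intro continuous_on_norm Zc that)
  have att: "\<exists>t\<in>{0..T}. \<forall>s\<in>{0..T}. fnorm r (Z s \<omega>) \<le> fnorm r (Z t \<omega>)" if "\<omega> \<in> space P" for \<omega>
    by (rule continuous_attains_sup[OF compact_Icc _ c[OF that]]) (use T in auto)
  have bdd: "bdd_above ((\<lambda>t. fnorm r (Z t \<omega>)) ` Q)" if "\<omega> \<in> space P" for \<omega>
    using att[OF that] Q(2) by (auto simp: bdd_above_def)
  show thesis
  proof
    show "\<rho> \<in> borel_measurable P"
      unfolding \<rho>_def
    proof (rule borel_measurable_cSUP[OF Q(1) _ bdd])
      fix t assume "t \<in> Q"
      then have "t \<in> {0..T}" using Q(2) by blast
      then show "(\<lambda>\<omega>. fnorm r (Z t \<omega>)) \<in> borel_measurable P"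
        by (intro measurable_fnorm Zm ZD)
    qed
    show "fnorm r (Z t \<omega>) \<le> \<rho> \<omega>" if t: "t \<in> {0..T}" and \<omega>: "\<omega> \<in> space P" for t \<omega>
    proof (rule continuous_le_on_closure[where S = Q and f = "\<lambda>t. fnorm r (Z t \<omega>)"])
      show "continuous_on (closure Q) (\<lambda>t. fnorm r (Z t \<omega>))" using c[OF \<omega>] clQ by simp
      show "t \<in> closure Q" using t clQ by simp
      fix s assume "s \<in> Q"
      then show "fnorm r (Z s \<omega>) \<le> \<rho> \<omega>" unfolding \<rho>_def by (rule cSUP_upper[OF _ bdd[OF \<omega>]])
    qed
    \<comment> \<open>The maximum along the path is attained, so \<rho> never exceeds the supremum
      in the moment hypothesis.\<close>
    show "\<exists>t\<in>{0..T}. \<rho> \<omega> \<le> fnorm r (Z t \<omega>)" if \<omega>: "\<omega> \<in> space P" for \<omega>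
    proof -
      obtain t where t: "t \<in> {0..T}" "\<forall>s\<in>{0..T}. fnorm r (Z s \<omega>) \<le> fnorm r (Z t \<omega>)"
        using att[OF \<omega>] by blast
      have "\<rho> \<omega> \<le> fnorm r (Z t \<omega>)"
        unfolding \<rho>_def by (rule cSUP_least[OF Q0]) (use t(2) Q(2) in blast)
      then show ?thesis using t(1) by blast
    qed
  qed
qed

theorem theorem1:
  fixes P :: "'w measure"
    and Filt :: "real \<Rightarrow> 'w measure"
    and j :: "'v::{banach, second_countable_topology} \<Rightarrow>
              'h::{real_inner, banach, second_countable_topology}"
    and lam :: "nat \<Rightarrow> real" and e :: "nat \<Rightarrow> 'h"
    and F :: "'v \<Rightarrow> 'v" and F' :: "'v \<Rightarrow> 'v \<Rightarrow>\<^sub>L 'v" and F'' :: "'v \<Rightarrow> 'v \<Rightarrow>\<^sub>L 'v \<Rightarrow>\<^sub>L 'v"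
    and Z :: "real \<Rightarrow> 'w \<Rightarrow> 'h" and \<xi> :: "'w \<Rightarrow> 'h"
    and X :: "real \<Rightarrow> 'w \<Rightarrow> 'h" and Y :: "nat \<Rightarrow> nat \<Rightarrow> nat \<Rightarrow> 'w \<Rightarrow> 'h"
    and T c \<gamma> \<theta> :: real
  assumes T: "T > 0"
    and P: "prob_space P"
    and Filt: "normal_filtration P T Filt"
    and j: "bounded_linear j" "inj j"
    and lam: "\<forall>n\<ge>1. lam n > 0" "mono_on {1..} lam"
    and e: "orthonormal_basis e"
    and dom_half_V: "\<exists>K. \<forall>u\<in>frac_dom lam e (1/2).
          u \<in> range j \<and> norm (inv j u) \<le> K * frac_norm lam e (1/2) u"
    and F': "\<forall>v. (F has_derivative blinfun_apply (F' v)) (at v)"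
    and F'': "\<forall>v. (F' has_derivative blinfun_apply (F'' v)) (at v)" "continuous_on UNIV F''"
    and c: "c \<ge> 0"
    and F'_H: "\<forall>v w. norm (j (F' v w)) \<le> c * norm (j w)"
    and F'_V: "\<forall>v. norm (F' v) \<le> c"
    and F''_V: "\<forall>v. norm (F'' v) \<le> c"
    and F'_adjoint: "\<forall>u\<in>frac_dom lam e (1/2). \<forall>v\<in>frac_dom lam e (1/2).
          adjoint (H_extension j (F' (inv j u))) v \<in> frac_dom lam e (1/2) \<and>
          frac_norm lam e (1/2) (adjoint (H_extension j (F' (inv j u))) v)
            \<le> c * (1 + frac_norm lam e (1/2) u) * frac_norm lam e (1/2) v"
    and \<gamma>: "1/2 \<le> \<gamma>" "\<gamma> < 1"
    and \<theta>: "0 < \<theta>" "\<theta> \<le> 1/2"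
    and Z: "adapted_continuous lam e \<gamma> P T Filt Z"
    and Z_centered: "\<forall>t\<in>{0..T}. has_bochner_integral P (Z t) 0"
    and Z_indep: "\<forall>t1 t2. 0 \<le> t1 \<and> t1 < t2 \<and> t2 \<le> T \<longrightarrow>
          prob_space.indep_set P
            (sets (vimage_algebra (space P)
               (\<lambda>\<omega>. Z t2 \<omega> - semigrp lam e (t2 - t1) (Z t1 \<omega>)) (frac_borel lam e \<gamma>)))
            (sets (Filt t1))"
    and Z_moments:
          "(\<integral>\<^sup>+\<omega>. (SUP t\<in>{0..T}. ennreal (norm (frac_pow lam e \<gamma> (Z t \<omega>)) ^ 4)) \<partial>P) +
           (SUP (t1, t2)\<in>{(t1, t2). 0 \<le> t1 \<and> t1 < t2 \<and> t2 \<le> T}.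
              ennreal ((t2 - t1) powr (- 4 * \<theta>)) *
              (\<integral>\<^sup>+\<omega>. ennreal (norm (inv j (Z t2 \<omega> - Z t1 \<omega>)) ^ 4) \<partial>P)) < \<infinity>"
    and \<xi>: "\<xi> \<in> Filt 0 \<rightarrow>\<^sub>M frac_borel lam e 1"
    and \<xi>_moment: "(\<integral>\<^sup>+\<omega>. ennreal (norm (gen lam e (\<xi> \<omega>)) ^ 4) \<partial>P) < \<infinity>"
    and X: "adapted_continuous lam e \<gamma> P T Filt X"
    and X_eq: "\<forall>t\<in>{0..T}. \<forall>\<omega>\<in>space P.
          X t \<omega> = semigrp lam e t (\<xi> \<omega>) +
            (LINT s:{0..t}|lborel. semigrp lam e (t - s) (j (F (inv j (X s \<omega>))))) + Z t \<omega>"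
    and Y_0: "\<forall>N\<ge>1. \<forall>M\<ge>1. \<forall>\<omega>\<in>space P.
          Y N M 0 \<omega> = proj e N (\<xi> \<omega>) + proj e N (Z 0 \<omega>)"
    and Y_Suc: "\<forall>N\<ge>1. \<forall>M\<ge>1. \<forall>m<M. \<forall>\<omega>\<in>space P.
          Y N M (Suc m) \<omega> =
            semigrp lam e (T / real M)
              (Y N M m \<omega> + (T / real M) *\<^sub>R proj e N (j (F (inv j (Y N M m \<omega>))))) +
            proj e N (Z (real (m + 1) * T / real M) \<omega>
                      - semigrp lam e (T / real M) (Z (real m * T / real M) \<omega>))"
  shows "\<exists>C>0. \<forall>N\<ge>1. \<forall>M\<ge>1. \<forall>m\<le>M.
           integrable P (\<lambda>\<omega>. (norm (X (real m * T / real M) \<omega> - Y N M m \<omega>))\<^sup>2) \<and>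
           sqrt (prob_space.expectation P (\<lambda>\<omega>. (norm (X (real m * T / real M) \<omega> - Y N M m \<omega>))\<^sup>2))
             \<le> C * (1 / lam N powr \<gamma> + (1 + ln (real M)) / real M powr (2 * \<theta>))"
proof -
  interpret P: prob_space P by (rule P)
  interpret spectral_basis lam e
    using lam e by unfold_locales blast+
  from dom_half_V obtain K0 where K0: "\<forall>u\<in>D (1/2). u \<in> range j \<and> norm (inv j u) \<le> K0 * fnorm (1/2) u" ..
  \<comment> \<open>The embedding constant is given without a sign.\<close>
  define K where "K = max K0 0"
  have K: "u \<in> range j \<and> norm (inv j u) \<le> K * fnorm (1/2) u" if "u \<in> D (1/2)" for u
  proof -
    have "K0 * fnorm (1/2) u \<le> K * fnorm (1/2) u" by (intro mult_right_mono) (auto simp: K_def)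
    then show ?thesis using K0 that by force
  qed
  interpret mild_setting lam e j F F' F'' c K T \<gamma>
  proof (intro mild_setting.intro nemytskii.intro spectral_basis_axioms nemytskii_axioms.intro
      mild_setting_axioms.intro)
    show "0 \<le> K" by (simp add: K_def)
    show "u \<in> range j \<and> norm (inv j u) \<le> K * fnorm (1/2) u" if "u \<in> D (1/2)" for u
      by (rule K[OF that])
    show "(F has_derivative blinfun_apply (F' v)) (at v)"
      "(F' has_derivative blinfun_apply (F'' v)) (at v)" for v
      using F' F'' by blast+
    show "norm (j (F' v w)) \<le> c * norm (j w)" "norm (F'' v) \<le> c" for v w
      using F'_H F''_V by blast+
    show "adjoint (H_extension j (F' (inv j u))) v \<in> D (1/2) \<and>
        fnorm (1/2) (adjoint (H_extension j (F' (inv j u))) v) \<le> c * (1 + fnorm (1/2) u) * fnorm (1/2) v"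
      if "u \<in> D (1/2)" "v \<in> D (1/2)" for u v
      using F'_adjoint that by blast
  qed (fact j c T \<gamma>)+
  have \<gamma>0: "0 \<le> \<gamma>" using \<gamma> by simp
  have sub: "subalgebra P (Filt t)" if "t \<in> {0..T}" for t
    using Filt that by (simp add: normal_filtration_def)
  have spF: "space (Filt t) = space P" if "t \<in> {0..T}" for t
    using sub[OF that] by (simp add: subalgebra_def)
  have Filt_mono: "sets (Filt s) \<subseteq> sets (Filt t)" if "0 \<le> s" "s \<le> t" "t \<le> T" for s t
    using Filt that by (simp add: normal_filtration_def)
  have T0: "0 \<in> {0..T}" using T by simp
  have Zm: "Z t \<in> borel_measurable (Filt t)" and Xm: "X t \<in> borel_measurable (Filt t)" if "t \<in> {0..T}" for t
    using Z X that measurable_frac_borelD(1)[OF _ \<gamma>0] unfolding adapted_continuous_def by blast+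
  have ZD: "Z t \<omega> \<in> D \<gamma>" and XD: "X t \<omega> \<in> D \<gamma>" if t: "t \<in> {0..T}" and \<omega>: "\<omega> \<in> space P" for t \<omega>
    using continuous_map_fracD(1)[OF _ t, of \<gamma>] Z X \<omega> unfolding adapted_continuous_def by blast+
  have Zc: "continuous_on {0..T} (\<lambda>t. fpow \<gamma> (Z t \<omega>))" and Xc: "continuous_on {0..T} (\<lambda>t. fpow \<gamma> (X t \<omega>))"
    if "\<omega> \<in> space P" for \<omega>
    using continuous_map_fracD(2) Z X that unfolding adapted_continuous_def by blast+
  have ZmP: "Z t \<in> borel_measurable P" if "t \<in> {0..T}" for t
    by (rule measurable_from_subalg[OF sub Zm]) (use that in auto)
  have \<xi>m0: "\<xi> \<in> borel_measurable (Filt 0)" and \<xi>D: "\<And>\<omega>. \<omega> \<in> space P \<Longrightarrow> \<xi> \<omega> \<in> D 1"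
    using measurable_frac_borelD[OF \<xi>] spF[OF T0] by auto
  have \<xi>m: "\<xi> \<in> borel_measurable P" by (rule measurable_from_subalg[OF sub[OF T0] \<xi>m0])
  obtain \<rho> where \<rho>m: "\<rho> \<in> borel_measurable P"
    and \<rho>: "\<And>t \<omega>. t \<in> {0..T} \<Longrightarrow> \<omega> \<in> space P \<Longrightarrow> fnorm \<gamma> (Z t \<omega>) \<le> \<rho> \<omega>"
    and \<rho>_att: "\<And>\<omega>. \<omega> \<in> space P \<Longrightarrow> \<exists>t\<in>{0..T}. \<rho> \<omega> \<le> fnorm \<gamma> (Z t \<omega>)"
    using measurable_path_bound[OF T ZmP ZD Zc] by blast
  have \<rho>0: "0 \<le> \<rho> \<omega>" if "\<omega> \<in> space P" for \<omega>
    using \<rho>[OF T0 that] fnorm_nonneg order_trans by blast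
  \<comment> \<open>The summand 1 lets lower powers of \<open>R\<close> be replaced by higher ones
    throughout.\<close>
  define R where "R \<omega> = 1 + fnorm 1 (\<xi> \<omega>) + \<rho> \<omega>" for \<omega>
  have \<xi>fm: "(\<lambda>\<omega>. fnorm 1 (\<xi> \<omega>)) \<in> borel_measurable P" by (rule measurable_fnorm[OF \<xi>m \<xi>D])
  have Rm: "R \<in> borel_measurable P" unfolding R_def using \<xi>fm \<rho>m by measurable
  let ?Zinc = "(SUP (t1, t2)\<in>{(t1, t2). 0 \<le> t1 \<and> t1 < t2 \<and> t2 \<le> T}.
              ennreal ((t2 - t1) powr (- 4 * \<theta>)) *
              (\<integral>\<^sup>+\<omega>. ennreal (norm (inv j (Z t2 \<omega> - Z t1 \<omega>)) ^ 4) \<partial>P))"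
  have fin1: "(\<integral>\<^sup>+\<omega>. (SUP t\<in>{0..T}. ennreal (norm (fpow \<gamma> (Z t \<omega>)) ^ 4)) \<partial>P) < \<infinity>"
    and fin2: "?Zinc < \<infinity>"
    by (rule le_less_trans[OF add_increasing2[OF zero_le order_refl] Z_moments],
        rule le_less_trans[OF add_increasing[OF zero_le order_refl] Z_moments])
  have \<rho>4: "integrable P (\<lambda>\<omega>. \<rho> \<omega> ^ 4)"
  proof (rule integrableI_nonneg)
    show "(\<lambda>\<omega>. \<rho> \<omega> ^ 4) \<in> borel_measurable P" using \<rho>m by measurable
    show "AE \<omega> in P. 0 \<le> \<rho> \<omega> ^ 4" by simp
    have "(\<integral>\<^sup>+\<omega>. ennreal (\<rho> \<omega> ^ 4) \<partial>P) \<le> (\<integral>\<^sup>+\<omega>. (SUP t\<in>{0..T}. ennreal (norm (fpow \<gamma> (Z t \<omega>)) ^ 4)) \<partial>P)"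
    proof (rule nn_integral_mono)
      fix \<omega> assume \<omega>: "\<omega> \<in> space P"
      obtain t where t: "t \<in> {0..T}" "\<rho> \<omega> \<le> fnorm \<gamma> (Z t \<omega>)" using \<rho>_att[OF \<omega>] by blast
      have "ennreal (\<rho> \<omega> ^ 4) \<le> ennreal (norm (fpow \<gamma> (Z t \<omega>)) ^ 4)"
        using t(2) \<rho>0[OF \<omega>] by (intro ennreal_leI power_mono) (auto simp: frac_norm_def)
      also have "\<dots> \<le> (SUP t\<in>{0..T}. ennreal (norm (fpow \<gamma> (Z t \<omega>)) ^ 4))"
        by (rule SUP_upper[OF t(1)])
      finally show "ennreal (\<rho> \<omega> ^ 4) \<le> (SUP t\<in>{0..T}. ennreal (norm (fpow \<gamma> (Z t \<omega>)) ^ 4))" .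
    qed
    then show "(\<integral>\<^sup>+\<omega>. ennreal (\<rho> \<omega> ^ 4) \<partial>P) < \<infinity>" using fin1 by (rule le_less_trans)
  qed
  have \<xi>4: "integrable P (\<lambda>\<omega>. fnorm 1 (\<xi> \<omega>) ^ 4)"
  proof (rule integrableI_nonneg)
    show "(\<lambda>\<omega>. fnorm 1 (\<xi> \<omega>) ^ 4) \<in> borel_measurable P" using \<xi>fm by measurable
    show "AE \<omega> in P. 0 \<le> fnorm 1 (\<xi> \<omega>) ^ 4" by simp
    have "(\<integral>\<^sup>+\<omega>. ennreal (fnorm 1 (\<xi> \<omega>) ^ 4) \<partial>P) = (\<integral>\<^sup>+\<omega>. ennreal (norm (gen lam e (\<xi> \<omega>)) ^ 4) \<partial>P)"
      by (intro nn_integral_cong) (simp add: norm_gen \<xi>D)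
    then show "(\<integral>\<^sup>+\<omega>. ennreal (fnorm 1 (\<xi> \<omega>) ^ 4) \<partial>P) < \<infinity>" using \<xi>_moment by simp
  qed
  have R4: "integrable P (\<lambda>\<omega>. R \<omega> ^ 4)"
  proof (rule P.integrable_expectation_le_mono(1))
    show "integrable P (\<lambda>\<omega>. 27 * (1 ^ 4 + fnorm 1 (\<xi> \<omega>) ^ 4 + \<rho> \<omega> ^ 4))"
      using \<rho>4 \<xi>4 by simp
    show "(\<lambda>\<omega>. R \<omega> ^ 4) \<in> borel_measurable P" using Rm by measurable
    show "0 \<le> R \<omega> ^ 4 \<and> R \<omega> ^ 4 \<le> 27 * (1 ^ 4 + fnorm 1 (\<xi> \<omega>) ^ 4 + \<rho> \<omega> ^ 4)" for \<omega>
      unfolding R_def using power4_sum3_le[of 1 "fnorm 1 (\<xi> \<omega>)" "\<rho> \<omega>"] by simp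
  qed
  \<comment> \<open>The supremum is finite by \<open>fin2\<close>, so nothing is lost in passing to
    a real number.\<close>
  define CZ where "CZ = enn2real ?Zinc"
  have Z_inc: "(\<integral>\<^sup>+\<omega>. ennreal (norm (inv j (Z t \<omega> - Z s \<omega>)) ^ 4) \<partial>P) \<le> ennreal (CZ * (t - s) powr (4 * \<theta>))"
    if st: "0 \<le> s" "s < t" "t \<le> T" for s t
  proof -
    let ?I = "\<integral>\<^sup>+\<omega>. ennreal (norm (inv j (Z t \<omega> - Z s \<omega>)) ^ 4) \<partial>P"
    have "ennreal ((t - s) powr (- 4 * \<theta>)) * ?I \<le> ennreal CZ"
    proof -
      have "ennreal ((t - s) powr (- 4 * \<theta>)) * ?I \<le> ?Zinc"
        by (rule SUP_upper2[where i = "(s, t)"]) (use st in auto)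
      also have "\<dots> = ennreal CZ" unfolding CZ_def using fin2 by (intro ennreal_enn2real[symmetric]) simp
      finally show ?thesis .
    qed
    \<comment> \<open>The negative power is moved to the other side by multiplying with its inverse,
      which is finite because \<open>s < t\<close>.\<close>
    then have "ennreal ((t - s) powr (4 * \<theta>)) * (ennreal ((t - s) powr (- 4 * \<theta>)) * ?I) \<le> ennreal ((t - s) powr (4 * \<theta>)) * ennreal CZ"
      by (rule mult_left_mono) simp
    moreover have "ennreal ((t - s) powr (4 * \<theta>)) * (ennreal ((t - s) powr (- 4 * \<theta>)) * ?I) = ?I"
    proof -
      have "(t - s) powr (4 * \<theta>) * (t - s) powr (- 4 * \<theta>) = 1"
        using st by (simp flip: powr_add)
      then have "ennreal ((t - s) powr (4 * \<theta>)) * ennreal ((t - s) powr (- 4 * \<theta>)) = 1"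
        by (subst ennreal_mult[symmetric]) auto
      then show ?thesis by (simp add: mult.assoc[symmetric])
    qed
    moreover have "ennreal ((t - s) powr (4 * \<theta>)) * ennreal CZ = ennreal (CZ * (t - s) powr (4 * \<theta>))"
      by (subst ennreal_mult[symmetric]) (auto simp: CZ_def mult.commute)
    ultimately show ?thesis by simp
  qed
  have path: "mild_path lam e j F F' F'' c K T \<gamma> (R \<omega>) (\<xi> \<omega>) (\<lambda>t. Z t \<omega>) (\<lambda>t. X t \<omega>)"
    if \<omega>: "\<omega> \<in> space P" for \<omega>
  proof (intro mild_path.intro mild_setting_axioms mild_path_axioms.intro)
    show "1 \<le> R \<omega>" using \<rho>0[OF \<omega>] by (simp add: R_def)
    show "\<xi> \<omega> \<in> D 1" by (rule \<xi>D[OF \<omega>])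
    show "fnorm 1 (\<xi> \<omega>) \<le> R \<omega>" using \<rho>0[OF \<omega>] by (simp add: R_def)
    show "continuous_on {0..T} (\<lambda>t. fpow \<gamma> (X t \<omega>))" by (rule Xc[OF \<omega>])
    fix t assume t: "t \<in> {0..T}"
    show "Z t \<omega> \<in> D \<gamma>" "X t \<omega> \<in> D \<gamma>" using ZD[OF t \<omega>] XD[OF t \<omega>] by auto
    show "fnorm \<gamma> (Z t \<omega>) \<le> R \<omega>" using \<rho>[OF t \<omega>] by (simp add: R_def add_increasing)
    have "continuous_on {0..T} (\<lambda>s. drift (X s \<omega>))"
      by (rule continuous_on_drift[OF Xc[OF \<omega>] XD[OF _ \<omega>] \<gamma>(1)])
    then have "continuous_on {0..t} (\<lambda>s. drift (X s \<omega>))"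
      by (rule continuous_on_subset) (use t in auto)
    \<comment> \<open>Continuity of the integrand identifies the Lebesgue integral of the hypothesis
      with the gauge integral used for paths.\<close>
    then have c: "continuous_on {0..t} (\<lambda>s. S (t - s) (drift (X s \<omega>)))"
      by (intro continuous_on_S_compose) (auto intro!: continuous_intros)
    have "X t \<omega> = S t (\<xi> \<omega>) + (LINT s:{0..t}|lborel. S (t - s) (drift (X s \<omega>))) + Z t \<omega>"
      using X_eq t \<omega> by (simp add: drift_def)
    then show "X t \<omega> = S t (\<xi> \<omega>) + integral {0..t} (\<lambda>s. S (t - s) (drift (X s \<omega>))) + Z t \<omega>"
      unfolding set_lebesgue_integral_eq_integral_continuous[OF c] .
  qed
  have ind: "P.indep_var borel \<psi> borel (\<lambda>\<omega>. bv n \<bullet> (Z t \<omega> - S (t - s) (Z s \<omega>)))"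
    if st: "0 \<le> s" "s < t" "t \<le> T" and \<psi>: "\<psi> \<in> borel_measurable (Filt s)" for s t n and \<psi> :: "'w \<Rightarrow> real"
  proof (rule indep_coord[OF P sub \<gamma>0 _ _ \<psi>])
    have sT: "s \<in> {0..T}" and tT: "t \<in> {0..T}" using st by auto
    show "s \<in> {0..T}" by (rule sT)
    have [measurable]: "Z t \<in> borel_measurable P" "Z s \<in> borel_measurable P" using ZmP sT tT by auto
    have [measurable]: "S (t - s) \<in> borel_measurable borel" using st by (intro measurable_S) simp
    show "(\<lambda>\<omega>. Z t \<omega> - S (t - s) (Z s \<omega>)) \<in> borel_measurable P" by measurable
    show "Z t \<omega> - S (t - s) (Z s \<omega>) \<in> D \<gamma>" if "\<omega> \<in> space P" for \<omega>
      using st ZD[OF sT that] ZD[OF tT that] by (intro frac_dom_diff frac_dom_S) auto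
    show "P.indep_set (sets (vimage_algebra (space P) (\<lambda>\<omega>. Z t \<omega> - S (t - s) (Z s \<omega>)) (frac_borel lam e \<gamma>))) (sets (Filt s))"
      using Z_indep st by blast
  qed
  interpret mild_noise lam e j F F' F'' c K T \<gamma> P Filt \<theta> CZ Z X \<xi> R
  proof (intro mild_noise.intro mild_setting_axioms P mild_noise_axioms.intro)
    show "0 \<le> CZ" by (simp add: CZ_def)
    show "integrable P (Z t)" "integral\<^sup>L P (Z t) = 0" if "t \<in> {0..T}" for t
      using Z_centered that by (auto simp: has_bochner_integral_iff)
  qed (fact \<theta> sub Filt_mono Xm Zm Rm R4 path Z_inc ind)+
  show ?thesis
  proof (intro exI[of _ C_rate] conjI allI impI C_rate_pos)
    fix N M m :: nat assume N: "1 \<le> N" and M: "1 \<le> M" and m: "m \<le> M"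
    define h where "h = T / real M"
    have kh: "real k * T / real M = real k * h" for k by (simp add: h_def)
    have Y0: "Y N M 0 \<omega> = proj e N (\<xi> \<omega>) + proj e N (Z 0 \<omega>)" if "\<omega> \<in> space P" for \<omega>
      using Y_0 N M that by blast
    have YS: "Y N M (Suc k) \<omega> = S h (Y N M k \<omega> + h *\<^sub>R proj e N (drift (Y N M k \<omega>)))
      + proj e N (Z (real (Suc k) * h) \<omega> - S h (Z (real k * h) \<omega>))" if "k < M" "\<omega> \<in> space P" for k \<omega>
      using Y_Suc[rule_format, OF N M that] unfolding drift_def
      by (simp only: kh h_def[symmetric] Suc_eq_plus1)
    show "integrable P (\<lambda>\<omega>. (norm (X (real m * T / real M) \<omega> - Y N M m \<omega>))\<^sup>2)"
      "sqrt (P.expectation (\<lambda>\<omega>. (norm (X (real m * T / real M) \<omega> - Y N M m \<omega>))\<^sup>2))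
        \<le> C_rate * (1 / lam N powr \<gamma> + (1 + ln (real M)) / real M powr (2 * \<theta>))"
      unfolding kh using strong_rate[OF N M m h_def Y0 YS \<xi>m] by auto
  qed
qed

end
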